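(* Let $p$ be a prime, $q=p^r$, $m\ge 1$, let $a,b\in\mathbb{F}_q$ with $a\neq b$, let $\beta\in\mathbb{F}_{q^m}$, and let $d\in\{-1,3\}$, where $p\neq 3$ is assumed if $d=3$. Let $L_{m,d,\beta}=\mathbb{F}_{q^m}(x,y_a,y_b)$ be the function field over $\mathbb{F}_{q^m}$ defined by $$y_a^q-y_a=x+a(\beta+x^d),\qquad y_b^q-y_b=x+b(\beta+x^d).$$ Then the number $N_{m,d}(\beta)$ of rational places (places of degree one) of $L_{m,d,\beta}$ is $$N_{m,d}(\beta)=q^m+1+\sum_{v\in\mathbb{F}_q^*}e(\beta v)\sum_{u}S_d^{(m)}(u,v),$$ where $u$ runs over $\mathbb{F}_q^*$ if $d=-1$ and over $\mathbb{F}_q$ if $d=3$.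
   Context: $\mathrm{Tr}$ denotes the absolute trace $\mathbb{F}_{q^m}\to\mathbb{F}_p$ and $e(z)=\exp(2\pi i\,\mathrm{Tr}(z)/p)$ is the canonical additive character of $\mathbb{F}_{q^m}$. For $u,v\in\mathbb{F}_q$, $S_d^{(m)}(u,v)=\sum_{z}e(uz+vz^d)$, where $z$ runs over $\mathbb{F}_{q^m}^*$ if $d=-1$ and over $\mathbb{F}_{q^m}$ if $d=3$. *)

theory Defs
  imports Complex_Main "HOL-Computational_Algebra.Polynomial"
begin

definition field_embedding :: "('k::field \<Rightarrow> 'l::field) \<Rightarrow> bool" where
  "field_embedding \<iota> \<longleftrightarrow>
     \<iota> 1 = 1 \<and> (\<forall>c d. \<iota> (c + d) = \<iota> c + \<iota> d) \<and> (\<forall>c d. \<iota> (c * d) = \<iota> c * \<iota> d)"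

definition is_subring :: "'l::comm_ring_1 set \<Rightarrow> bool" where
  "is_subring A \<longleftrightarrow> 1 \<in> A \<and> (\<forall>x\<in>A. \<forall>y\<in>A. x - y \<in> A \<and> x * y \<in> A)"

definition is_subfield :: "'l::field set \<Rightarrow> bool" where
  "is_subfield F \<longleftrightarrow> is_subring F \<and> (\<forall>x\<in>F. inverse x \<in> F)"

definition transcendental_over :: "('k::field \<Rightarrow> 'l::field) \<Rightarrow> 'l \<Rightarrow> bool" where
  "transcendental_over \<iota> x \<longleftrightarrow> (\<forall>f :: 'k poly. f \<noteq> 0 \<longrightarrow> poly (map_poly \<iota> f) x \<noteq> 0)"

definition ideal_in :: "'l::comm_ring_1 set \<Rightarrow> 'l set \<Rightarrow> bool" where
  "ideal_in V J \<longleftrightarrow>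
     J \<subseteq> V \<and> 0 \<in> J \<and> (\<forall>x\<in>J. \<forall>y\<in>J. x + y \<in> J) \<and> (\<forall>v\<in>V. \<forall>x\<in>J. v * x \<in> J)"

definition maximal_ideal_in :: "'l::comm_ring_1 set \<Rightarrow> 'l set \<Rightarrow> bool" where
  "maximal_ideal_in V P \<longleftrightarrow>
     ideal_in V P \<and> P \<noteq> V \<and> (\<forall>J. ideal_in V J \<and> P \<subseteq> J \<longrightarrow> J = P \<or> J = V)"

text \<open>
  Below, a function field over a field of constants \<open>K\<close> is a subfield \<open>L\<close> of some ambient
  field; the type \<open>'k\<close> is the field \<open>K\<close>, and \<open>\<iota>\<close> embeds it into \<open>L\<close>.
  Valuation rings of \<open>L/K\<close> and places (the maximal ideals of valuation rings) follow Stichtenoth,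
  ``Algebraic Function Fields and Codes''.
\<close>

definition valuation_ring :: "('k::field \<Rightarrow> 'l::field) \<Rightarrow> 'l set \<Rightarrow> 'l set \<Rightarrow> bool" where
  "valuation_ring \<iota> L V \<longleftrightarrow>
     is_subring V \<and> range \<iota> \<subset> V \<and> V \<subset> L \<and> (\<forall>z\<in>L. z \<in> V \<or> inverse z \<in> V)"

text \<open>
  The classes of the elements of \<open>B\<close> form a \<open>K\<close>-basis of the residue class field \<open>V/P\<close>. Taking
  coefficients 1 and -1 in the second clause shows that distinct elements of \<open>B\<close>
  have distinct classes, so \<open>card B\<close> is the degree of the place \<open>P\<close>.
\<close>

definition residue_basis :: "('k::field \<Rightarrow> 'l::field) \<Rightarrow> 'l set \<Rightarrow> 'l set \<Rightarrow> 'l set \<Rightarrow> bool" where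
  "residue_basis \<iota> V P B \<longleftrightarrow>
     finite B \<and> B \<subseteq> V \<and>
     (\<forall>c. (\<Sum>b\<in>B. \<iota> (c b) * b) \<in> P \<longrightarrow> (\<forall>b\<in>B. c b = 0)) \<and>
     (\<forall>z\<in>V. \<exists>c. z - (\<Sum>b\<in>B. \<iota> (c b) * b) \<in> P)"

definition place_of_degree :: "('k::field \<Rightarrow> 'l::field) \<Rightarrow> 'l set \<Rightarrow> nat \<Rightarrow> 'l set \<Rightarrow> bool" where
  "place_of_degree \<iota> L n P \<longleftrightarrow>
     (\<exists>V. valuation_ring \<iota> L V \<and> maximal_ideal_in V P \<and> (\<exists>B. residue_basis \<iota> V P B \<and> card B = n))"

definition rational_places :: "('k::field \<Rightarrow> 'l::field) \<Rightarrow> 'l set \<Rightarrow> 'l set set" where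
  "rational_places \<iota> L = {P. place_of_degree \<iota> L 1 P}"

text \<open>For \<open>q = p ^ r\<close> and a field \<open>'k\<close> with \<open>q ^ m\<close> elements, this is its subfield with \<open>q\<close> elements.\<close>

definition Fq :: "nat \<Rightarrow> 'k::field set" where
  "Fq q = {c. c ^ q = c}"

definition abs_trace :: "nat \<Rightarrow> nat \<Rightarrow> 'k::field \<Rightarrow> 'k" where
  "abs_trace p n z = (\<Sum>i<n. z ^ (p ^ i))"

text \<open>
  Canonical additive character of a field with \<open>p ^ n\<close> elements; the trace, an element of the
  prime field, is lifted to its representative in \<open>{0..<p}\<close>.
\<close>

definition add_char :: "nat \<Rightarrow> nat \<Rightarrow> 'k::field \<Rightarrow> complex" where
  "add_char p n z =
     exp (2 * of_real pi * \<i> * of_nat (THE j. j < p \<and> of_nat j = abs_trace p n z) / of_nat p)"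

definition S_sum :: "nat \<Rightarrow> nat \<Rightarrow> int \<Rightarrow> 'k::{finite,field} \<Rightarrow> 'k \<Rightarrow> complex" where
  "S_sum p n d u v =
     (\<Sum>z\<in>(if d = -1 then UNIV - {0} else UNIV). add_char p n (u * z + v * z powi d))"

end

theory Submission
  imports Defs "HOL-Computational_Algebra.Primes"
begin

text \<open>
  With \<open>t = (a y\<^sub>b - b y\<^sub>a) / (a - b)\<close> and \<open>s = (y\<^sub>a - y\<^sub>b) / (a - b)\<close> one has \<open>t\<^sup>q - t = x\<close> and
  \<open>s\<^sup>q - s = \<beta> + x\<^sup>d\<close>, so \<open>L\<close> is an Artin-Schreier extension \<open>K(t, s)\<close> of the rational function
  field \<open>K(t)\<close>; for \<open>d = 3\<close> the substitution \<open>s \<mapsto> s - t\<^sup>3\<close> lowers the pole order of the right-hand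
  side at infinity to \<open>2 q + 1\<close>, which is prime to \<open>q\<close>. Every rational place lies over \<open>t = c\<close> for some
  \<open>c \<in> K\<close> or over \<open>t = \<infinity>\<close>. Where the right-hand side is regular, with value \<open>\<gamma>\<close>, the rational
  places correspond to the solutions of \<open>u\<^sup>q - u = \<gamma>\<close> in \<open>K\<close>; at a pole of order prime to \<open>q\<close> the
  extension is totally ramified and there is one place. In both cases the place is the local ring of a
  smooth point of a plane curve, which gives uniqueness and rationality; existence comes from the
  extension theorem for valuation rings, and from conjugating by \<open>s \<mapsto> s - c\<close>, which is possible
  because total ramification somewhere makes \<open>1, s, \<dots>, s\<^bsup>q - 1\<^esup>\<close> independent over \<open>K(t)\<close>. Finally, the
  number of solutions of \<open>u\<^sup>q - u = z\<close> is the character sum over \<open>e (u z)\<close>, \<open>u \<in> F\<^sub>q\<close>.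
\<close>

section \<open>Extension of local rings to valuation rings\<close>

text \<open>The degree of \<open>L\<close> over \<open>K(t)\<close> is not given. If the
  Artin-Schreier equation of \<open>s\<close> were reducible, a solution \<open>c\<close> of
  \<open>c^q - c = \<gamma>\<close> in \<open>K\<close> need not be the residue of \<open>s\<close>
  at any place. A totally ramified point is therefore treated first: \<open>t = \<infinity>\<close>
  for \<open>d = 3\<close>, and \<open>t = 0\<close> for \<open>d = -1\<close>. That a valuation
  ring exists there already forces degree \<open>q\<close>. Orders are never introduced as a
  function: an element of order \<open>e\<close> appears as \<open>\<pi>^e * u\<close> with a unit
  \<open>u\<close>, and the uniformizers are explicit (\<open>1 / (s \<tau>^2)\<close> with
  \<open>\<tau> = 1 / t\<close>, respectively \<open>1 / s\<close>). The exponent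
  \<open>2 q + 1\<close> comes from
  \<open>(t^q - t)^3 = t^(3q) - 3 t^(2q+1) + 3 t^(q+2) - t^3\<close>, where the substitution absorbs
  \<open>t^(3q) - t^3\<close>; the coefficient 3 is nonzero as \<open>p \<noteq> 3\<close>. For
  \<open>d = -1\<close> the right-hand side \<open>\<beta> + 1 / (t^q - t)\<close> has a simple pole
  at each element of \<open>F_q\<close> and the value \<open>\<beta>\<close> at infinity. These
  points carry \<open>q + AS_count \<beta>\<close> places, exactly what turns the terms with
  \<open>u = 0\<close> or \<open>v = 0\<close> of the character sum into
  \<open>q^m + 1\<close>.\<close>

lemma is_subringD:
  assumes "is_subring A"
  shows "1 \<in> A" "0 \<in> A"
    "x \<in> A \<Longrightarrow> y \<in> A \<Longrightarrow> x - y \<in> A"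
    "x \<in> A \<Longrightarrow> y \<in> A \<Longrightarrow> x * y \<in> A"
    "x \<in> A \<Longrightarrow> - x \<in> A"
    "x \<in> A \<Longrightarrow> y \<in> A \<Longrightarrow> x + y \<in> A"
    "x \<in> A \<Longrightarrow> x ^ n \<in> A"
proof -
  show 1: "1 \<in> A" and d: "\<And>x y. x \<in> A \<Longrightarrow> y \<in> A \<Longrightarrow> x - y \<in> A"
    and m: "\<And>x y. x \<in> A \<Longrightarrow> y \<in> A \<Longrightarrow> x * y \<in> A"
    using assms by (auto simp: is_subring_def)
  show z: "0 \<in> A" using d[OF 1 1] by simp
  show u: "- x \<in> A" if "x \<in> A" for x using d[OF z that] by simp
  show "x + y \<in> A" if "x \<in> A" "y \<in> A" for x y using d[OF that(1) u[OF that(2)]] by simp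
  show "x ^ n \<in> A" if "x \<in> A" for x n using that by (induction n) (auto intro: 1 m)
qed

lemma is_subring_sum:
  assumes "is_subring A" "\<And>i. i \<in> I \<Longrightarrow> f i \<in> A"
  shows "(\<Sum>i\<in>I. f i) \<in> A"
  using assms(2) by (induction I rule: infinite_finite_induct) (auto intro: is_subringD[OF assms(1)])

lemma is_subringI:
  assumes "1 \<in> A" "\<And>x y. x \<in> A \<Longrightarrow> y \<in> A \<Longrightarrow> x - y \<in> A"
    "\<And>x y. x \<in> A \<Longrightarrow> y \<in> A \<Longrightarrow> x * y \<in> A"
  shows "is_subring A"
  using assms by (auto simp: is_subring_def)

lemma is_subring_hull: "is_subring (is_subring hull S)"
  by (rule hull_in) (auto simp: is_subring_def)

lemma is_subfield_hull: "is_subfield (is_subfield hull S)"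
  by (rule hull_in) (auto simp: is_subfield_def is_subring_def)

lemma is_subfieldD:
  assumes "is_subfield F"
  shows "is_subring F" "x \<in> F \<Longrightarrow> inverse x \<in> F" "x \<in> F \<Longrightarrow> y \<in> F \<Longrightarrow> x / y \<in> F"
    "x \<in> F \<Longrightarrow> x powi i \<in> F"
proof -
  show r: "is_subring F" and i: "\<And>x. x \<in> F \<Longrightarrow> inverse x \<in> F"
    using assms by (auto simp: is_subfield_def)
  show "x / y \<in> F" if "x \<in> F" "y \<in> F" for x y
    using is_subringD(4)[OF r that(1) i[OF that(2)]] by (simp add: divide_inverse)
  show "x powi i \<in> F" if "x \<in> F" for x and i :: int
    using that i by (auto simp: power_int_def intro: is_subringD[OF r])
qed

section \<open>Polynomials with coefficients in a subring or an ideal\<close>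

definition coeffs_in :: "'a::zero set \<Rightarrow> 'a poly \<Rightarrow> bool" where
  "coeffs_in S f \<longleftrightarrow> (\<forall>i. coeff f i \<in> S)"

lemma coeffs_in_ring:
  assumes "is_subring A" "coeffs_in A f" "coeffs_in A g"
  shows "coeffs_in A (f + g)" "coeffs_in A (f - g)" "coeffs_in A (f * g)" "coeffs_in A (f ^ n)"
proof -
  have mult: "coeffs_in A (f * g)" if "coeffs_in A f" "coeffs_in A g" for f g
    using that by (auto simp: coeffs_in_def coeff_mult intro!: is_subring_sum[OF assms(1)] is_subringD[OF assms(1)])
  show "coeffs_in A (f + g)" "coeffs_in A (f - g)" "coeffs_in A (f * g)"
    using mult assms by (auto simp: coeffs_in_def intro: is_subringD[OF assms(1)])
  show "coeffs_in A (f ^ n)"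
  proof (induction n)
    case 0
    then show ?case using is_subringD[OF assms(1)] by (simp add: coeffs_in_def)
  next
    case (Suc n)
    then show ?case using mult[OF assms(2)] by simp
  qed
qed

lemma coeffs_in_basic:
  assumes "is_subring A"
  shows "coeffs_in A 0" "coeffs_in A 1" "c \<in> A \<Longrightarrow> coeffs_in A [:c:]" "c \<in> A \<Longrightarrow> coeffs_in A (monom c n)"
    "c \<in> A \<Longrightarrow> coeffs_in A f \<Longrightarrow> coeffs_in A (pCons c f)"
    "c \<in> A \<Longrightarrow> coeffs_in A f \<Longrightarrow> coeffs_in A (smult c f)"
  using is_subringD[OF assms]
  by (auto simp: coeffs_in_def coeff_pCons coeff_monom split: nat.split)

lemma poly_mem_subring:
  assumes "is_subring A" "coeffs_in A f" "z \<in> A"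
  shows "poly f z \<in> A"
  using assms(2) by (auto simp: poly_altdef coeffs_in_def intro!: is_subring_sum[OF assms(1)] is_subringD[OF assms(1)] assms(3))

lemma coeffs_in_ideal:
  assumes "ideal_in B J" "is_subring B"
  shows "coeffs_in J f \<Longrightarrow> coeffs_in J g \<Longrightarrow> coeffs_in J (f + g)"
    "coeffs_in B f \<Longrightarrow> coeffs_in J g \<Longrightarrow> coeffs_in J (f * g)"
proof -
  show "coeffs_in J f \<Longrightarrow> coeffs_in J g \<Longrightarrow> coeffs_in J (f + g)"
    using assms by (auto simp: coeffs_in_def ideal_in_def)
  have s: "finite I \<Longrightarrow> (\<And>i. i \<in> I \<Longrightarrow> h i \<in> J) \<Longrightarrow> sum h I \<in> J" for I :: "nat set" and h
    by (induction I rule: finite_induct) (use assms in \<open>auto simp: ideal_in_def\<close>)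
  show "coeffs_in B f \<Longrightarrow> coeffs_in J g \<Longrightarrow> coeffs_in J (f * g)"
    unfolding coeffs_in_def coeff_mult using assms by (auto intro!: s simp: ideal_in_def)
qed

text \<open>An extremal pair \<open>(B, J)\<close> is coded as a single set \<open>B \<times> {True} \<union> J \<times> {False}\<close>, so that
  Zorn's lemma for inclusion applies.\<close>

lemma ex_maximal_ring_ideal:
  fixes A I L :: "'l::field set"
  assumes "is_subring A" "A \<subseteq> L" "ideal_in A I" "1 \<notin> I"
  obtains B J where "is_subring B" "A \<subseteq> B" "B \<subseteq> L" "ideal_in B J" "I \<subseteq> J" "1 \<notin> J"
    "\<And>B' J'. is_subring B' \<Longrightarrow> B \<subseteq> B' \<Longrightarrow> B' \<subseteq> L \<Longrightarrow> ideal_in B' J' \<Longrightarrow> J \<subseteq> J' \<Longrightarrow> 1 \<notin> J' \<Longrightarrow> B' = B \<and> J' = J"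
proof -
  define enc :: "'l set \<Rightarrow> 'l set \<Rightarrow> ('l \<times> bool) set" where "enc B J = B \<times> {True} \<union> J \<times> {False}" for B J
  define fB :: "('l \<times> bool) set \<Rightarrow> 'l set" where "fB C = {z. (z, True) \<in> C}" for C
  define fJ :: "('l \<times> bool) set \<Rightarrow> 'l set" where "fJ C = {z. (z, False) \<in> C}" for C
  have fe[simp]: "fB (enc B J) = B" "fJ (enc B J) = J" for B J by (auto simp: enc_def fB_def fJ_def)
  define S where "S = {C. is_subring (fB C) \<and> A \<subseteq> fB C \<and> fB C \<subseteq> L \<and> ideal_in (fB C) (fJ C) \<and> I \<subseteq> fJ C \<and> 1 \<notin> fJ C}"
  have "\<exists>M\<in>S. \<forall>X\<in>S. M \<subseteq> X \<longrightarrow> X = M"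
  proof (rule subset_Zorn_nonempty)
    have "enc A I \<in> S" using assms by (simp add: S_def)
    then show "S \<noteq> {}" by blast
  next
    fix C assume ne: "C \<noteq> {}" and ch: "subset.chain S C"
    have CS: "X \<in> S" if "X \<in> C" for X using ch that by (auto simp: subset.chain_def)
    have two: "\<exists>Z\<in>C. u \<in> Z \<and> v \<in> Z" if "u \<in> \<Union>C" "v \<in> \<Union>C" for u v
    proof -
      from that obtain X Y where "X \<in> C" "Y \<in> C" "u \<in> X" "v \<in> Y" by blast
      moreover have "X \<subseteq> Y \<or> Y \<subseteq> X" using ch \<open>X \<in> C\<close> \<open>Y \<in> C\<close> by (auto simp: subset.chain_def)
      ultimately show ?thesis by blast
    qed
    obtain X0 where X0: "X0 \<in> C" using ne by blast
    have "is_subring (fB (\<Union>C))"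
    proof (rule is_subringI)
      have "1 \<in> fB X0" using CS[OF X0] by (auto simp: S_def is_subring_def)
      then show "1 \<in> fB (\<Union>C)" using X0 by (auto simp: fB_def)
      fix x y assume "x \<in> fB (\<Union>C)" "y \<in> fB (\<Union>C)"
      then obtain Z where "Z \<in> C" "x \<in> fB Z" "y \<in> fB Z"
        using two[of "(x, True)" "(y, True)"] by (auto simp: fB_def)
      moreover from this have "x - y \<in> fB Z" "x * y \<in> fB Z"
        using CS[of Z] by (auto simp: S_def is_subring_def)
      ultimately show "x - y \<in> fB (\<Union>C)" "x * y \<in> fB (\<Union>C)" by (auto simp: fB_def)
    qed
    moreover have "ideal_in (fB (\<Union>C)) (fJ (\<Union>C))"
      unfolding ideal_in_def
    proof (intro conjI ballI subsetI)
      fix x assume "x \<in> fJ (\<Union>C)"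
      then obtain Z where "Z \<in> C" "x \<in> fJ Z" by (auto simp: fJ_def)
      then have "x \<in> fB Z" using CS[of Z] by (auto simp: S_def ideal_in_def)
      then show "x \<in> fB (\<Union>C)" using \<open>Z \<in> C\<close> by (auto simp: fB_def)
    next
      have "0 \<in> fJ X0" using CS[OF X0] by (auto simp: S_def ideal_in_def)
      then show "0 \<in> fJ (\<Union>C)" using X0 by (auto simp: fJ_def)
    next
      fix x y assume "x \<in> fJ (\<Union>C)" "y \<in> fJ (\<Union>C)"
      then obtain Z where "Z \<in> C" "x \<in> fJ Z" "y \<in> fJ Z"
        using two[of "(x, False)" "(y, False)"] by (auto simp: fJ_def)
      moreover from this have "x + y \<in> fJ Z"
        using CS[of Z] by (auto simp: S_def ideal_in_def)
      ultimately show "x + y \<in> fJ (\<Union>C)" by (auto simp: fJ_def)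
    next
      fix x y assume "x \<in> fB (\<Union>C)" "y \<in> fJ (\<Union>C)"
      then obtain Z where "Z \<in> C" "x \<in> fB Z" "y \<in> fJ Z"
        using two[of "(x, True)" "(y, False)"] by (auto simp: fJ_def fB_def)
      moreover from this have "x * y \<in> fJ Z"
        using CS[of Z] by (auto simp: S_def ideal_in_def)
      ultimately show "x * y \<in> fJ (\<Union>C)" by (auto simp: fJ_def)
    qed
    moreover have "A \<subseteq> fB (\<Union>C)" "I \<subseteq> fJ (\<Union>C)"
      using CS[OF X0] X0 by (auto simp: S_def fB_def fJ_def)
    moreover have "fB (\<Union>C) \<subseteq> L" "1 \<notin> fJ (\<Union>C)"
      using CS by (fastforce simp: S_def fB_def fJ_def)+
    ultimately show "\<Union>C \<in> S" by (simp add: S_def)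
  qed
  then obtain M where M: "M \<in> S" and mx: "\<And>X. X \<in> S \<Longrightarrow> M \<subseteq> X \<Longrightarrow> X = M" by blast
  show ?thesis
  proof (rule that[of "fB M" "fJ M"])
    fix B' J' assume h: "is_subring B'" "fB M \<subseteq> B'" "B' \<subseteq> L" "ideal_in B' J'" "fJ M \<subseteq> J'" "1 \<notin> J'"
    have "enc B' J' \<in> S" using h M by (auto simp: S_def)
    moreover have "M \<subseteq> enc B' J'"
    proof
      fix u assume "u \<in> M"
      then show "u \<in> enc B' J'" using h(2,5) by (cases u; cases "snd u") (auto simp: enc_def fB_def fJ_def)
    qed
    ultimately have "enc B' J' = M" by (rule mx)
    then show "B' = fB M \<and> J' = fJ M" by (metis fe)
  qed (use M in \<open>auto simp: S_def\<close>)
qed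

text \<open>For a valuation ring this is the maximal ideal. Zero is listed separately because
  \<open>inverse 0 = 0\<close> lies in every subring.\<close>

definition nonunits :: "'l::field set \<Rightarrow> 'l set" where
  "nonunits V = {z \<in> V. z = 0 \<or> inverse z \<notin> V}"

text \<open>Adjoining \<open>z\<close> to a maximal pair \<open>(B, J)\<close> gives the ring
  \<open>B[z]\<close> with the ideal \<open>J B[z]\<close>. By maximality this ideal must contain 1,
  which is the relation in question.\<close>

lemma not_in_maximal_ring:
  fixes B J L :: "'l::field set"
  assumes L: "is_subfield L" and B: "is_subring B" "B \<subseteq> L" and J: "ideal_in B J" "1 \<notin> J"
    and mx: "\<And>B' J'. is_subring B' \<Longrightarrow> B \<subseteq> B' \<Longrightarrow> B' \<subseteq> L \<Longrightarrow> ideal_in B' J' \<Longrightarrow> J \<subseteq> J' \<Longrightarrow> 1 \<notin> J' \<Longrightarrow> B' = B"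
    and z: "z \<in> L" "z \<notin> B"
  shows "\<exists>f. coeffs_in J f \<and> poly f z = 1"
proof (rule ccontr)
  assume no: "\<not> ?thesis"
  define B' where "B' = {poly f z |f. coeffs_in B f}"
  define J' where "J' = {poly f z |f. coeffs_in J f}"
  have JB: "J \<subseteq> B" "0 \<in> J" using J by (auto simp: ideal_in_def)
  have "is_subring B'"
  proof (rule is_subringI)
    show "1 \<in> B'" unfolding B'_def using coeffs_in_basic(2)[OF B(1)] by (force intro: exI[of _ 1])
    fix x y assume "x \<in> B'" "y \<in> B'"
    then obtain f g where fg: "x = poly f z" "y = poly g z" "coeffs_in B f" "coeffs_in B g" by (auto simp: B'_def)
    show "x - y \<in> B'" unfolding B'_def mem_Collect_eq
      by (rule exI[of _ "f - g"]) (use fg coeffs_in_ring[OF B(1)] in auto)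
    show "x * y \<in> B'" unfolding B'_def mem_Collect_eq
      by (rule exI[of _ "f * g"]) (use fg coeffs_in_ring[OF B(1)] in auto)
  qed
  moreover have "B \<subseteq> B'"
  proof
    fix x assume "x \<in> B"
    then show "x \<in> B'" unfolding B'_def mem_Collect_eq
      by (intro exI[of _ "[:x:]"]) (use coeffs_in_basic[OF B(1)] in auto)
  qed
  moreover have "B' \<subseteq> L"
  proof
    fix u assume "u \<in> B'"
    then obtain f where "u = poly f z" "coeffs_in L f" using B(2) by (auto simp: B'_def coeffs_in_def)
    then show "u \<in> L" using poly_mem_subring[OF is_subfieldD(1)[OF L] _ z(1)] by simp
  qed
  moreover have "ideal_in B' J'"
    unfolding ideal_in_def
  proof (intro conjI ballI)
    show "J' \<subseteq> B'" using JB by (fastforce simp: B'_def J'_def coeffs_in_def)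
    show "0 \<in> J'" unfolding J'_def mem_Collect_eq
      by (rule exI[of _ 0]) (use JB in \<open>auto simp: coeffs_in_def\<close>)
    show "x + y \<in> J'" if xy: "x \<in> J'" "y \<in> J'" for x y
    proof -
      from xy obtain f g where "x = poly f z" "y = poly g z" "coeffs_in J f" "coeffs_in J g" by (auto simp: J'_def)
      then show ?thesis unfolding J'_def mem_Collect_eq
        by (intro exI[of _ "f + g"]) (use coeffs_in_ideal[OF J(1) B(1)] in auto)
    qed
    show "x * y \<in> J'" if xy: "x \<in> B'" "y \<in> J'" for x y
    proof -
      from xy obtain f g where "x = poly f z" "y = poly g z" "coeffs_in B f" "coeffs_in J g" by (auto simp: J'_def B'_def)
      then show ?thesis unfolding J'_def mem_Collect_eq
        by (intro exI[of _ "f * g"]) (use coeffs_in_ideal[OF J(1) B(1)] in auto)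
    qed
  qed
  moreover have "J \<subseteq> J'"
  proof
    fix x assume "x \<in> J"
    then show "x \<in> J'" unfolding J'_def mem_Collect_eq
      by (intro exI[of _ "[:x:]"]) (use JB in \<open>auto simp: coeffs_in_def coeff_pCons split: nat.split\<close>)
  qed
  moreover have "1 \<notin> J'" using no by (auto simp: J'_def)
  ultimately have "B' = B" by (rule mx)
  moreover have "z \<in> B'" unfolding B'_def mem_Collect_eq
    by (rule exI[of _ "[:0, 1:]"]) (use coeffs_in_basic[OF B(1)] is_subringD[OF B(1)] in auto)
  ultimately show False using z by blast
qed

text \<open>Allowing \<open>n\<close> beyond the degree of \<open>f\<close> lets a relation in
  \<open>1 / z\<close> be compared with a longer relation in \<open>z\<close>.\<close>

lemma poly_inverse_mult_power:
  fixes z :: "'a::field"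
  assumes "z \<noteq> 0" "degree f \<le> n"
  shows "z ^ n * poly f (inverse z) = (\<Sum>i\<le>n. coeff f i * z ^ (n - i))"
proof -
  have "poly f (inverse z) = (\<Sum>i\<le>n. coeff f i * inverse z ^ i)"
    unfolding poly_altdef using assms(2) by (intro sum.mono_neutral_left) (auto simp: coeff_eq_0)
  then have "z ^ n * poly f (inverse z) = (\<Sum>i\<le>n. coeff f i * (z ^ n * inverse z ^ i))"
    by (simp add: sum_distrib_left mult.left_commute)
  also have "\<dots> = (\<Sum>i\<le>n. coeff f i * z ^ (n - i))"
    by (rule sum.cong) (use assms(1) in \<open>auto simp: power_diff field_simps\<close>)
  finally show ?thesis .
qed

text \<open>Chevalley's extension theorem. If neither \<open>z\<close> nor its inverse lies in the
  ring \<open>B\<close> of a maximal pair, then 1 is a polynomial with coefficients in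
  \<open>J\<close> both in \<open>z\<close> and in \<open>1 / z\<close>. Any such two relations
  yield a pair of smaller total degree, which cannot go on for ever.\<close>

lemma extend_to_valuation_ring:
  fixes A I L :: "'l::field set"
  assumes L: "is_subfield L" and A: "is_subring A" "A \<subseteq> L" "ideal_in A I" "1 \<notin> I"
  obtains V where "is_subring V" "A \<subseteq> V" "V \<subseteq> L" "I \<subseteq> nonunits V" "\<And>z. z \<in> L \<Longrightarrow> z \<in> V \<or> inverse z \<in> V"
proof -
  from ex_maximal_ring_ideal[OF A] obtain B J where
    B: "is_subring B" "A \<subseteq> B" "B \<subseteq> L" and J: "ideal_in B J" "I \<subseteq> J" "1 \<notin> J"
    and mx: "\<And>B' J'. is_subring B' \<Longrightarrow> B \<subseteq> B' \<Longrightarrow> B' \<subseteq> L \<Longrightarrow> ideal_in B' J' \<Longrightarrow> J \<subseteq> J' \<Longrightarrow> 1 \<notin> J' \<Longrightarrow> B' = B \<and> J' = J"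
    by metis
  note Jm = J(1)[unfolded ideal_in_def]
  have Jmult: "u \<in> B \<Longrightarrow> v \<in> J \<Longrightarrow> v * u \<in> J" for u v using Jm by (metis mult.commute)
  have Jsum: "finite S \<Longrightarrow> (\<And>i. i \<in> S \<Longrightarrow> h i \<in> J) \<Longrightarrow> sum h S \<in> J" for S :: "nat set" and h
    by (induction S rule: finite_induct) (use Jm in auto)
  have key: "\<exists>f. coeffs_in J f \<and> poly f z = 1" if "z \<in> L" "z \<notin> B" for z
    using mx by (intro not_in_maximal_ring[OF L B(1,3) J(1,3) _ that]) blast
  \<comment> \<open>Elements of \<open>1 - J\<close> are units of \<open>B\<close>: otherwise a
    relation \<open>1 = f(1 / (1 - b))\<close>, cleared of denominators, puts a power of
    \<open>1 - b\<close> into \<open>J\<close>, although that power is congruent to 1 modulo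
    \<open>J\<close>.\<close>
  have inv: "inverse (1 - b) \<in> B" if "b \<in> J" for b
  proof (rule ccontr)
    assume n: "inverse (1 - b) \<notin> B"
    have bB: "b \<in> B" "1 - b \<in> B" using that Jm is_subringD[OF B(1)] by auto
    have ne: "1 - b \<noteq> 0" using that J(3) by auto
    have "inverse (1 - b) \<in> L" using bB B(3) is_subfieldD(2)[OF L] by auto
    from key[OF this n] obtain f where f: "coeffs_in J f" "poly f (inverse (1 - b)) = 1" by blast
    have "(1 - b) ^ degree f = (\<Sum>i\<le>degree f. coeff f i * (1 - b) ^ (degree f - i))"
      using poly_inverse_mult_power[OF ne order_refl, of f] f(2) by simp
    also have "\<dots> \<in> J" using f(1) bB(2) by (intro Jsum Jmult) (auto simp: coeffs_in_def is_subringD[OF B(1)])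
    finally have p: "(1 - b) ^ degree f \<in> J" .
    have "1 - (1 - b) ^ k \<in> J" for k
    proof (induction k)
      case (Suc k)
      have "1 - (1 - b) ^ Suc k = (1 - (1 - b) ^ k) + b * (1 - b) ^ k" by (simp add: algebra_simps)
      also have "\<dots> \<in> J" using Suc Jmult[OF is_subringD(7)[OF B(1) bB(2)] that] Jm by blast
      finally show ?case .
    qed (use Jm in auto)
    then have "(1 - (1 - b) ^ degree f) + (1 - b) ^ degree f \<in> J" using p Jm by blast
    then show False using J(3) by simp
  qed
  have main: False if z: "z \<in> L" "z \<notin> B" "inverse z \<notin> B" for z
  proof -
    \<comment> \<open>Induction on the sum of the degrees. The element \<open>w\<close> is arbitrary
      so that the two relations can change places, with \<open>inverse w\<close> for
      \<open>w\<close>, once the longer one has become the shorter one.\<close>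
    have no: "\<not> (coeffs_in J f \<and> coeffs_in J g \<and> poly f w = 1 \<and> poly g (inverse w) = 1)"
      if "w \<in> L" "w \<noteq> 0" "degree g \<le> degree f" for f g w
      using that
    proof (induction "degree f + degree g" arbitrary: f g w rule: less_induct)
      case less
      show ?case
      proof
        assume h: "coeffs_in J f \<and> coeffs_in J g \<and> poly f w = 1 \<and> poly g (inverse w) = 1"
        define n m where "n = degree f" and "m = degree g"
        have fc: "coeff f i \<in> J" "coeff g i \<in> J" for i using h by (auto simp: coeffs_in_def)
        have npos: "n \<noteq> 0"
        proof
          assume "n = 0"
          then have "poly f w = coeff f 0" by (simp add: poly_altdef n_def)
          then show False using h J(3) fc by metis
        qed
        \<comment> \<open>Multiplied by \<open>w^n\<close>, the relation in \<open>1 / w\<close>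
          reads \<open>(1 - g_0) w^n = g_1 w^(n-1) + \<dots> + g_m w^(n-m)\<close>. As
          \<open>1 - g_0\<close> is a unit of \<open>B\<close>, this expresses \<open>w^n\<close> by
          lower powers with coefficients in \<open>J\<close>.\<close>
        define v where "v = inverse (1 - coeff g 0)"
        have "coeff g 0 \<noteq> 1" using J(3) fc(2)[of 0] by metis
        then have v: "v \<in> B" "v * (1 - coeff g 0) = 1"
          using inv[OF fc(2)] by (auto simp: v_def)
        define b where "b i = v * coeff g i" for i
        have bJ: "b i \<in> J" for i using Jm v(1) fc by (auto simp: b_def)
        define P where "P = (\<Sum>i=1..m. monom (b i) (n - i))"
        have cP: "coeffs_in J P" unfolding coeffs_in_def P_def coeff_sum
          using bJ Jm by (auto intro!: Jsum)
        have dP: "degree P < n" unfolding P_def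
          using npos by (intro degree_sum_less) (auto intro: le_less_trans[OF degree_monom_le])
        have wP: "w ^ n = poly P w"
        proof -
          have mn: "m \<le> n" using less.prems by (simp add: m_def n_def)
          have "w ^ n = w ^ n * poly g (inverse w)" using h by simp
          also have "\<dots> = (\<Sum>i\<le>n. coeff g i * w ^ (n - i))"
            using poly_inverse_mult_power[OF less.prems(2), of g n] mn by (simp add: m_def)
          also have "\<dots> = (\<Sum>i\<le>m. coeff g i * w ^ (n - i))"
            using mn by (intro sum.mono_neutral_right) (auto simp: m_def coeff_eq_0)
          also have "{..m} = insert 0 {1..m}" by auto
          also have "(\<Sum>i\<in>insert 0 {1..m}. coeff g i * w ^ (n - i)) = coeff g 0 * w ^ n + (\<Sum>i=1..m. coeff g i * w ^ (n - i))"
            by simp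
          finally have "(1 - coeff g 0) * w ^ n = (\<Sum>i=1..m. coeff g i * w ^ (n - i))"
            by (simp add: algebra_simps)
          then have "v * ((1 - coeff g 0) * w ^ n) = (\<Sum>i=1..m. b i * w ^ (n - i))"
            by (simp add: b_def sum_distrib_left mult.assoc)
          then show ?thesis using v(2) by (simp add: P_def poly_sum poly_monom mult.assoc[symmetric])
        qed
        \<comment> \<open>The leading term of \<open>f\<close> is replaced by that expression: the
          degree drops and the value at \<open>w\<close> stays 1.\<close>
        define f' where "f' = f - monom (coeff f n) n + smult (coeff f n) P"
        have "poly f' w = 1" using h wP by (simp add: f'_def poly_monom)
        moreover have "coeffs_in J f'" unfolding coeffs_in_def
        proof
          fix i
          have "coeff (f - monom (coeff f n) n) i \<in> J" using fc Jm by (simp add: coeff_monom)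
          moreover have "coeff f n * coeff P i \<in> J"
            using Jmult[of "coeff P i" "coeff f n"] fc cP Jm by (auto simp: coeffs_in_def)
          ultimately show "coeff f' i \<in> J" using Jm by (simp add: f'_def)
        qed
        moreover have "degree f' < n"
        proof -
          have "degree (f - monom (coeff f n) n) < n"
          proof (rule degree_lessI)
            show "f - monom (coeff f n) n \<noteq> 0 \<or> 0 < n" using npos by blast
            show "\<forall>k\<ge>n. coeff (f - monom (coeff f n) n) k = 0"
              by (auto simp: n_def coeff_monom coeff_eq_0)
          qed
          moreover have "degree (smult (coeff f n) P) < n" using dP by (metis degree_smult_le le_less_trans)
          ultimately show ?thesis unfolding f'_def by (rule degree_add_less)
        qed
        moreover have w': "inverse w \<in> L" "inverse w \<noteq> 0" using less.prems is_subfieldD(2)[OF L] by auto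
        ultimately show False
          using less.hyps[of f' g w] less.hyps[of g f' "inverse w"] less.prems h
          by (cases "m \<le> degree f'") (auto simp: n_def m_def)
      qed
    qed
    have z0: "z \<noteq> 0" using z is_subringD(2)[OF B(1)] by auto
    have zi: "inverse z \<in> L" using z is_subfieldD(2)[OF L] by auto
    obtain f g where "coeffs_in J f" "poly f z = 1" "coeffs_in J g" "poly g (inverse z) = 1"
      using key[OF z(1,2)] key[OF zi z(3)] by blast
    then show False
      using no[of z g f] no[of "inverse z" f g] z0 z zi by (cases "degree g \<le> degree f") auto
  qed
  have "J \<subseteq> nonunits B"
  proof
    fix j assume j: "j \<in> J"
    then have "j \<in> B" using Jm by auto
    moreover have "inverse j \<notin> B" if "j \<noteq> 0"
      using Jmult[of "inverse j" j] j J(3) that by auto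
    ultimately show "j \<in> nonunits B" by (auto simp: nonunits_def)
  qed
  then show ?thesis using that[OF B(1,2,3)] J(2) main by blast
qed

section \<open>Valuation rings over a field of constants\<close>

text \<open>Closure under sums uses the dichotomy: one of \<open>x / y\<close> and
  \<open>y / x\<close> lies in \<open>V\<close>, and \<open>x + y = (x / y + 1) y\<close>. A proper
  ideal contains no unit, so \<open>nonunits V\<close> contains every proper ideal.\<close>

lemma nonunits_maximal_ideal:
  assumes "is_subring V" "V \<subseteq> L" "is_subfield L" "\<And>z. z \<in> L \<Longrightarrow> z \<in> V \<or> inverse z \<in> V"
  shows "ideal_in V (nonunits V)" "maximal_ideal_in V P \<longleftrightarrow> P = nonunits V"
proof -
  note r = is_subringD[OF assms(1)]
  have mult: "v * x \<in> nonunits V" if "v \<in> V" "x \<in> nonunits V" for v x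
  proof (cases "v * x = 0")
    case True
    have "0 \<in> nonunits V" using r(2) by (simp add: nonunits_def)
    then show ?thesis using True by metis
  next
    case False
    have "inverse (v * x) \<notin> V"
    proof
      assume "inverse (v * x) \<in> V"
      then have "v * inverse (v * x) \<in> V" using that r by blast
      moreover have "v * inverse (v * x) = inverse x" using False by (simp add: field_simps)
      ultimately have "inverse x \<in> V" by (simp only:)
      then show False using that False by (auto simp: nonunits_def)
    qed
    then show ?thesis using that r by (auto simp: nonunits_def)
  qed
  have add': "x + y \<in> nonunits V" if "x \<in> nonunits V" "y \<in> nonunits V" "y \<noteq> 0" "x / y \<in> V" for x y
  proof -
    have "(x / y + 1) * y \<in> nonunits V" using that r by (intro mult) auto
    then show ?thesis using that by (simp add: algebra_simps)
  qed
  have add: "x + y \<in> nonunits V" if "x \<in> nonunits V" "y \<in> nonunits V" for x y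
  proof (cases "x = 0 \<or> y = 0")
    case False
    have "x / y \<in> L" using that assms(2) is_subfieldD(3)[OF assms(3)] by (auto simp: nonunits_def)
    then have "x / y \<in> V \<or> y / x \<in> V" using assms(4)[of "x / y"] by simp
    then show ?thesis using add'[of x y] add'[of y x] that False by (auto simp: add.commute)
  qed (use that in auto)
  show I: "ideal_in V (nonunits V)"
    unfolding ideal_in_def using mult add r by (auto simp: nonunits_def)
  have I1: "J \<subseteq> nonunits V" if "ideal_in V J" "J \<noteq> V" for J
  proof
    fix x assume x: "x \<in> J"
    then have "x \<in> V" using that by (auto simp: ideal_in_def)
    moreover have "inverse x \<notin> V" if "x \<noteq> 0"
    proof
      assume "inverse x \<in> V"
      then have "inverse x * x \<in> J" using x \<open>ideal_in V J\<close> by (auto simp: ideal_in_def)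
      then have "1 \<in> J" using that by simp
      then have "v \<in> J" if "v \<in> V" for v using \<open>ideal_in V J\<close> that by (force simp: ideal_in_def)
      then show False using \<open>ideal_in V J\<close> \<open>J \<noteq> V\<close> by (auto simp: ideal_in_def)
    qed
    ultimately show "x \<in> nonunits V" by (auto simp: nonunits_def)
  qed
  have "1 \<notin> nonunits V" using r(1) by (simp add: nonunits_def)
  then have "nonunits V \<noteq> V" using r(1) by blast
  then have "maximal_ideal_in V (nonunits V)"
    unfolding maximal_ideal_in_def using I I1 by blast
  moreover have "P = nonunits V" if "maximal_ideal_in V P"
  proof -
    have "ideal_in V P" "P \<noteq> V" using that by (auto simp: maximal_ideal_in_def)
    then have "P \<subseteq> nonunits V" by (rule I1)
    then show ?thesis using that I \<open>nonunits V \<noteq> V\<close> unfolding maximal_ideal_in_def by blast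
  qed
  ultimately show "maximal_ideal_in V P \<longleftrightarrow> P = nonunits V" by blast
qed

section \<open>Polynomials, rational functions and generated fields over the constants\<close>

definition ev :: "('k::field \<Rightarrow> 'l::field) \<Rightarrow> 'k poly \<Rightarrow> 'l \<Rightarrow> 'l" where
  "ev \<iota> f z = poly (map_poly \<iota> f) z"

locale field_emb =
  fixes \<iota> :: "'k::field \<Rightarrow> 'l::field"
  assumes embedding: "field_embedding \<iota>"
begin

lemma emb_simps [simp]:
  "\<iota> 1 = 1" "\<iota> 0 = 0" "\<iota> (c + d) = \<iota> c + \<iota> d" "\<iota> (c * d) = \<iota> c * \<iota> d" "\<iota> (- c) = - \<iota> c"
  "\<iota> (c - d) = \<iota> c - \<iota> d" "\<iota> (c ^ n) = \<iota> c ^ n" "\<iota> (inverse c) = inverse (\<iota> c)"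
  "\<iota> (c / d) = \<iota> c / \<iota> d"
  "\<iota> (of_nat n) = of_nat n" "\<iota> c = 0 \<longleftrightarrow> c = 0" "\<iota> c = \<iota> d \<longleftrightarrow> c = d"
proof -
  have 1: "\<iota> 1 = 1" and a: "\<And>c d. \<iota> (c + d) = \<iota> c + \<iota> d" and m: "\<And>c d. \<iota> (c * d) = \<iota> c * \<iota> d"
    using embedding by (auto simp: field_embedding_def)
  show z: "\<iota> 0 = 0" using a[of 0 0] by (metis add_cancel_right_right)
  show n: "\<iota> (- c) = - \<iota> c" for c using a[of c "- c"] z by (simp add: eq_neg_iff_add_eq_0 add.commute)
  show d: "\<iota> (c - d) = \<iota> c - \<iota> d" for c d using a[of c "- d"] n by simp
  show "\<iota> (c ^ n) = \<iota> c ^ n" for c n by (induction n) (auto simp: 1 m)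
  show z0: "\<iota> c = 0 \<longleftrightarrow> c = 0" for c
  proof
    assume "\<iota> c = 0"
    then have "\<iota> (c * inverse c) = 0" by (simp add: m)
    then show "c = 0" using 1 by (cases "c = 0") auto
  qed (simp add: z)
  show i: "\<iota> (inverse c) = inverse (\<iota> c)" for c
  proof (cases "c = 0")
    case False
    then have "\<iota> c * \<iota> (inverse c) = 1" using m[of c "inverse c"] 1 by simp
    then show ?thesis by (rule inverse_unique[symmetric])
  qed (simp add: z)
  show "\<iota> (c / d) = \<iota> c / \<iota> d" by (simp add: divide_inverse m i)
  show "\<iota> (of_nat n) = of_nat n" by (induction n) (auto simp: z a 1)
  show "\<iota> c = \<iota> d \<longleftrightarrow> c = d" using z0[of "c - d"] d by simp
  show "\<iota> 1 = 1" "\<iota> (c + d) = \<iota> c + \<iota> d" "\<iota> (c * d) = \<iota> c * \<iota> d" by (fact 1 a m)+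
qed

lemma ev_simps [simp]:
  "ev \<iota> 0 z = 0" "ev \<iota> 1 z = 1" "ev \<iota> (pCons c f) z = \<iota> c + z * ev \<iota> f z"
  "ev \<iota> (f + g) z = ev \<iota> f z + ev \<iota> g z" "ev \<iota> (smult c f) z = \<iota> c * ev \<iota> f z"
  "ev \<iota> (f * g) z = ev \<iota> f z * ev \<iota> g z" "ev \<iota> (- f) z = - ev \<iota> f z"
  "ev \<iota> (f - g) z = ev \<iota> f z - ev \<iota> g z" "ev \<iota> (f ^ n) z = ev \<iota> f z ^ n"
proof -
  show 0: "ev \<iota> 0 z = 0" and 1: "ev \<iota> 1 z = 1" and p: "\<And>c f. ev \<iota> (pCons c f) z = \<iota> c + z * ev \<iota> f z"
    by (simp_all add: ev_def map_poly_pCons)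
  show a: "ev \<iota> (f + g) z = ev \<iota> f z + ev \<iota> g z" for f g
    by (induction f g rule: poly_induct2) (auto simp: 0 p algebra_simps)
  show s: "ev \<iota> (smult c f) z = \<iota> c * ev \<iota> f z" for f c
    by (induction f) (auto simp: 0 p algebra_simps)
  show m: "ev \<iota> (f * g) z = ev \<iota> f z * ev \<iota> g z" for f g
    by (induction f) (auto simp: 0 p a s algebra_simps)
  show n: "ev \<iota> (- f) z = - ev \<iota> f z" for f using s[of "-1" f] by simp
  show "ev \<iota> (f - g) z = ev \<iota> f z - ev \<iota> g z" for f g using a[of f "- g"] n by simp
  show "ev \<iota> (f ^ n) z = ev \<iota> f z ^ n" by (induction n) (auto simp: 1 m)
qed

lemma ev_monom [simp]: "ev \<iota> (monom c n) z = \<iota> c * z ^ n"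
  by (simp add: ev_def map_poly_monom poly_monom)

definition pols :: "'l \<Rightarrow> 'l set" where "pols z = range (\<lambda>f. ev \<iota> f z)"

lemma is_subring_pols: "is_subring (pols z)"
proof (rule is_subringI)
  show "1 \<in> pols z" unfolding pols_def by (rule range_eqI[of _ _ 1]) simp
  fix x y assume "x \<in> pols z" "y \<in> pols z"
  then obtain f g where "x = ev \<iota> f z" "y = ev \<iota> g z" by (auto simp: pols_def)
  then have "x - y = ev \<iota> (f - g) z" "x * y = ev \<iota> (f * g) z" by simp_all
  then show "x - y \<in> pols z" "x * y \<in> pols z" unfolding pols_def by blast+
qed

lemma pols_basic: "\<iota> c \<in> pols z" "z \<in> pols z"
proof -
  have "\<iota> c = ev \<iota> [:c:] z" "z = ev \<iota> [:0, 1:] z" by simp_all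
  then show "\<iota> c \<in> pols z" "z \<in> pols z" unfolding pols_def by blast+
qed

definition rats :: "'l \<Rightarrow> 'l set" where
  "rats z = {ev \<iota> f z / ev \<iota> h z |f h. ev \<iota> h z \<noteq> 0}"

lemma fractions_subfield:
  assumes "is_subring R"
  shows "is_subfield {a / b |a b. a \<in> R \<and> b \<in> R \<and> b \<noteq> (0::'l)}" (is "is_subfield ?Q")
  unfolding is_subfield_def
proof (intro conjI ballI is_subringI)
  note r = is_subringD[OF assms]
  have fr: "x / 1 \<in> ?Q" if "x \<in> R" for x
    using that r(1) zero_neq_one[where ?'a='l] unfolding mem_Collect_eq by metis
  show "1 \<in> ?Q" using fr[OF r(1)] by simp
  fix x assume "x \<in> ?Q"
  then obtain a b where ab: "x = a / b" "a \<in> R" "b \<in> R" "b \<noteq> 0" by blast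
  show "inverse x \<in> ?Q"
  proof (cases "a = 0")
    case True
    then show ?thesis using fr[OF r(2)] ab by simp
  next
    case False
    then have "inverse x = b / a" using ab by simp
    then show ?thesis using ab False by blast
  qed
  fix y assume "y \<in> ?Q"
  then obtain c d where cd: "y = c / d" "c \<in> R" "d \<in> R" "d \<noteq> 0" by blast
  have "x - y = (a * d - c * b) / (b * d)" "x * y = (a * c) / (b * d)" "b * d \<noteq> 0"
    using ab cd by (auto simp: field_simps)
  moreover have "a * d - c * b \<in> R" "a * c \<in> R" "b * d \<in> R" using ab cd r by auto
  ultimately show "x - y \<in> ?Q" "x * y \<in> ?Q" by blast+
qed

lemma rats_altdef: "rats z = {a / b |a b. a \<in> pols z \<and> b \<in> pols z \<and> b \<noteq> 0}"
  by (auto simp: rats_def pols_def)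

lemma is_subfield_rats: "is_subfield (rats z)"
  unfolding rats_altdef by (rule fractions_subfield[OF is_subring_pols])

lemma pols_subset_rats: "pols z \<subseteq> rats z"
proof
  fix x assume "x \<in> pols z"
  then have "x = x / 1 \<and> x \<in> pols z \<and> 1 \<in> pols z \<and> (1::'l) \<noteq> 0"
    using is_subringD(1)[OF is_subring_pols] by simp
  then show "x \<in> rats z" unfolding rats_altdef by blast
qed

lemma rats_basic: "\<iota> c \<in> rats z" "z \<in> rats z" "ev \<iota> f z \<in> rats z"
  using pols_basic pols_subset_rats[of z] unfolding pols_def by blast+

lemma pols_subset: "is_subring A \<Longrightarrow> range \<iota> \<subseteq> A \<Longrightarrow> z \<in> A \<Longrightarrow> ev \<iota> f z \<in> A"
  by (induction f) (auto intro!: is_subringD)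

lemma rats_subset: "is_subfield A \<Longrightarrow> range \<iota> \<subseteq> A \<Longrightarrow> z \<in> A \<Longrightarrow> rats z \<subseteq> A"
  unfolding rats_def using pols_subset[OF is_subfieldD(1)] by (auto intro!: is_subfieldD)

definition gen_ring :: "'l set \<Rightarrow> 'l set" where "gen_ring S = is_subring hull (range \<iota> \<union> S)"
definition gen_field :: "'l set \<Rightarrow> 'l set" where "gen_field S = is_subfield hull (range \<iota> \<union> S)"

lemma gen_ring: "is_subring (gen_ring S)" "\<iota> c \<in> gen_ring S" "z \<in> S \<Longrightarrow> z \<in> gen_ring S"
  unfolding gen_ring_def by (auto intro: is_subring_hull hull_inc)

lemma gen_ring_least: "is_subring A \<Longrightarrow> range \<iota> \<subseteq> A \<Longrightarrow> S \<subseteq> A \<Longrightarrow> gen_ring S \<subseteq> A"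
  unfolding gen_ring_def by (rule hull_minimal) auto

lemma gen_field: "is_subfield (gen_field S)" "\<iota> c \<in> gen_field S" "z \<in> S \<Longrightarrow> z \<in> gen_field S"
  unfolding gen_field_def by (auto intro: is_subfield_hull hull_inc)

lemma gen_field_least: "is_subfield A \<Longrightarrow> range \<iota> \<subseteq> A \<Longrightarrow> S \<subseteq> A \<Longrightarrow> gen_field S \<subseteq> A"
  unfolding gen_field_def by (rule hull_minimal) auto

lemma gen_field_eqI: "S \<subseteq> gen_field T \<Longrightarrow> T \<subseteq> gen_field S \<Longrightarrow> gen_field S = gen_field T"
  using gen_field by (intro subset_antisym gen_field_least) auto

lemma gen_field_fractions:
  "gen_field S \<subseteq> {a / b |a b. a \<in> gen_ring S \<and> b \<in> gen_ring S \<and> b \<noteq> 0}"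
proof (rule gen_field_least[OF fractions_subfield[OF gen_ring(1)]])
  have 1: "x \<in> {a / b |a b. a \<in> gen_ring S \<and> b \<in> gen_ring S \<and> b \<noteq> 0}" if "x \<in> gen_ring S" for x
  proof -
    have "x = x / 1 \<and> x \<in> gen_ring S \<and> 1 \<in> gen_ring S \<and> (1::'l) \<noteq> 0"
      using that is_subringD(1)[OF gen_ring(1)] by simp
    then show ?thesis by blast
  qed
  show "range \<iota> \<subseteq> {a / b |a b. a \<in> gen_ring S \<and> b \<in> gen_ring S \<and> b \<noteq> 0}"
    using 1 gen_ring(2) by blast
  show "S \<subseteq> {a / b |a b. a \<in> gen_ring S \<and> b \<in> gen_ring S \<and> b \<noteq> 0}"
    using 1 gen_ring(3) by blast
qed

end

section \<open>Units, residues and rationality for a valuation ring\<close>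

locale valued_field = field_emb \<iota> for \<iota> :: "'k::field \<Rightarrow> 'l::field" +
  fixes L V :: "'l set"
  assumes L: "is_subfield L" and V: "valuation_ring \<iota> L V"
begin

abbreviation M :: "'l set" where "M \<equiv> nonunits V"

lemma V_facts: "is_subring V" "V \<subseteq> L" "\<iota> c \<in> V" "z \<in> L \<Longrightarrow> z \<in> V \<or> inverse z \<in> V"
  using V by (auto simp: valuation_ring_def)

lemmas V_ring = is_subringD[OF V_facts(1)]

lemma ideal_M: "ideal_in V M" and maximal_iff: "maximal_ideal_in V P \<longleftrightarrow> P = M"
  using nonunits_maximal_ideal[OF V_facts(1,2) L] V_facts(4) by blast+

lemma M_facts:
  "x \<in> M \<Longrightarrow> x \<in> V" "0 \<in> M" "x \<in> M \<Longrightarrow> y \<in> M \<Longrightarrow> x + y \<in> M"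
  "v \<in> V \<Longrightarrow> x \<in> M \<Longrightarrow> v * x \<in> M" "v \<in> V \<Longrightarrow> x \<in> M \<Longrightarrow> x * v \<in> M" "x \<in> M \<Longrightarrow> - x \<in> M"
  "x \<in> M \<Longrightarrow> y \<in> M \<Longrightarrow> x - y \<in> M" "1 \<notin> M"
proof -
  show "x \<in> M \<Longrightarrow> x \<in> V" "0 \<in> M" and a: "\<And>x y. x \<in> M \<Longrightarrow> y \<in> M \<Longrightarrow> x + y \<in> M"
    and m: "\<And>v x. v \<in> V \<Longrightarrow> x \<in> M \<Longrightarrow> v * x \<in> M"
    using ideal_M by (auto simp: ideal_in_def)
  show "v \<in> V \<Longrightarrow> x \<in> M \<Longrightarrow> x * v \<in> M" using m by (simp add: mult.commute)
  show n: "x \<in> M \<Longrightarrow> - x \<in> M" for x using m[OF V_ring(5)[OF V_ring(1)]] by force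
  show "x \<in> M \<Longrightarrow> y \<in> M \<Longrightarrow> x - y \<in> M" using a[OF _ n, of x y] by simp
  show "1 \<notin> M" using V_ring(1) by (simp add: nonunits_def)
qed

lemma unitD: "z \<in> V \<Longrightarrow> z \<notin> M \<Longrightarrow> z \<noteq> 0" "z \<in> V \<Longrightarrow> z \<notin> M \<Longrightarrow> inverse z \<in> V"
  "z \<in> V \<Longrightarrow> z \<notin> M \<Longrightarrow> inverse z \<notin> M"
  by (auto simp: nonunits_def)

lemma inverse_M: "z \<in> L \<Longrightarrow> z \<notin> V \<Longrightarrow> inverse z \<in> M"
  using V_facts(4)[of z] by (auto simp: nonunits_def)

lemma not_in_V: "z \<in> M \<Longrightarrow> z \<noteq> 0 \<Longrightarrow> inverse z \<notin> V"
  by (auto simp: nonunits_def)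

lemma M_prime: "x \<in> V \<Longrightarrow> y \<in> V \<Longrightarrow> x * y \<in> M \<Longrightarrow> x \<in> M \<or> y \<in> M"
  using M_facts(4)[of "inverse x" "x * y"] unitD(1,2)[of x]
  by (cases "x \<in> M") (auto simp: mult.assoc[symmetric])

lemma power_M: "x \<in> M \<Longrightarrow> n > 0 \<Longrightarrow> x ^ n \<in> M"
  by (cases n) (auto intro!: M_facts V_ring(7))

definition U :: "'l set" where "U = V - M"

lemma U_facts: "u \<in> U \<Longrightarrow> u \<in> V" "u \<in> U \<Longrightarrow> u \<noteq> 0" "1 \<in> U" "u \<in> U \<Longrightarrow> v \<in> U \<Longrightarrow> u * v \<in> U"
  "u \<in> U \<Longrightarrow> inverse u \<in> U" "u \<in> U \<Longrightarrow> v \<in> U \<Longrightarrow> u / v \<in> U" "u \<in> U \<Longrightarrow> u ^ n \<in> U"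
  "u \<in> U \<Longrightarrow> u powi i \<in> U" "u \<in> U \<Longrightarrow> x \<in> M \<Longrightarrow> u + x \<in> U" "u \<in> U \<Longrightarrow> u \<in> M \<Longrightarrow> False" "u \<in> U \<Longrightarrow> - u \<in> U"
proof -
  show a: "u \<in> U \<Longrightarrow> u \<in> V" "u \<in> U \<Longrightarrow> u \<noteq> 0" and 1: "1 \<in> U" for u
    using unitD V_ring(1) M_facts by (auto simp: U_def)
  show m: "u \<in> U \<Longrightarrow> v \<in> U \<Longrightarrow> u * v \<in> U" for u v using M_prime V_ring(4) by (auto simp: U_def)
  show i: "u \<in> U \<Longrightarrow> inverse u \<in> U" for u using unitD by (auto simp: U_def)
  show "u \<in> U \<Longrightarrow> v \<in> U \<Longrightarrow> u / v \<in> U" using m i by (simp add: divide_inverse)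
  show p: "u \<in> U \<Longrightarrow> u ^ n \<in> U" for u n by (induction n) (auto simp: 1 m)
  show "u \<in> U \<Longrightarrow> u powi i \<in> U" using p i by (auto simp: power_int_def)
  show "u \<in> U \<Longrightarrow> x \<in> M \<Longrightarrow> u + x \<in> U" using V_ring(6) M_facts(7)[of "u + x" x] M_facts(1)[of x] by (auto simp: U_def)
  show "u \<in> U \<Longrightarrow> u \<in> M \<Longrightarrow> False" by (auto simp: U_def)
  show "u \<in> U \<Longrightarrow> - u \<in> U" using V_ring(5) M_facts(6)[of "- u"] by (auto simp: U_def)
qed

lemma const_M: "\<iota> c \<in> M \<longleftrightarrow> c = 0"
  using not_in_V[of "\<iota> c"] V_facts(3)[of "inverse c"] M_facts(2) by auto

text \<open>A relation and not a function: the residue field may be larger than \<open>K\<close>,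
  and then some \<open>z\<close> in \<open>V\<close> has no residue in \<open>K\<close>.\<close>

definition res :: "'l \<Rightarrow> 'k \<Rightarrow> bool" where "res z c \<longleftrightarrow> z \<in> V \<and> z - \<iota> c \<in> M"

lemma resI: "z - \<iota> c \<in> M \<Longrightarrow> res z c"
  using V_ring(6)[OF M_facts(1) V_facts(3)[of c], of "z - \<iota> c"] by (auto simp: res_def)

lemma res_const: "res (\<iota> c) c" using V_facts M_facts by (auto simp: res_def)
lemma res_1: "res 1 1" using res_const[of 1] by simp
lemma res_0: "res z 0 \<longleftrightarrow> z \<in> M" using M_facts by (auto simp: res_def)

lemma res_arith:
  assumes "res z c" "res w d"
  shows "res (z + w) (c + d)" "res (z - w) (c - d)" "res (z * w) (c * d)"
proof -
  have "(z - \<iota> c) + (w - \<iota> d) \<in> M" "(z - \<iota> c) - (w - \<iota> d) \<in> M" using assms M_facts by (auto simp: res_def)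
  then show "res (z + w) (c + d)" "res (z - w) (c - d)" by (auto intro!: resI simp: algebra_simps)
  have "(z - \<iota> c) * w + \<iota> c * (w - \<iota> d) \<in> M" using assms M_facts V_facts by (auto simp: res_def)
  then show "res (z * w) (c * d)" by (auto intro!: resI simp: algebra_simps)
qed

lemma res_unique: "res z c \<Longrightarrow> res z d \<Longrightarrow> c = d"
  using res_arith(2)[of z c z d] const_M[of "c - d"] M_facts(6)[of "\<iota> d - \<iota> c"] by (simp add: res_def)

lemma res_V: "res z c \<Longrightarrow> z \<in> V" by (simp add: res_def)

lemma res_U: "res z c \<Longrightarrow> z \<in> U \<longleftrightarrow> c \<noteq> 0"
  using res_unique[of z c 0] res_0[of z] res_V by (auto simp: U_def)

lemma res_inverse:
  assumes "res z c" "c \<noteq> 0"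
  shows "res (inverse z) (inverse c)"
proof -
  have U: "z \<in> U" using assms res_U by blast
  have z: "z \<noteq> 0" "inverse z \<in> V" using U_facts(2,1)[OF U] U_facts(1)[OF U_facts(5)[OF U]] by auto
  have "\<iota> c - z \<in> M" using M_facts(6)[of "z - \<iota> c"] assms by (simp add: res_def)
  then have "\<iota> (inverse c) * inverse z * (\<iota> c - z) \<in> M"
    using V_ring(4)[OF V_facts(3) z(2)] M_facts(4) by blast
  then show ?thesis using z assms by (auto intro!: resI simp: field_simps)
qed

lemma res_divide: "res z c \<Longrightarrow> res w d \<Longrightarrow> d \<noteq> 0 \<Longrightarrow> res (z / w) (c / d)"
  using res_arith(3)[OF _ res_inverse] by (simp add: divide_inverse)

lemma res_ev: "res z c \<Longrightarrow> res (ev \<iota> f z) (poly f c)"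
  by (induction f) (auto intro!: res_arith res_const simp: res_0 M_facts)

definition rational :: bool where "rational \<longleftrightarrow> (\<forall>z\<in>V. \<exists>c. res z c)"

text \<open>With the power of \<open>X\<close> split off, \<open>f\<close> leaves a cofactor with
  nonzero constant term, and this term is the residue of the cofactor at
  \<open>\<tau>\<close>.\<close>

lemma ev_M_decomp:
  assumes "\<tau> \<in> M" "f \<noteq> 0"
  obtains k u where "ev \<iota> f \<tau> = \<tau> ^ k * u" "u \<in> U"
proof -
  obtain h where h: "f = [:- 0, 1:] ^ order 0 f * h" "\<not> [:- 0, 1:] dvd h"
    using order_decomp[OF assms(2), of 0] by blast
  have "poly h 0 \<noteq> 0" using h(2) by (simp add: poly_eq_0_iff_dvd)
  moreover have "res (ev \<iota> h \<tau>) (poly h 0)" using assms by (intro res_ev) (simp add: res_0)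
  ultimately have "ev \<iota> h \<tau> \<in> U" using res_U by blast
  moreover have "ev \<iota> f \<tau> = \<tau> ^ order 0 f * ev \<iota> h \<tau>" by (subst h(1)) simp
  ultimately show ?thesis using that by blast
qed

end

section \<open>Smooth points\<close>

context field_emb
begin

text \<open>The origin as a point of the plane curve with coordinate functions \<open>\<pi>\<close> and \<open>\<omega>\<close>.\<close>

definition point_ideal :: "'l \<Rightarrow> 'l \<Rightarrow> 'l set" where
  "point_ideal \<pi> \<omega> = {\<pi> * x + \<omega> * y |x y. x \<in> gen_ring {\<pi>, \<omega>} \<and> y \<in> gen_ring {\<pi>, \<omega>}}"

text \<open>Built from \<open>\<pi>\<close> and \<open>\<omega>\<close> alone, without reference to
  a valuation ring, so that identifying a valuation ring with it proves uniqueness.\<close>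

definition local_ring :: "'l \<Rightarrow> 'l \<Rightarrow> 'l set" where
  "local_ring \<pi> \<omega> =
    {x / y |x y. x \<in> gen_ring {\<pi>, \<omega>} \<and> y \<in> gen_ring {\<pi>, \<omega>} \<and> y \<notin> point_ideal \<pi> \<omega>}"

text \<open>Every nonzero \<open>c\<close> divides a nonzero polynomial in \<open>\<tau>\<close>.
  Taking the cofactor from \<open>K[\<tau>, c]\<close> places it in every valuation ring that
  contains \<open>\<tau>\<close> and \<open>c\<close>.\<close>

definition algebraic_ext :: "'l set \<Rightarrow> 'l \<Rightarrow> bool" where
  "algebraic_ext L \<tau> \<longleftrightarrow> (\<forall>c\<in>L. c \<noteq> 0 \<longrightarrow> (\<exists>f. \<exists>c'\<in>gen_ring {\<tau>, c}. ev \<iota> f \<tau> \<noteq> 0 \<and> c * c' = ev \<iota> f \<tau>))"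

text \<open>The elements congruent to a constant modulo the ideal form a ring that contains the
  constants and both generators, hence everything.\<close>

lemma point_ideal_const:
  assumes "z \<in> gen_ring {\<pi>, \<omega>}"
  obtains c where "z - \<iota> c \<in> point_ideal \<pi> \<omega>"
proof -
  define R where "R = gen_ring {\<pi>, \<omega>}"
  note r = is_subringD[OF gen_ring(1)[of "{\<pi>, \<omega>}"], folded R_def]
  note r01 = r(1,2)
  have g: "\<pi> \<in> R" "\<omega> \<in> R" "\<iota> c \<in> R" for c using gen_ring(2,3) by (auto simp: R_def)
  define I where "I = point_ideal \<pi> \<omega>"
  have I: "u \<in> I \<longleftrightarrow> (\<exists>x y. u = \<pi> * x + \<omega> * y \<and> x \<in> R \<and> y \<in> R)" for u
    by (auto simp: I_def point_ideal_def R_def)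
  have IR: "u \<in> R" if "u \<in> I" for u using that I g r by auto
  have Im: "u * v \<in> I" if "u \<in> I" "v \<in> R" for u v
  proof -
    from that obtain x y where "u = \<pi> * x + \<omega> * y" "x \<in> R" "y \<in> R" using I by blast
    then have "u * v = \<pi> * (x * v) + \<omega> * (y * v)" "x * v \<in> R" "y * v \<in> R"
      using that r by (auto simp: algebra_simps)
    then show ?thesis using I by blast
  qed
  have Ia: "u + v \<in> I" "u - v \<in> I" if "u \<in> I" "v \<in> I" for u v
  proof -
    from that obtain x y x' y' where
      "u = \<pi> * x + \<omega> * y" "x \<in> R" "y \<in> R" "v = \<pi> * x' + \<omega> * y'" "x' \<in> R" "y' \<in> R" using I by meson
    then have "u + v = \<pi> * (x + x') + \<omega> * (y + y')" "x + x' \<in> R" "y + y' \<in> R"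
      "u - v = \<pi> * (x - x') + \<omega> * (y - y')" "x - x' \<in> R" "y - y' \<in> R"
      using r by (auto simp: algebra_simps)
    then show "u + v \<in> I" "u - v \<in> I" using I by blast+
  qed
  have I0: "0 \<in> I" using r01 I[of 0] by force
  define A where "A = {u \<in> R. \<exists>c. u - \<iota> c \<in> I}"
  have "gen_ring {\<pi>, \<omega>} \<subseteq> A"
  proof (rule gen_ring_least)
    show "range \<iota> \<subseteq> A"
    proof
      fix u assume "u \<in> range \<iota>"
      then obtain c where "u = \<iota> c" by blast
      then have "u - \<iota> c \<in> I" "u \<in> R" using I0 g by auto
      then show "u \<in> A" unfolding A_def by blast
    qed
    have "\<pi> - \<iota> 0 = \<pi> * 1 + \<omega> * 0" "\<omega> - \<iota> 0 = \<pi> * 0 + \<omega> * 1" by simp_all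
    then have "\<pi> - \<iota> 0 \<in> I" "\<omega> - \<iota> 0 \<in> I" unfolding I using r01 by blast+
    then show "{\<pi>, \<omega>} \<subseteq> A" using g unfolding A_def by blast
    show "is_subring A"
    proof (rule is_subringI)
      have "1 - \<iota> 1 \<in> I" using I0 by simp
      then show "1 \<in> A" using r01 unfolding A_def by blast
      fix u v assume "u \<in> A" "v \<in> A"
      then obtain c d where cd: "u \<in> R" "v \<in> R" "u - \<iota> c \<in> I" "v - \<iota> d \<in> I" by (auto simp: A_def)
      have "(u - v) - \<iota> (c - d) = (u - \<iota> c) - (v - \<iota> d)" by simp
      then have "(u - v) - \<iota> (c - d) \<in> I" using Ia cd by metis
      moreover have "u * v - \<iota> (c * d) = (u - \<iota> c) * v + (v - \<iota> d) * \<iota> c" by (simp add: algebra_simps)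
      then have "u * v - \<iota> (c * d) \<in> I" using Ia Im cd g by metis
      ultimately show "u - v \<in> A" "u * v \<in> A" unfolding A_def using cd r by blast+
    qed
  qed
  then show ?thesis using assms that by (auto simp: A_def I_def)
qed

end

context valued_field
begin

text \<open>Shows that \<open>local_ring\<close> is the localization of
  \<open>K[\<pi>, \<omega>]\<close> at its intersection with \<open>M\<close>: the constant to which
  an element of \<open>M\<close> is congruent lies in \<open>M\<close> itself, so it is 0.\<close>

lemma point_ideal_eq:
  assumes "\<pi> \<in> M" "\<omega> \<in> M"
  shows "gen_ring {\<pi>, \<omega>} \<subseteq> V" "z \<in> gen_ring {\<pi>, \<omega>} \<Longrightarrow> z \<in> point_ideal \<pi> \<omega> \<longleftrightarrow> z \<in> M"
proof -
  show RV: "gen_ring {\<pi>, \<omega>} \<subseteq> V"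
    using assms M_facts(1) V_facts by (intro gen_ring_least) auto
  have IM: "point_ideal \<pi> \<omega> \<subseteq> M"
    unfolding point_ideal_def using RV assms by (auto intro!: M_facts(3,5))
  show "z \<in> point_ideal \<pi> \<omega> \<longleftrightarrow> z \<in> M" if z: "z \<in> gen_ring {\<pi>, \<omega>}"
  proof
    assume "z \<in> M"
    from point_ideal_const[OF z] obtain c where c: "z - \<iota> c \<in> point_ideal \<pi> \<omega>" .
    then have "z - (z - \<iota> c) \<in> M" using IM \<open>z \<in> M\<close> M_facts(7) by blast
    then have "c = 0" using const_M by simp
    then show "z \<in> point_ideal \<pi> \<omega>" using c by simp
  qed (use IM in auto)
qed

text \<open>The relation \<open>\<omega> a = \<pi> b\<close> says that the origin is a smooth point with uniformizer \<open>\<pi>\<close>. An element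
  of the local ring cannot be divisible by all powers of \<open>\<pi>\<close>, since it divides a polynomial in \<open>\<tau>\<close>.\<close>

theorem chart:
  assumes \<pi>: "\<pi> \<in> M" "\<pi> \<noteq> 0" and \<omega>: "\<omega> \<in> M" and Lg: "L \<subseteq> gen_field {\<pi>, \<omega>}"
    and ab: "a \<in> gen_ring {\<pi>, \<omega>}" "a \<in> U" "b \<in> gen_ring {\<pi>, \<omega>}" "\<omega> * a = \<pi> * b"
    and \<tau>: "\<tau> = \<pi> ^ e * u" "u \<in> U" "e > 0"
    and alg: "algebraic_ext L \<tau>"
  shows "V = local_ring \<pi> \<omega>" "rational"
proof -
  define R where "R = gen_ring {\<pi>, \<omega>}"
  have Rs: "is_subring R" using gen_ring(1) by (simp add: R_def)
  note r = is_subringD[OF Rs]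
  note RI = point_ideal_eq[OF \<pi>(1) \<omega>, folded R_def]
  define Q where "Q = {x / y |x y. x \<in> R \<and> y \<in> R \<and> y \<in> U}"
  have Qloc: "Q = local_ring \<pi> \<omega>"
    unfolding Q_def local_ring_def R_def[symmetric] U_def using RI by blast
  have QV: "Q \<subseteq> V" unfolding Q_def using RI(1) V_ring(4) U_facts(1)[OF U_facts(5)]
    by (auto simp: divide_inverse)
  have RQ: "x \<in> Q" if "x \<in> R" for x
  proof -
    have "x = x / 1" by simp
    then show ?thesis unfolding Q_def using that r(1) U_facts(3) by blast
  qed
  have Qm: "x * y \<in> Q" if "x \<in> Q" "y \<in> Q" for x y
  proof -
    from that obtain x1 x2 y1 y2 where
      "x = x1 / x2" "y = y1 / y2" "x1 \<in> R" "x2 \<in> R" "y1 \<in> R" "y2 \<in> R" "x2 \<in> U" "y2 \<in> U"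
      unfolding Q_def by blast
    then have "x * y = (x1 * y1) / (x2 * y2)" "x1 * y1 \<in> R" "x2 * y2 \<in> R" "x2 * y2 \<in> U"
      using r U_facts by auto
    then show ?thesis unfolding Q_def by blast
  qed
  have Qi: "inverse x \<in> Q" if "x \<in> Q" "x \<in> U" for x
  proof -
    from that obtain x1 x2 where x: "x = x1 / x2" "x1 \<in> R" "x2 \<in> R" "x2 \<in> U"
      unfolding Q_def by blast
    then have "x1 = x * x2" using U_facts(2) by auto
    then have "x1 \<in> U" using U_facts(4) that x by blast
    moreover have "inverse x = x2 / x1" using x by simp
    ultimately show ?thesis unfolding Q_def using x by blast
  qed
  have Qn: "x ^ n \<in> Q" if "x \<in> Q" for x n using that RQ[OF r(1)] Qm by (induction n) auto
  \<comment> \<open>By \<open>\<omega> = \<pi> b / a\<close> with a unit \<open>a\<close>, both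
    generators of the point ideal are multiples of \<open>\<pi>\<close> in \<open>Q\<close>.\<close>
  have step: "\<exists>x'\<in>Q. x = \<pi> * x'" if "x \<in> Q" "x \<in> M" for x
  proof -
    from that obtain y z where yz: "x = y / z" "y \<in> R" "z \<in> R" "z \<in> U" unfolding Q_def by blast
    then have "y = x * z" using U_facts(2) by auto
    then have "y \<in> M" using M_facts(5) that U_facts(1) yz by blast
    then obtain v w where vw: "y = \<pi> * v + \<omega> * w" "v \<in> R" "w \<in> R"
      using RI(2)[OF yz(2)] by (auto simp: point_ideal_def R_def)
    have nz: "a \<noteq> 0" "z \<noteq> 0" using ab(2) yz(4) U_facts(2) by auto
    then have "\<omega> = \<pi> * b / a" using ab(4) by (simp add: field_simps)
    then have "x = \<pi> * ((v * a + w * b) / (a * z))" using yz(1) vw(1) nz by (simp add: field_simps)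
    moreover have "v * a + w * b \<in> R" "a * z \<in> R" "a * z \<in> U"
      using ab vw yz r U_facts unfolding R_def[symmetric] by auto
    ultimately show ?thesis unfolding Q_def by blast
  qed
  \<comment> \<open>Dividing by \<open>\<pi>\<close> until the cofactor is a unit must end;
    otherwise \<open>c\<close> would be divisible in \<open>Q\<close> by every power of
    \<open>\<pi>\<close>.\<close>
  have decomp: "\<exists>n w. w \<in> Q \<and> w \<in> U \<and> c = \<pi> ^ n * w" if c: "c \<in> R" "c \<noteq> 0" for c
  proof (rule ccontr)
    assume no: "\<not> ?thesis"
    have all: "\<exists>w\<in>Q. c = \<pi> ^ n * w" for n
    proof (induction n)
      case 0
      then show ?case using RQ c by auto
    next
      case (Suc n)
      then obtain w where w: "w \<in> Q" "c = \<pi> ^ n * w" by blast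
      then have "w \<notin> U" using no by blast
      then have "w \<in> M" using w QV by (auto simp: U_def)
      from step[OF w(1) this] show ?case using w(2) by (auto simp: ac_simps)
    qed
    have \<tau>M: "\<tau> \<in> M" using \<tau> \<pi> power_M M_facts(5) U_facts(1) by blast
    have cV: "c \<in> V" using c RI(1) by auto
    then have "c \<in> L" using V_facts(2) by auto
    then obtain f c' where f: "ev \<iota> f \<tau> \<noteq> 0" "c' \<in> gen_ring {\<tau>, c}" "c * c' = ev \<iota> f \<tau>"
      using alg c(2) unfolding algebraic_ext_def by blast
    have "gen_ring {\<tau>, c} \<subseteq> V" using V_facts cV M_facts(1)[OF \<tau>M] by (intro gen_ring_least) auto
    then have c': "c' \<in> V" using f(2) by auto
    have "f \<noteq> 0" using f(1) by auto
    then obtain k v where kv: "ev \<iota> f \<tau> = \<tau> ^ k * v" "v \<in> U" using ev_M_decomp[OF \<tau>M] by blast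
    have "ev \<iota> f \<tau> = \<pi> ^ (e * k) * (u ^ k * v)"
      unfolding kv(1) unfolding \<tau>(1) by (simp add: power_mult_distrib power_mult)
    moreover have uv: "u ^ k * v \<in> U" using \<tau>(2) kv(2) by (intro U_facts(4,7))
    \<comment> \<open>Since \<open>f(\<tau>)\<close> is \<open>\<pi>^(e k)\<close> times a unit, one
      more factor \<open>\<pi>\<close> in its divisor \<open>c\<close> is impossible.\<close>
    moreover obtain w where w: "w \<in> Q" "c = \<pi> ^ (Suc (e * k)) * w" using all by blast
    ultimately have "\<pi> ^ (e * k) * (\<pi> * (w * c')) = \<pi> ^ (e * k) * (u ^ k * v)"
      using f(3) by (simp add: ac_simps)
    then have "u ^ k * v = \<pi> * (w * c')" using \<pi>(2) by simp
    also have "\<dots> \<in> M" using \<pi>(1) w(1) QV c' by (intro M_facts(5) V_ring) auto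
    finally show False using uv U_facts(10) by blast
  qed
  have "V \<subseteq> Q"
  proof
    fix z assume z: "z \<in> V"
    show "z \<in> Q"
    proof (cases "z = 0")
      case True
      then show ?thesis using RQ r(2) by auto
    next
      case False
      have "z \<in> gen_field {\<pi>, \<omega>}" using z V_facts(2) Lg by auto
      then obtain x y where xy: "z = x / y" "x \<in> R" "y \<in> R" "y \<noteq> 0"
        using gen_field_fractions[of "{\<pi>, \<omega>}"] unfolding R_def by blast
      then have "x \<noteq> 0" using False by auto
      then obtain n v where v: "v \<in> Q" "v \<in> U" "x = \<pi> ^ n * v" using decomp xy by blast
      obtain m w where w: "w \<in> Q" "w \<in> U" "y = \<pi> ^ m * w" using decomp xy by blast
      note nz = U_facts(2)[OF v(2)] U_facts(2)[OF w(2)]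
      show ?thesis
      proof (cases "m \<le> n")
        case True
        then have "z = \<pi> ^ (n - m) * (v * inverse w)"
          using xy(1) v w nz \<pi>(2) by (simp add: power_diff field_simps)
        moreover have "\<pi> \<in> Q" using RQ gen_ring(3)[of \<pi> "{\<pi>, \<omega>}"] by (simp add: R_def)
        ultimately show ?thesis using Qm Qn Qi v w by metis
      next
        case False
        \<comment> \<open>A negative power of \<open>\<pi>\<close> cannot occur:
          \<open>z \<pi>^(m - n)\<close> would be a unit and lie in \<open>M\<close>.\<close>
        then have "z * \<pi> ^ (m - n) = v / w"
          using xy(1) v w nz \<pi>(2) by (simp add: power_diff field_simps)
        moreover have "z * \<pi> ^ (m - n) \<in> M" using z \<pi>(1) False power_M M_facts(4) by simp
        moreover have "v / w \<in> U" using v w U_facts(6) by blast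
        ultimately show ?thesis using U_facts(10) by metis
      qed
    qed
  qed
  then have VQ: "V = Q" using QV by blast
  then show "V = local_ring \<pi> \<omega>" using Qloc by simp
  have Rres: "\<exists>c. res x c" if "x \<in> R" for x
  proof -
    from that obtain c where c: "x - \<iota> c \<in> point_ideal \<pi> \<omega>" using point_ideal_const unfolding R_def by blast
    have "x - \<iota> c \<in> R" using that gen_ring(2) r(3) by (auto simp: R_def)
    then have "x - \<iota> c \<in> M" using c RI(2) by blast
    then show ?thesis using resI by blast
  qed
  show rational unfolding rational_def
  proof
    fix z assume "z \<in> V"
    then have "z \<in> Q" using VQ by blast
    then obtain x y where xy: "z = x / y" "x \<in> R" "y \<in> R" "y \<in> U" unfolding Q_def by blast
    obtain c d where "res x c" "res y d" using Rres xy by blast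
    moreover from this have "d \<noteq> 0" using xy res_U by blast
    ultimately have "res z (c / d)" unfolding xy(1) by (rule res_divide)
    then show "\<exists>c. res z c" by blast
  qed
qed

end

section \<open>Algebraicity and independence in Artin-Schreier extensions\<close>

text \<open>Gaussian elimination by cross-multiplication: no division occurs, so the solution stays
  inside the subring.\<close>

lemma linear_system_solution:
  fixes A :: "'a::idom set" and m :: "'i \<Rightarrow> 'j \<Rightarrow> 'a"
  assumes A: "is_subring A" and "finite I" "finite J" "card I < card J" "\<And>i j. i \<in> I \<Longrightarrow> j \<in> J \<Longrightarrow> m i j \<in> A"
  shows "\<exists>a. (\<forall>j\<in>J. a j \<in> A) \<and> (\<exists>j\<in>J. a j \<noteq> 0) \<and> (\<forall>i\<in>I. (\<Sum>j\<in>J. m i j * a j) = 0)"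
  using assms(2-5)
proof (induction I arbitrary: J m rule: finite_induct)
  case empty
  then have "J \<noteq> {}" by auto
  then show ?case using is_subringD(1)[OF A] by (intro exI[of _ "\<lambda>_. 1"]) auto
next
  case (insert r I)
  note r = is_subringD[OF A]
  show ?case
  proof (cases "\<forall>j\<in>J. m r j = 0")
    case True
    have "\<exists>a. (\<forall>j\<in>J. a j \<in> A) \<and> (\<exists>j\<in>J. a j \<noteq> 0) \<and> (\<forall>i\<in>I. (\<Sum>j\<in>J. m i j * a j) = 0)"
      using insert by (intro insert.IH) auto
    then show ?thesis using True by (auto simp: sum.neutral)
  next
    case False
    then obtain k where k: "k \<in> J" "m r k \<noteq> 0" by blast
    define J' where "J' = J - {k}"
    have J': "finite J'" "J = insert k J'" "k \<notin> J'" using k insert.prems by (auto simp: J'_def)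
    have "\<exists>a. (\<forall>j\<in>J'. a j \<in> A) \<and> (\<exists>j\<in>J'. a j \<noteq> 0)
        \<and> (\<forall>i\<in>I. (\<Sum>j\<in>J'. (m i j * m r k - m r j * m i k) * a j) = 0)"
    proof (rule insert.IH)
      show "card I < card J'" using insert J' by auto
      show "m i j * m r k - m r j * m i k \<in> A" if "i \<in> I" "j \<in> J'" for i j
        using that insert.prems(3) J' by (auto intro!: r(3,4))
    qed (use J' in auto)
    then obtain a where a: "\<And>j. j \<in> J' \<Longrightarrow> a j \<in> A" "\<exists>j\<in>J'. a j \<noteq> 0"
      "\<And>i. i \<in> I \<Longrightarrow> (\<Sum>j\<in>J'. (m i j * m r k - m r j * m i k) * a j) = 0" by blast
    \<comment> \<open>The other unknowns are scaled by the pivot \<open>m r k\<close>, so that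
      equation \<open>r\<close> is solved by the unknown \<open>k\<close> without dividing.\<close>
    define b where "b j = (if j = k then - (\<Sum>j\<in>J'. m r j * a j) else m r k * a j)" for j
    have sb: "(\<Sum>j\<in>J. m i j * b j) = (\<Sum>j\<in>J'. (m i j * m r k - m r j * m i k) * a j)" for i
    proof -
      have "(\<Sum>j\<in>J. m i j * b j) = m i k * b k + (\<Sum>j\<in>J'. m i j * b j)"
        using J' by simp
      also have "(\<Sum>j\<in>J'. m i j * b j) = (\<Sum>j\<in>J'. m i j * (m r k * a j))"
        using J'(3) by (intro sum.cong) (auto simp: b_def)
      finally show ?thesis
        by (simp add: b_def sum_subtractf[symmetric] sum_distrib_left algebra_simps)
    qed
    have "b j \<in> A" if "j \<in> J" for j
      using that a(1) insert.prems(3) k J' by (auto simp: b_def intro!: r(4,5) is_subring_sum[OF A])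
    moreover have "\<exists>j\<in>J. b j \<noteq> 0" using a(2) k J' by (auto simp: b_def)
    moreover have "(\<Sum>j\<in>J. m i j * b j) = 0" if "i \<in> insert r I" for i
    proof (cases "i = r")
      case True
      then show ?thesis unfolding sb by (simp add: mult.commute)
    next
      case False
      then show ?thesis unfolding sb using that a(3) by blast
    qed
    ultimately show ?thesis by blast
  qed
qed

lemma coeffs_in_monic_division:
  fixes A :: "'a::idom set"
  assumes A: "is_subring A" and E: "coeffs_in A E" "lead_coeff E = 1" "0 < degree E" and "coeffs_in A f"
  shows "\<exists>h r. coeffs_in A h \<and> coeffs_in A r \<and> f = E * h + r \<and> degree r < degree E"
  using assms(5)
proof (induction "degree f" arbitrary: f rule: less_induct)
  case less
  show ?case
  proof (cases "degree f < degree E")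
    case True
    then show ?thesis using less.prems coeffs_in_basic(1)[OF A] by (intro exI[of _ 0] exI[of _ f]) auto
  next
    case False
    define k where "k = degree f - degree E"
    define f' where "f' = f - monom (lead_coeff f) k * E"
    have mc: "coeffs_in A (monom (lead_coeff f) k)"
      using less.prems by (intro coeffs_in_basic[OF A]) (auto simp: coeffs_in_def)
    have "degree f' < degree f"
    proof (rule degree_lessI)
      show "f' \<noteq> 0 \<or> 0 < degree f" using False E by auto
      show "\<forall>j\<ge>degree f. coeff f' j = 0"
      proof (intro allI impI)
        fix j assume j: "degree f \<le> j"
        show "coeff f' j = 0"
        proof (cases "j = degree f")
          case True
          then show ?thesis using False E(2) by (simp add: f'_def coeff_monom_mult k_def)
        next
          case False
          then show ?thesis using j \<open>\<not> degree f < degree E\<close>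
            by (simp add: f'_def coeff_monom_mult k_def coeff_eq_0)
        qed
      qed
    qed
    moreover have "coeffs_in A f'" unfolding f'_def using mc E less.prems by (intro coeffs_in_ring[OF A])
    ultimately obtain h r where h: "coeffs_in A h" "coeffs_in A r" "f' = E * h + r" "degree r < degree E"
      using less.hyps by blast
    then have "f = E * (h + monom (lead_coeff f) k) + r" by (simp add: f'_def algebra_simps)
    then show ?thesis using h coeffs_in_ring(1)[OF A h(1) mc] by blast
  qed
qed

lemma poly_as_sum_lessThan:
  fixes x :: "'a::comm_ring_1"
  assumes "degree r < n"
  shows "poly r x = (\<Sum>i<n. coeff r i * x ^ i)"
  unfolding poly_altdef using assms by (intro sum.mono_neutral_left) (auto simp: coeff_eq_0)

lemma algebraic_over_subring:
  fixes A :: "'a::idom set"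
  assumes A: "is_subring A" and E: "coeffs_in A E" "lead_coeff E = 1" "0 < degree E" "poly E s = 0"
    and g: "coeffs_in A g" "c = poly g s" "c \<noteq> 0"
  obtains G where "coeffs_in A G" "coeff G 0 \<noteq> 0" "poly G c = 0"
proof -
  define n where "n = degree E"
  have "\<exists>r. coeffs_in A r \<and> degree r < n \<and> c ^ j = poly r s" for j
  proof -
    have "coeffs_in A (g ^ j)" using g by (intro coeffs_in_ring[OF A])
    then obtain h r where "coeffs_in A r" "g ^ j = E * h + r" "degree r < n"
      using coeffs_in_monic_division[OF A E(1-3)] unfolding n_def by blast
    moreover from this have "c ^ j = poly r s" using E(4) g(2)
      by (metis add_0 mult_zero_left poly_add poly_mult poly_power)
    ultimately show ?thesis by blast
  qed
  then obtain r where r: "\<And>j. coeffs_in A (r j)" "\<And>j. degree (r j) < n" "\<And>j. c ^ j = poly (r j) s" by metis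
  have "\<exists>a. (\<forall>j\<in>{..n}. a j \<in> A) \<and> (\<exists>j\<in>{..n}. a j \<noteq> 0) \<and> (\<forall>i\<in>{..<n}. (\<Sum>j\<in>{..n}. coeff (r j) i * a j) = 0)"
    using r(1) by (intro linear_system_solution[OF A]) (auto simp: coeffs_in_def)
  then obtain a where a: "\<And>j. j \<le> n \<Longrightarrow> a j \<in> A" "\<exists>j\<le>n. a j \<noteq> 0" "\<And>i. i < n \<Longrightarrow> (\<Sum>j\<le>n. coeff (r j) i * a j) = 0"
    by blast
  define G where "G = (\<Sum>j\<le>n. monom (a j) j)"
  have cG: "coeff G j = (if j \<le> n then a j else 0)" for j by (simp add: G_def coeff_sum coeff_monom)
  have "poly G c = (\<Sum>j\<le>n. a j * (\<Sum>i<n. coeff (r j) i * s ^ i))"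
    unfolding G_def poly_sum poly_monom r(3) using poly_as_sum_lessThan[OF r(2)] by simp
  also have "\<dots> = (\<Sum>i<n. (\<Sum>j\<le>n. coeff (r j) i * a j) * s ^ i)"
    by (simp only: sum_distrib_left sum_distrib_right) (subst sum.swap, simp add: ac_simps)
  also have "\<dots> = 0" using a(3) by simp
  finally have G0: "poly G c = 0" .
  \<comment> \<open>Cancelling the power of \<open>c\<close> common to all terms makes the constant
    coefficient nonzero, which is what later allows inverting \<open>c\<close>.\<close>
  define k where "k = (LEAST j. coeff G j \<noteq> 0)"
  have ex: "\<exists>j. coeff G j \<noteq> 0" using a(2) cG by auto
  have k: "coeff G k \<noteq> 0" "\<And>j. j < k \<Longrightarrow> coeff G j = 0"
    unfolding k_def using LeastI_ex[OF ex] not_less_Least by auto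
  have sh: "G = monom 1 k * poly_shift k G"
    by (rule poly_eqI) (auto simp: coeff_monom_mult coeff_poly_shift k(2))
  have "poly (poly_shift k G) c = 0"
  proof -
    have "poly G c = c ^ k * poly (poly_shift k G) c" by (subst sh) (simp add: poly_monom)
    then show ?thesis using G0 g(3) by simp
  qed
  moreover have "coeffs_in A (poly_shift k G)"
    using a(1) is_subringD(2)[OF A] by (auto simp: coeffs_in_def coeff_poly_shift cG)
  moreover have "coeff (poly_shift k G) 0 \<noteq> 0" using k by (simp add: coeff_poly_shift)
  ultimately show ?thesis using that by blast
qed

lemma is_subring_poly_values:
  assumes F: "is_subring F" "F \<subseteq> A" "is_subring A" "s \<in> A"
  shows "is_subring {poly g s |g. coeffs_in F g}" "{poly g s |g. coeffs_in F g} \<subseteq> A"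
    "F \<subseteq> {poly g s |g. coeffs_in F g}" "s \<in> {poly g s |g. coeffs_in F g}"
proof -
  let ?P = "{poly g s |g. coeffs_in F g}"
  have in_P: "coeffs_in F g \<Longrightarrow> z = poly g s \<Longrightarrow> z \<in> ?P" for g z by blast
  show "is_subring ?P"
  proof (rule is_subringI)
    show "1 \<in> ?P" by (rule in_P[OF coeffs_in_basic(2)[OF F(1)]]) simp
    fix x y assume "x \<in> ?P" "y \<in> ?P"
    then obtain f g where fg: "coeffs_in F f" "coeffs_in F g" "x = poly f s" "y = poly g s" by blast
    show "x - y \<in> ?P" by (rule in_P[OF coeffs_in_ring(2)[OF F(1) fg(1,2)]]) (simp add: fg)
    show "x * y \<in> ?P" by (rule in_P[OF coeffs_in_ring(3)[OF F(1) fg(1,2)]]) (simp add: fg)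
  qed
  show "?P \<subseteq> A"
  proof
    fix x assume "x \<in> ?P"
    then obtain f where "x = poly f s" "coeffs_in A f" using F(2) by (auto simp: coeffs_in_def)
    then show "x \<in> A" using poly_mem_subring[OF F(3) _ F(4)] by simp
  qed
  show "F \<subseteq> ?P"
  proof
    fix x assume "x \<in> F"
    then show "x \<in> ?P" by (intro in_P[OF coeffs_in_basic(3)[OF F(1)]]) auto
  qed
  have "coeffs_in F [:0, 1:]" using coeffs_in_basic[OF F(1)] is_subringD[OF F(1)] by blast
  then show "s \<in> ?P" by (rule in_P) simp
qed

text \<open>A relation \<open>a + c G'(c) = 0\<close> with \<open>a \<noteq> 0\<close> gives
  \<open>1 / c = - G'(c) / a\<close>, so \<open>F[s]\<close> is closed under inverses.\<close>

lemma is_subfield_poly_values: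
  fixes F :: "'a::field set"
  assumes F: "is_subfield F" and E: "coeffs_in F E" "lead_coeff E = 1" "0 < degree E" "poly E s = 0"
  shows "is_subfield {poly g s |g. coeffs_in F g}" (is "is_subfield ?P")
proof -
  note Fr = is_subfieldD(1)[OF F]
  have "is_subring (UNIV :: 'a set)" by (simp add: is_subring_def)
  note P = is_subring_poly_values[OF Fr subset_UNIV this UNIV_I, of s]
  have "inverse c \<in> ?P" if "c \<in> ?P" for c
  proof (cases "c = 0")
    case False
    from that obtain g where "coeffs_in F g" "c = poly g s" by blast
    from algebraic_over_subring[OF Fr E this False] obtain G where
      G: "coeffs_in F G" "coeff G 0 \<noteq> 0" "poly G c = 0" .
    obtain a G' where aG: "G = pCons a G'" by (cases G) auto
    have a: "a \<in> F" "a \<noteq> 0" using G by (auto simp: aG coeffs_in_def coeff_pCons split: nat.splits)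
    have "coeffs_in F G'" unfolding coeffs_in_def
    proof
      fix i show "coeff G' i \<in> F" using G(1)[unfolded coeffs_in_def, rule_format, of "Suc i"] by (simp add: aG)
    qed
    then have "coeffs_in ?P G'" using P(3) unfolding coeffs_in_def by blast
    then have "poly G' c \<in> ?P" using poly_mem_subring[OF P(1) _ that] by blast
    moreover have "- inverse a \<in> ?P" using a P(3) is_subfieldD(2)[OF F] is_subringD(5)[OF Fr] by blast
    ultimately have "- inverse a * poly G' c \<in> ?P" using is_subringD(4)[OF P(1)] by blast
    moreover have "inverse c = - inverse a * poly G' c"
    proof -
      have "a + c * poly G' c = 0" using G(3) by (simp add: aG)
      then have "c * poly G' c = - a" by (simp add: eq_neg_iff_add_eq_0 add.commute)
      then have "poly G' c = - a / c" using False by (simp add: field_simps)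
      then show ?thesis using a False by (simp add: field_simps)
    qed
    ultimately show ?thesis by metis
  next
    case True
    then show ?thesis using that by simp
  qed
  then show ?thesis using P(1) by (simp add: is_subfield_def)
qed

definition AS_poly :: "nat \<Rightarrow> 'a::comm_ring_1 \<Rightarrow> 'a poly" where
  "AS_poly q g = monom 1 q - monom 1 1 - [:g:]"

lemma AS_poly:
  assumes "q \<ge> 2"
  shows "degree (AS_poly q (g::'a::field)) = q" "lead_coeff (AS_poly q g) = 1"
    "poly (AS_poly q g) s = s ^ q - s - g"
    "is_subring F \<Longrightarrow> g \<in> F \<Longrightarrow> coeffs_in F (AS_poly q g)"
proof -
  have c: "coeff (AS_poly q g) q = 1" using assms
    by (auto simp: AS_poly_def coeff_monom coeff_pCons split: nat.splits)
  have "degree (AS_poly q g) \<le> q" using assms unfolding AS_poly_def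
    by (intro degree_diff_le order_trans[OF degree_monom_le]) (auto simp: degree_pCons_0)
  then show d: "degree (AS_poly q g) = q" using le_degree[of "AS_poly q g" q] c by auto
  show "lead_coeff (AS_poly q g) = 1" using c d by simp
  show "poly (AS_poly q g) s = s ^ q - s - g" by (simp add: AS_poly_def poly_monom)
  show "is_subring F \<Longrightarrow> g \<in> F \<Longrightarrow> coeffs_in F (AS_poly q g)"
    unfolding AS_poly_def using is_subringD(1) by (intro coeffs_in_ring coeffs_in_basic)
qed

context field_emb
begin

text \<open>As \<open>s\<close> is integral over \<open>K(\<tau>)\<close>, the ring
  \<open>K(\<tau>)[s]\<close> is already a field. This allows maps on \<open>L\<close> to be defined
  by substituting for \<open>s\<close>.\<close>

lemma gen_field_AS:
  assumes "q \<ge> 2" "s ^ q - s \<in> rats \<tau>"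
  shows "gen_field {\<tau>, s} = {poly g s |g. coeffs_in (rats \<tau>) g}" (is "_ = ?P")
proof
  define E where "E = AS_poly q (s ^ q - s)"
  note E = AS_poly[OF assms(1), where g = "s ^ q - s", folded E_def]
  note Fr = is_subfieldD(1)[OF is_subfield_rats[of \<tau>]]
  have ser: "rats \<tau> \<subseteq> gen_field {\<tau>, s}" using gen_field by (intro rats_subset) auto
  note P = is_subring_poly_values[OF Fr ser is_subfieldD(1)[OF gen_field(1)] gen_field(3), of s]
  show "?P \<subseteq> gen_field {\<tau>, s}" using P(2) by simp
  have "is_subfield ?P"
    using E assms by (intro is_subfield_poly_values[OF is_subfield_rats, of _ E]) (auto intro: Fr)
  moreover have "range \<iota> \<subseteq> ?P" using P(3) rats_basic(1) by auto
  moreover have "{\<tau>, s} \<subseteq> ?P" using P(3,4) rats_basic(2) by auto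
  ultimately show "gen_field {\<tau>, s} \<subseteq> ?P" by (rule gen_field_least)
qed

lemma clear_denominators:
  assumes "coeffs_in (rats \<tau>) G"
  shows "\<exists>d\<in>pols \<tau>. d \<noteq> 0 \<and> coeffs_in (pols \<tau>) (smult d G)"
  using assms
proof (induction G)
  case 0
  then show ?case using is_subringD(1,2)[OF is_subring_pols] by (intro bexI[of _ 1]) (auto simp: coeffs_in_def)
next
  case (pCons a G)
  note r = is_subringD[OF is_subring_pols[of \<tau>]]
  have a: "a \<in> rats \<tau>" and G: "coeffs_in (rats \<tau>) G"
    using pCons.prems unfolding coeffs_in_def by (metis coeff_pCons_0, metis coeff_pCons_Suc)
  from pCons.IH[OF G] obtain d where d: "d \<in> pols \<tau>" "d \<noteq> 0" "coeffs_in (pols \<tau>) (smult d G)" by blast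
  from a obtain x y where xy: "a = x / y" "x \<in> pols \<tau>" "y \<in> pols \<tau>" "y \<noteq> 0" unfolding rats_altdef by blast
  have "smult (y * d) (pCons a G) = pCons (d * x) (smult y (smult d G))" using xy by simp
  moreover have "coeffs_in (pols \<tau>) (smult y (smult d G))"
    using d(3) xy(3) coeffs_in_basic(6)[OF is_subring_pols] by blast
  then have "coeffs_in (pols \<tau>) (pCons (d * x) (smult y (smult d G)))"
    using d(1) xy(2) r(4) coeffs_in_basic(5)[OF is_subring_pols] by blast
  ultimately have "coeffs_in (pols \<tau>) (smult (y * d) (pCons a G))" by (simp only:)
  then show ?case using d xy r(4) by (intro bexI[of _ "y * d"]) auto
qed

text \<open>In an equation of \<open>c\<close> over \<open>K(\<tau>)\<close> with nonzero constant
  term the denominators are cleared. The constant term is then a polynomial in \<open>\<tau>\<close>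
  and, by the equation, \<open>c\<close> times an element of \<open>K[\<tau>, c]\<close>.\<close>

lemma algebraic_ext_AS:
  assumes "q \<ge> 2" "s ^ q - s \<in> rats \<tau>"
  shows "algebraic_ext (gen_field {\<tau>, s}) \<tau>"
  unfolding algebraic_ext_def
proof (intro ballI impI)
  fix c assume c: "c \<in> gen_field {\<tau>, s}" "c \<noteq> 0"
  define E where "E = AS_poly q (s ^ q - s)"
  note E = AS_poly[OF assms(1), where g = "s ^ q - s", folded E_def]
  note Fr = is_subfieldD(1)[OF is_subfield_rats[of \<tau>]]
  obtain g where g: "coeffs_in (rats \<tau>) g" "c = poly g s" using c(1) unfolding gen_field_AS[OF assms] by blast
  obtain G where G: "coeffs_in (rats \<tau>) G" "coeff G 0 \<noteq> 0" "poly G c = 0"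
    using algebraic_over_subring[OF Fr, of E s g c] E g c(2) Fr assms by auto
  from clear_denominators[OF G(1)] obtain d where d: "d \<noteq> 0" "coeffs_in (pols \<tau>) (smult d G)" by blast
  obtain a G' where aG: "smult d G = pCons a G'" by (cases "smult d G") auto
  have a: "a = d * coeff G 0" using arg_cong[OF aG, of "\<lambda>p. coeff p 0"] by simp
  have aP: "a \<in> pols \<tau>" and G': "coeffs_in (pols \<tau>) G'"
    using d(2) unfolding coeffs_in_def aG by (metis coeff_pCons_0, metis coeff_pCons_Suc)
  obtain f where f: "a = ev \<iota> f \<tau>" using aP by (auto simp: pols_def)
  have sub: "pols \<tau> \<subseteq> gen_ring {\<tau>, c}"
  proof
    fix x assume "x \<in> pols \<tau>"
    then obtain f where "x = ev \<iota> f \<tau>" by (auto simp: pols_def)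
    then show "x \<in> gen_ring {\<tau>, c}"
      using pols_subset[OF gen_ring(1), of "{\<tau>, c}" \<tau> f] gen_ring(2,3) by auto
  qed
  have "poly G' c \<in> gen_ring {\<tau>, c}"
    using G' sub gen_ring by (intro poly_mem_subring) (auto simp: coeffs_in_def)
  then have "- poly G' c \<in> gen_ring {\<tau>, c}" using is_subringD(5)[OF gen_ring(1)] by blast
  moreover have "c * - poly G' c = a"
  proof -
    have "poly (smult d G) c = 0" using G(3) by simp
    then have "a + c * poly G' c = 0" by (simp add: aG)
    then have "c * poly G' c = - a" by (simp add: add_eq_0_iff)
    then show ?thesis by simp
  qed
  moreover have "a \<noteq> 0" using a d(1) G(2) by simp
  ultimately show "\<exists>f. \<exists>c'\<in>gen_ring {\<tau>, c}. ev \<iota> f \<tau> \<noteq> 0 \<and> c * c' = ev \<iota> f \<tau>"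
    using f by (intro exI[of _ f] bexI[of _ "- poly G' c"]) simp_all
qed

end

section \<open>Orders of elements at a valuation ring\<close>

context valued_field
begin

text \<open>After the least power of \<open>\<pi>\<close> is taken out, exactly one summand is a
  unit and all others lie in \<open>M\<close>.\<close>

lemma sum_distinct_orders_nonzero:
  assumes \<pi>: "\<pi> \<in> M" "\<pi> \<noteq> 0" and I: "finite I" "I \<noteq> {}" "inj_on n I"
    and z: "\<And>i. i \<in> I \<Longrightarrow> u i \<in> U \<and> z i = \<pi> powi n i * u i"
  shows "(\<Sum>i\<in>I. z i) \<noteq> 0"
proof -
  have "Min (n ` I) \<in> n ` I" using I by simp
  then obtain i0 where i0: "i0 \<in> I" "n i0 = Min (n ` I)" by auto
  have le: "n i0 < n i" if "i \<in> I" "i \<noteq> i0" for i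
  proof -
    have "n i0 \<le> n i" using i0 I(1) that by simp
    moreover have "n i0 \<noteq> n i" using inj_onD[OF I(3), of i0 i] i0(1) that by blast
    ultimately show ?thesis by simp
  qed
  have "(\<Sum>i\<in>I. z i) = z i0 + (\<Sum>i\<in>I - {i0}. z i)" using i0 I by (simp add: sum.remove)
  also have "(\<Sum>i\<in>I - {i0}. z i) = \<pi> powi n i0 * (\<Sum>i\<in>I - {i0}. \<pi> powi (n i - n i0) * u i)"
    unfolding sum_distrib_left using z \<pi>(2) by (intro sum.cong) (auto simp: power_int_diff)
  also have "z i0 + \<dots> = \<pi> powi n i0 * (u i0 + (\<Sum>i\<in>I - {i0}. \<pi> powi (n i - n i0) * u i))"
    using z[OF i0(1)] by (simp add: algebra_simps)
  finally have eq: "(\<Sum>i\<in>I. z i) = \<dots>" .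
  have "\<pi> powi (n i - n i0) * u i \<in> M" if "i \<in> I - {i0}" for i
  proof -
    have "\<pi> powi (n i - n i0) = \<pi> ^ nat (n i - n i0)" using le[of i] that by (auto simp: power_int_def)
    then have "\<pi> powi (n i - n i0) \<in> M" using le[of i] that \<pi>(1) by (auto intro: power_M)
    then show ?thesis using z[of i] that U_facts(1) M_facts(5) by blast
  qed
  then have "(\<Sum>i\<in>J. \<pi> powi (n i - n i0) * u i) \<in> M" if "J \<subseteq> I - {i0}" for J
    using finite_subset[OF that] that I(1)
    by (induction J rule: infinite_finite_induct) (auto intro: M_facts)
  then have "u i0 + (\<Sum>i\<in>I - {i0}. \<pi> powi (n i - n i0) * u i) \<in> U"
    using z[OF i0(1)] U_facts(9) by blast
  then show ?thesis using eq \<pi>(2) U_facts(2) by simp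
qed

lemma rats_order:
  assumes "\<tau> \<in> M" "\<tau> \<noteq> 0" "z \<in> rats \<tau>" "z \<noteq> 0"
  obtains k u where "u \<in> U" "z = \<tau> powi k * u"
proof -
  from assms(3) obtain f h where fh: "z = ev \<iota> f \<tau> / ev \<iota> h \<tau>" "ev \<iota> h \<tau> \<noteq> 0" unfolding rats_def by blast
  then have "f \<noteq> 0" "h \<noteq> 0" using assms(4) by auto
  then obtain k u l v where "ev \<iota> f \<tau> = \<tau> ^ k * u" "u \<in> U" "ev \<iota> h \<tau> = \<tau> ^ l * v" "v \<in> U"
    using ev_M_decomp[OF assms(1)] by metis
  then have "u / v \<in> U" "z = \<tau> powi (int k - int l) * (u / v)"
    using fh assms(2) U_facts(6) by (auto simp: power_int_diff)
  then show ?thesis using that by blast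
qed

text \<open>The terms of \<open>f(s)\<close> have distinct orders, even modulo \<open>q\<close>, because \<open>s\<close> has a pole of order
  \<open>n q + 1\<close>.\<close>

lemma ramified_independent:
  assumes q: "q \<ge> 2" and \<pi>: "\<pi> \<in> M" "\<pi> \<noteq> 0" and \<tau>: "\<tau> = \<pi> ^ q * u" "u \<in> U"
    and s: "s * \<pi> ^ (n * q + 1) = w" "w \<in> U"
    and f: "coeffs_in (rats \<tau>) f" "degree f < q" "f \<noteq> 0"
  shows "poly f s \<noteq> 0"
proof -
  have \<tau>M: "\<tau> \<in> M" "\<tau> \<noteq> 0"
    using \<tau> \<pi> q U_facts(1,2) by (auto intro!: M_facts(5) power_M)
  define I where "I = {i. coeff f i \<noteq> 0}"
  have Id: "i \<le> degree f" if "i \<in> I" for i using that le_degree by (auto simp: I_def)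
  then have fin: "finite I" using finite_subset[of I "{..degree f}"] by auto
  have "\<exists>k v. v \<in> U \<and> coeff f i = \<tau> powi k * v" if "i \<in> I" for i
    using rats_order[OF \<tau>M, of "coeff f i"] f(1) that unfolding I_def coeffs_in_def by blast
  then obtain k v where kv: "\<And>i. i \<in> I \<Longrightarrow> v i \<in> U \<and> coeff f i = \<tau> powi k i * v i" by metis
  define N where "N = int n * int q + 1"
  \<comment> \<open>The order of the term with index \<open>i\<close>: its coefficient is a unit
    times a power of \<open>\<tau>\<close>, which has order \<open>q\<close>, and \<open>s\<close>
    has order \<open>- N\<close>.\<close>
  define e where "e i = int q * k i - N * int i" for i
  have sw: "s = w * \<pi> powi (- N)"
  proof -
    have "\<pi> powi N = \<pi> ^ (n * q + 1)"
    proof -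
      have "N = int (n * q + 1)" by (simp add: N_def)
      then show ?thesis by (simp only: power_int_of_nat)
    qed
    then show ?thesis using s(1) \<pi>(2) by (simp add: power_int_minus field_simps)
  qed
  have "poly f s = (\<Sum>i\<le>degree f. coeff f i * s ^ i)" by (rule poly_altdef)
  also have "\<dots> = (\<Sum>i\<in>I. coeff f i * s ^ i)"
    using Id by (intro sum.mono_neutral_right) (auto simp: I_def)
  also have "\<dots> \<noteq> 0"
  proof (rule sum_distinct_orders_nonzero[OF \<pi> fin, of e])
    show "I \<noteq> {}" using f(3) by (auto simp: I_def poly_eq_iff)
    show "inj_on e I"
    proof (rule inj_onI)
      fix i j assume ij: "i \<in> I" "j \<in> I" "e i = e j"
      \<comment> \<open>As \<open>N\<close> is 1 modulo \<open>q\<close>, equal orders make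
        \<open>i\<close> and \<open>j\<close> congruent modulo \<open>q\<close>, and both are below
        \<open>q\<close>.\<close>
      then have "int i - int j = int q * (k i - k j - int n * (int i - int j))"
        by (simp add: e_def N_def algebra_simps)
      then have "int q dvd int i - int j" by (metis dvd_triv_left)
      then have "int i mod int q = int j mod int q" by (simp add: mod_eq_dvd_iff)
      moreover have "i < q" "j < q" using Id ij f(2) by force+
      ultimately show "i = j" by simp
    qed
    fix i assume i: "i \<in> I"
    have "coeff f i * s ^ i = (\<pi> ^ q * u) powi k i * v i * (w * \<pi> powi (- N)) ^ i"
      using kv[OF i] \<tau>(1) sw by simp
    also have "\<dots> = \<pi> powi e i * (u powi k i * v i * w ^ i)"
    proof -
      have "(\<pi> ^ q) powi k i = \<pi> powi (int q * k i)"
        by (metis power_int_mult power_int_of_nat)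
      moreover have "(\<pi> powi (- N)) ^ i = \<pi> powi (- N * int i)"
        by (metis power_int_mult power_int_of_nat)
      moreover have "\<pi> powi e i = \<pi> powi (int q * k i) * \<pi> powi (- N * int i)"
        using \<pi>(2) by (subst power_int_add[symmetric]) (auto simp: e_def)
      ultimately show ?thesis by (simp add: power_int_mult_distrib power_mult_distrib ac_simps)
    qed
    finally show "u powi k i * v i * w ^ i \<in> U \<and> coeff f i * s ^ i = \<pi> powi e i * (u powi k i * v i * w ^ i)"
      using kv[OF i] \<tau>(2) s(2) U_facts by auto
  qed
  finally show ?thesis .
qed

end

section \<open>Rational places of Artin-Schreier extensions\<close>

context field_emb
begin

definition rational_rings :: "'l set \<Rightarrow> 'l set set" where
  "rational_rings L = {V. valuation_ring \<iota> L V \<and> valued_field.rational \<iota> V}"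

text \<open>In degree one a single \<open>b\<close> spans the residue field; 1 is then a multiple of
  \<open>b\<close>, so \<open>b\<close> has a nonzero residue in \<open>K\<close> and
  \<open>V = K + M\<close>. Injectivity holds because \<open>V\<close> is recovered from its maximal
  ideal: a nonzero \<open>z\<close> in \<open>L\<close> lies in \<open>V\<close> exactly if its
  inverse is not in the ideal.\<close>

lemma rational_places_eq:
  assumes L: "is_subfield L"
  shows "rational_places \<iota> L = nonunits ` rational_rings L" "inj_on nonunits (rational_rings L)"
proof -
  have *: "(\<exists>B. residue_basis \<iota> V (nonunits V) B \<and> card B = 1) \<longleftrightarrow> valued_field.rational \<iota> V"
    if "valuation_ring \<iota> L V" for V
  proof -
    interpret valued_field \<iota> L V by unfold_locales fact+
    show ?thesis
    proof
      assume "\<exists>B. residue_basis \<iota> V M B \<and> card B = 1"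
      then obtain b where b: "b \<in> V" "\<And>z. z \<in> V \<Longrightarrow> \<exists>c. z - \<iota> (c b) * b \<in> M"
        unfolding residue_basis_def by (auto simp: card_1_singleton_iff)
      obtain e where e: "1 - \<iota> e * b \<in> M" using b(2)[OF V_ring(1)] by blast
      then have "e \<noteq> 0" using M_facts(8) by auto
      have "\<iota> e * b - \<iota> 1 \<in> M" using M_facts(6)[OF e] by simp
      then have "res (\<iota> (inverse e) * (\<iota> e * b)) (inverse e * 1)" by (intro res_arith res_const resI)
      then have rb: "res b (inverse e)" using \<open>e \<noteq> 0\<close> by (simp add: mult.assoc[symmetric])
      show rational unfolding rational_def
      proof
        fix z assume "z \<in> V"
        then obtain c where "z - \<iota> c * b \<in> M" using b(2) by blast
        then have "res (z - \<iota> c * b + \<iota> c * b) (0 + c * inverse e)"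
          by (intro res_arith res_const rb) (simp add: res_0)
        then show "\<exists>c. res z c" by auto
      qed
    next
      assume rational
      then have r: "\<exists>c. z - \<iota> c \<in> M" if "z \<in> V" for z using that by (auto simp: rational_def res_def)
      have "residue_basis \<iota> V M {1}" unfolding residue_basis_def
      proof (intro conjI allI impI ballI)
        fix z assume "z \<in> V"
        then obtain c where "z - \<iota> c \<in> M" using r by blast
        then show "\<exists>c. z - (\<Sum>b\<in>{1}. \<iota> (c b) * b) \<in> M" by (intro exI[of _ "\<lambda>_. c"]) simp
      qed (use V_ring(1) const_M in auto)
      then show "\<exists>B. residue_basis \<iota> V M B \<and> card B = 1" by (intro exI[of _ "{1}"]) simp
    qed
  qed
  have mx: "maximal_ideal_in V P \<longleftrightarrow> P = nonunits V" if "valuation_ring \<iota> L V" for V P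
  proof -
    interpret valued_field \<iota> L V by unfold_locales fact+
    show ?thesis by (rule maximal_iff)
  qed
  have "P \<in> rational_places \<iota> L \<longleftrightarrow> P \<in> nonunits ` rational_rings L" for P
  proof
    assume "P \<in> rational_places \<iota> L"
    then obtain V B where "valuation_ring \<iota> L V" "maximal_ideal_in V P" "residue_basis \<iota> V P B" "card B = 1"
      by (auto simp: rational_places_def place_of_degree_def)
    moreover from this have "P = nonunits V" using mx by simp
    ultimately show "P \<in> nonunits ` rational_rings L" using *[of V] unfolding rational_rings_def by auto
  next
    assume "P \<in> nonunits ` rational_rings L"
    then obtain V where V: "valuation_ring \<iota> L V" "valued_field.rational \<iota> V" "P = nonunits V"
      by (auto simp: rational_rings_def)
    moreover have "maximal_ideal_in V P" using mx V by simp
    ultimately show "P \<in> rational_places \<iota> L"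
      using *[OF V(1)] unfolding rational_places_def place_of_degree_def by blast
  qed
  then show "rational_places \<iota> L = nonunits ` rational_rings L" by blast
  have rec: "V = {z \<in> L. z = 0 \<or> inverse z \<notin> nonunits V}" if "valuation_ring \<iota> L V" for V
  proof -
    interpret valued_field \<iota> L V by unfold_locales fact+
    have "z \<in> V \<longleftrightarrow> z = 0 \<or> inverse z \<notin> M" if "z \<in> L" for z
      using that inverse_M[of z] not_in_V[of "inverse z"] V_ring(2) by auto
    then show ?thesis using V_facts(2) by blast
  qed
  show "inj_on nonunits (rational_rings L)"
  proof (rule inj_onI)
    fix V W assume h: "V \<in> rational_rings L" "W \<in> rational_rings L" "nonunits V = nonunits W"
    then have "valuation_ring \<iota> L V" "valuation_ring \<iota> L W" by (auto simp: rational_rings_def)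
    note rec[OF this(1)]
    also note h(3)
    also note rec[OF \<open>valuation_ring \<iota> L W\<close>, symmetric]
    finally show "V = W" .
  qed
qed

text \<open>The ideal \<open>\<tau> K[\<tau>]\<close> of \<open>K[\<tau>]\<close> is proper because
  \<open>\<tau>\<close> is transcendental, so the extension theorem applies to it.\<close>

lemma ex_valuation_ring:
  assumes L: "is_subfield L" "range \<iota> \<subseteq> L" "\<tau> \<in> L" and tr: "\<And>f. f \<noteq> 0 \<Longrightarrow> ev \<iota> f \<tau> \<noteq> 0"
  obtains V where "valuation_ring \<iota> L V" "\<tau> \<in> nonunits V"
proof -
  define I where "I = {\<tau> * z |z. z \<in> pols \<tau>}"
  note r = is_subringD[OF is_subring_pols[of \<tau>]]
  have AL: "pols \<tau> \<subseteq> L" using pols_subset[OF is_subfieldD(1)[OF L(1)] L(2,3)] by (auto simp: pols_def)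
  have inI: "z \<in> pols \<tau> \<Longrightarrow> w = \<tau> * z \<Longrightarrow> w \<in> I" for z w by (auto simp: I_def)
  have id: "ideal_in (pols \<tau>) I" unfolding ideal_in_def
  proof (intro conjI ballI)
    show "I \<subseteq> pols \<tau>" using pols_basic r(4) by (auto simp: I_def)
    show "0 \<in> I" by (rule inI[OF r(2)]) simp
    fix x y assume "x \<in> I" "y \<in> I"
    then obtain z w where "x = \<tau> * z" "y = \<tau> * w" "z \<in> pols \<tau>" "w \<in> pols \<tau>" by (auto simp: I_def)
    then show "x + y \<in> I" by (intro inI[OF r(6)[of z w]]) (auto simp: algebra_simps)
  next
    fix v x assume v: "v \<in> pols \<tau>" and "x \<in> I"
    then obtain z where "x = \<tau> * z" "z \<in> pols \<tau>" by (auto simp: I_def)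
    then show "v * x \<in> I" by (intro inI[OF r(4)[OF v, of z]]) (auto simp: algebra_simps)
  qed
  have "1 \<notin> I"
  proof
    assume "1 \<in> I"
    then obtain f where "1 = \<tau> * ev \<iota> f \<tau>" by (auto simp: I_def pols_def)
    then have "ev \<iota> (pCons (- 1) f) \<tau> = 0" by simp
    then show False using tr[of "pCons (- 1) f"] by auto
  qed
  from extend_to_valuation_ring[OF L(1) is_subring_pols AL id this] obtain V where
    V: "is_subring V" "pols \<tau> \<subseteq> V" "V \<subseteq> L" "I \<subseteq> nonunits V" "\<And>z. z \<in> L \<Longrightarrow> z \<in> V \<or> inverse z \<in> V"
    by metis
  have "\<tau> \<in> nonunits V" using inI[OF r(1), of \<tau>] V(4) by auto
  moreover have "\<tau> \<noteq> 0" using tr[of "[:0, 1:]"] by auto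
  ultimately have ni: "inverse \<tau> \<notin> V" by (auto simp: nonunits_def)
  have KV: "range \<iota> \<subseteq> V" using V(2) pols_basic(1) by blast
  have "\<tau> \<notin> range \<iota>"
  proof
    assume "\<tau> \<in> range \<iota>"
    then obtain c where "\<tau> = \<iota> c" by blast
    moreover have "\<iota> (inverse c) \<in> V" using KV by blast
    ultimately show False using ni by simp
  qed
  moreover have "\<tau> \<in> V" using V(2) pols_basic(2) by blast
  moreover have "inverse \<tau> \<in> L" using L is_subfieldD(2) by blast
  ultimately have "valuation_ring \<iota> L V"
    unfolding valuation_ring_def using V KV ni by auto
  then show ?thesis using that \<open>\<tau> \<in> nonunits V\<close> by blast
qed

text \<open>\<open>V\<close> is the preimage of \<open>V0\<close> under the field map from
  \<open>L\<close> to \<open>L\<close> that fixes \<open>F\<close> and sends \<open>s\<close> to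
  \<open>s'\<close>.\<close>

lemma twist_valuation_ring:
  assumes F: "is_subfield F" "range \<iota> \<subseteq> F" and L: "is_subfield L" "L = {poly g s |g. coeffs_in F g}"
    and s': "s' \<in> L" and conj: "\<And>f. coeffs_in F f \<Longrightarrow> poly f s = 0 \<Longrightarrow> poly f s' = 0"
    and V0: "valuation_ring \<iota> L V0" and \<tau>: "\<tau> \<in> F" "\<tau> \<in> nonunits V0" "\<tau> \<noteq> 0"
  obtains V where "valuation_ring \<iota> L V"
    "\<And>f. coeffs_in F f \<Longrightarrow> poly f s \<in> nonunits V \<longleftrightarrow> poly f s' \<in> nonunits V0"
proof -
  interpret v0: valued_field \<iota> L V0 by unfold_locales fact+
  note Fr = is_subfieldD(1)[OF F(1)]
  \<comment> \<open>An element of \<open>L\<close> may be \<open>poly f s\<close> for many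
    \<open>f\<close>; by \<open>conj\<close> the value at \<open>s'\<close> is the same for all of
    them.\<close>
  define \<sigma> where "\<sigma> z = poly (SOME f. coeffs_in F f \<and> poly f s = z) s'" for z
  have \<sigma>: "\<sigma> (poly f s) = poly f s'" if f: "coeffs_in F f" for f
  proof -
    define h where "h = (SOME h. coeffs_in F h \<and> poly h s = poly f s)"
    have h: "coeffs_in F h \<and> poly h s = poly f s" unfolding h_def by (rule someI[of _ f]) (use f in auto)
    then have "poly (h - f) s' = 0" using f by (intro conj coeffs_in_ring[OF Fr]) auto
    then show ?thesis by (simp add: \<sigma>_def h_def)
  qed
  have FL: "F \<subseteq> L"
  proof
    fix x assume "x \<in> F"
    then have "coeffs_in F [:x:]" "x = poly [:x:] s" using coeffs_in_basic[OF Fr] by auto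
    then show "x \<in> L" unfolding L(2) by blast
  qed
  have hom: "\<sigma> (z - w) = \<sigma> z - \<sigma> w" "\<sigma> (z * w) = \<sigma> z * \<sigma> w" if zw: "z \<in> L" "w \<in> L" for z w
  proof -
    obtain f g where fg: "z = poly f s" "w = poly g s" "coeffs_in F f" "coeffs_in F g" using zw L(2) by auto
    have "\<sigma> (poly (f - g) s) = poly (f - g) s'" "\<sigma> (poly (f * g) s) = poly (f * g) s'"
      using fg coeffs_in_ring[OF Fr] by (intro \<sigma>; blast)+
    then show "\<sigma> (z - w) = \<sigma> z - \<sigma> w" "\<sigma> (z * w) = \<sigma> z * \<sigma> w" using fg \<sigma> by simp_all
  qed
  have \<sigma>F: "\<sigma> x = x" if "x \<in> F" for x using \<sigma>[of "[:x:]"] coeffs_in_basic(3)[OF Fr that] by simp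
  have \<sigma>L: "\<sigma> z \<in> L" if z: "z \<in> L" for z
  proof -
    obtain f where f: "z = poly f s" "coeffs_in F f" using z L(2) by auto
    then have "coeffs_in L f" using FL by (auto simp: coeffs_in_def)
    then show ?thesis using f \<sigma> poly_mem_subring[OF is_subfieldD(1)[OF L(1)] _ s'] by simp
  qed
  have inv: "\<sigma> (inverse z) = inverse (\<sigma> z)" "\<sigma> z \<noteq> 0" if z: "z \<in> L" "z \<noteq> 0" for z
  proof -
    have "\<sigma> z * \<sigma> (inverse z) = 1"
      using hom(2)[of z "inverse z"] z is_subfieldD(2)[OF L(1)] \<sigma>F[OF is_subringD(1)[OF Fr]] by simp
    then show "\<sigma> (inverse z) = inverse (\<sigma> z)" "\<sigma> z \<noteq> 0" by (auto intro: inverse_unique[symmetric])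
  qed
  define V where "V = {z \<in> L. \<sigma> z \<in> V0}"
  note Lr = is_subringD[OF is_subfieldD(1)[OF L(1)]]
  have sub: "is_subring V"
  proof (rule is_subringI)
    show "1 \<in> V" using Lr(1) \<sigma>F[OF is_subringD(1)[OF Fr]] v0.V_ring(1) by (simp add: V_def)
    fix x y assume "x \<in> V" "y \<in> V"
    then show "x - y \<in> V" "x * y \<in> V"
      unfolding V_def using hom[of x y] Lr(3,4)[of x y] v0.V_ring(3,4)[of "\<sigma> x" "\<sigma> y"] by auto
  qed
  have non: "z \<in> nonunits V \<longleftrightarrow> \<sigma> z \<in> nonunits V0" if "z \<in> L" for z
    using that inv[OF that] \<sigma>F[OF is_subringD(2)[OF Fr]] is_subfieldD(2)[OF L(1)]
    by (cases "z = 0") (auto simp: nonunits_def V_def)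
  have KV: "range \<iota> \<subseteq> V"
  proof
    fix x assume x: "x \<in> range \<iota>"
    then have "x \<in> F" "x \<in> V0" using F(2) v0.V_facts(3) by auto
    then show "x \<in> V" using FL \<sigma>F[of x] unfolding V_def by auto
  qed
  have \<tau>V: "\<tau> \<in> nonunits V" using non \<tau> FL \<sigma>F by auto
  then have ni: "inverse \<tau> \<notin> V" "\<tau> \<in> V" using \<tau>(3) by (auto simp: nonunits_def)
  have "\<tau> \<notin> range \<iota>"
  proof
    assume "\<tau> \<in> range \<iota>"
    then obtain c where "\<tau> = \<iota> c" by blast
    moreover have "\<iota> (inverse c) \<in> V" using KV by blast
    ultimately show False using ni by simp
  qed
  moreover have "inverse \<tau> \<in> L" using \<tau>(1) FL L(1) is_subfieldD(2) by blast
  moreover have "z \<in> V \<or> inverse z \<in> V" if z: "z \<in> L" for z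
  proof (cases "z = 0")
    case True
    then show ?thesis using is_subringD(2)[OF sub] by simp
  next
    case False
    then show ?thesis
      using z inv[OF z False] is_subfieldD(2)[OF L(1)] v0.V_facts(4)[OF \<sigma>L[OF z]] by (auto simp: V_def)
  qed
  moreover have "V \<subseteq> L" by (auto simp: V_def)
  ultimately have "valuation_ring \<iota> L V" unfolding valuation_ring_def using sub KV ni by blast
  moreover have "poly f s \<in> nonunits V \<longleftrightarrow> poly f s' \<in> nonunits V0" if "coeffs_in F f" for f
    using non[of "poly f s"] that L(2) \<sigma> by auto
  ultimately show ?thesis using that by blast
qed

text \<open>With \<open>a\<close> and \<open>b\<close> units, \<open>\<tau>\<close> has order
  \<open>e\<close> at a smooth point of the curve with coordinates \<open>\<pi>\<close> and
  \<open>\<tau>\<close>. Every valuation ring with \<open>\<tau>\<close> in its maximal ideal thus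
  equals \<open>local_ring \<pi> \<tau>\<close>, and one exists.\<close>

lemma card_ramified:
  assumes L: "is_subfield L" "range \<iota> \<subseteq> L" "\<tau> \<in> L" and tr: "\<And>f. f \<noteq> 0 \<Longrightarrow> ev \<iota> f \<tau> \<noteq> 0"
    and alg: "algebraic_ext L \<tau>" and gen: "L \<subseteq> gen_field {\<pi>, \<tau>}" and e: "e > 0"
    and ab: "a \<in> gen_ring {\<pi>, \<tau>}" "b \<in> gen_ring {\<pi>, \<tau>}" "\<tau> * a = \<pi> ^ e * b"
    and dom: "\<And>V. valuation_ring \<iota> L V \<Longrightarrow> \<tau> \<in> nonunits V \<Longrightarrow>
      \<pi> \<in> nonunits V \<and> \<pi> \<noteq> 0 \<and> a \<in> valued_field.U V \<and> b \<in> valued_field.U V"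
  shows "card {V \<in> rational_rings L. \<tau> \<in> nonunits V} = 1"
proof -
  have *: "V = local_ring \<pi> \<tau> \<and> V \<in> rational_rings L" if hV: "valuation_ring \<iota> L V" "\<tau> \<in> nonunits V" for V
  proof -
    interpret valued_field \<iota> L V by unfold_locales fact+
    have d: "\<pi> \<in> M" "\<pi> \<noteq> 0" "a \<in> U" "b \<in> U" using dom[OF hV] by auto
    have "a \<noteq> 0" using d U_facts(2)[of a] by blast
    then have "\<tau> = \<pi> ^ e * (b / a)" using ab(3) by (simp add: field_simps)
    moreover have "b / a \<in> U" using d U_facts(6) by blast
    \<comment> \<open>\<open>chart\<close> asks for a relation linear in \<open>\<pi>\<close>, so
      all but one factor \<open>\<pi>\<close> goes into the cofactor.\<close>
    moreover have "\<pi> ^ (e - 1) * b \<in> gen_ring {\<pi>, \<tau>}"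
      using ab(2) gen_ring(1,3) is_subringD(4,7) by (metis insertI1)
    moreover have "\<tau> * a = \<pi> * (\<pi> ^ (e - 1) * b)"
      using ab(3) e by (cases e) (auto simp: mult.assoc)
    ultimately have "V = local_ring \<pi> \<tau>" "rational"
      using chart[of \<pi> \<tau> a "\<pi> ^ (e - 1) * b" \<tau> e "b / a"] d hV(2) gen ab(1) e alg by blast+
    then show ?thesis using hV by (simp add: rational_rings_def)
  qed
  obtain V where "valuation_ring \<iota> L V" "\<tau> \<in> nonunits V" using ex_valuation_ring[OF L tr] by blast
  then have "{V \<in> rational_rings L. \<tau> \<in> nonunits V} = {V}"
    using * by (auto simp: rational_rings_def)
  then show ?thesis by simp
qed

end

section \<open>Artin-Schreier extensions of a rational function field\<close>

locale AS_ext = field_emb \<iota> for \<iota> :: "'k::{finite,field} \<Rightarrow> 'l::field" +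
  fixes q :: nat and t s :: 'l and L :: "'l set"
  assumes q2: "q \<ge> 2"
    and Fq_card: "card (Fq q :: 'k set) = q"
    and frob: "\<And>x y :: 'l. (x + y) ^ q = x ^ q + y ^ q"
    and Lts: "L = gen_field {t, s}"
    and g_rats: "s ^ q - s \<in> rats t"
    and tr: "\<And>f. f \<noteq> 0 \<Longrightarrow> ev \<iota> f t \<noteq> 0"
begin

lemma frob_diff: "(x - y :: 'l) ^ q = x ^ q - y ^ q"
  using frob[of "x - y" y] by (simp add: algebra_simps)

lemma L_facts: "is_subfield L" "range \<iota> \<subseteq> L" "rats t \<subseteq> L" "s \<in> L" "t \<in> L" "L = {poly g s |g. coeffs_in (rats t) g}"
proof -
  show f: "is_subfield L" "range \<iota> \<subseteq> L" "s \<in> L" "t \<in> L" unfolding Lts using gen_field by auto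
  then show "rats t \<subseteq> L" by (intro rats_subset)
  show "L = {poly g s |g. coeffs_in (rats t) g}" unfolding Lts by (rule gen_field_AS[OF q2 g_rats])
qed

lemma algebraic:
  assumes "rats \<tau> = rats t"
  shows "algebraic_ext L \<tau>"
proof -
  have "t \<in> rats \<tau>" "\<tau> \<in> rats t" using assms rats_basic(2) by auto
  moreover have "rats \<tau> \<subseteq> gen_field {\<tau>, s}" "rats t \<subseteq> gen_field {t, s}"
    using gen_field by (intro rats_subset; auto)+
  ultimately have "gen_field {\<tau>, s} = L" unfolding Lts by (intro gen_field_eqI) (use gen_field(3) in auto)
  then show ?thesis using algebraic_ext_AS[OF q2, of s \<tau>] g_rats assms by simp
qed

text \<open>Both sides are monic of degree \<open>q\<close> and vanish on the \<open>q\<close>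
  elements of \<open>F_q\<close>.\<close>

lemma X_power_minus_X: "(\<Prod>d\<in>Fq q. [:- d, 1:]) = monom 1 q - monom (1::'k) 1" (is "?l = ?r")
proof (rule poly_eqI_degree_lead_coeff[where A = "Fq q" and n = q])
  have "degree ?l = q" using Fq_card by (simp add: degree_prod_eq_sum_degree)
  moreover have "lead_coeff ?l = 1" by (simp add: lead_coeff_prod)
  ultimately show "coeff ?l q = coeff ?r q" using q2 by (simp add: coeff_monom)
  show "degree ?l \<le> q" using \<open>degree ?l = q\<close> by simp
  show "degree ?r \<le> q" using q2 by (intro degree_diff_le order_trans[OF degree_monom_le]) auto
  show "card (Fq q :: 'k set) \<ge> q" using Fq_card by simp
  fix z :: 'k assume "z \<in> Fq q"
  then show "poly ?l z = poly ?r z" by (auto simp: poly_prod poly_monom Fq_def intro: prod_zero)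
qed

lemma ev_prod: "ev \<iota> (\<Prod>d\<in>S. f d) z = (\<Prod>d\<in>S. ev \<iota> (f d) z)"
  by (induction S rule: infinite_finite_induct) auto

lemma factor_AS: "(\<Prod>d\<in>Fq q. x - \<iota> d) = x ^ q - x"
  using arg_cong[OF X_power_minus_X, of "\<lambda>f. ev \<iota> f x"] by (simp add: ev_prod)

end

text \<open>Makes \<open>X^q - X - (s^q - s)\<close> the minimal polynomial of \<open>s\<close> over
  \<open>K(t)\<close>. It is kept apart from \<open>AS_ext\<close> because it is derived there, from
  a totally ramified place.\<close>

locale AS_ext_irred = AS_ext \<iota> q t s L
  for \<iota> :: "'k::{finite,field} \<Rightarrow> 'l::field" and q t s L +
  assumes indep: "\<And>f. coeffs_in (rats t) f \<Longrightarrow> degree f < q \<Longrightarrow> f \<noteq> 0 \<Longrightarrow> poly f s \<noteq> 0"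
begin

text \<open>By independence \<open>f\<close> is a multiple of the Artin-Schreier polynomial, which
  has the root \<open>s - \<iota> d\<close> together with \<open>s\<close> since
  \<open>d^q = d\<close>.\<close>

lemma conjugate_root:
  assumes "d \<in> Fq q" "coeffs_in (rats t) f" "poly f s = 0"
  shows "poly f (s - \<iota> d) = 0"
proof -
  define E where "E = AS_poly q (s ^ q - s)"
  note E = AS_poly[OF q2, where g = "s ^ q - s", folded E_def]
  note Fr = is_subfieldD(1)[OF is_subfield_rats[of t]]
  obtain h r where h: "coeffs_in (rats t) r" "f = E * h + r" "degree r < q"
    using coeffs_in_monic_division[OF Fr, of E f] E assms(2) Fr g_rats q2 by auto
  have "poly r s = 0" using assms(3) h(2) E(3)[of s] by simp
  then have "r = 0" using indep[OF h(1,3)] by blast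
  moreover have "poly E (s - \<iota> d) = 0"
  proof -
    have "\<iota> d ^ q = \<iota> d" using assms(1) by (simp add: Fq_def flip: emb_simps(7))
    then show ?thesis using E(3)[of "s - \<iota> d"] frob_diff[of s "\<iota> d"] by simp
  qed
  ultimately show ?thesis using h(2) by simp
qed

text \<open>Assumption \<open>g\<close> says that \<open>s^q - s\<close> is regular at
  \<open>\<tau> = 0\<close> with value \<open>\<gamma>\<close>. There \<open>s\<close> is integral,
  and a residue \<open>c\<close> in \<open>K\<close> solves \<open>c^q - c = \<gamma>\<close>.
  Because \<open>X^q - X\<close> has the linear term \<open>- X\<close>, the element
  \<open>\<tau>\<close> is a uniformizer, so \<open>c\<close> determines the place; conjugation
  shows that every \<open>c\<close> occurs.\<close>

lemma unramified_places:
  assumes \<tau>: "rats \<tau> = rats t" "\<tau> \<in> L" "\<And>f. f \<noteq> 0 \<Longrightarrow> ev \<iota> f \<tau> \<noteq> 0"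
    and g: "(s ^ q - s - \<iota> \<gamma>) * ev \<iota> H \<tau> = \<tau> * ev \<iota> G \<tau>" "poly H 0 \<noteq> 0"
  shows "finite {V \<in> rational_rings L. \<tau> \<in> nonunits V}"
    "card {V \<in> rational_rings L. \<tau> \<in> nonunits V} = card {c. c ^ q - c = \<gamma>}"
proof -
  have \<tau>0: "\<tau> \<noteq> 0" using \<tau>(3)[of "[:0, 1:]"] by auto
  have emb_Fq: "\<iota> (c ^ q - c) = \<iota> c ^ q - \<iota> c" for c by simp
  have base: "s \<in> V \<and> s ^ q - s - \<iota> \<gamma> \<in> nonunits V" if hV: "valuation_ring \<iota> L V" "\<tau> \<in> nonunits V" for V
  proof -
    interpret valued_field \<iota> L V by unfold_locales (fact L_facts hV)+
    have rH: "res (ev \<iota> H \<tau>) (poly H 0)" "res (ev \<iota> G \<tau>) (poly G 0)" using hV(2) by (auto intro!: res_ev simp: res_0)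
    then have HU: "ev \<iota> H \<tau> \<in> U" using g(2) res_U by blast
    then have "s ^ q - s - \<iota> \<gamma> = \<tau> * (ev \<iota> G \<tau> / ev \<iota> H \<tau>)"
      using g(1) U_facts(2)[OF HU] by (simp add: field_simps)
    moreover have "ev \<iota> G \<tau> / ev \<iota> H \<tau> \<in> V" using res_divide[OF rH(2,1) g(2)] res_V by blast
    ultimately have gM: "s ^ q - s - \<iota> \<gamma> \<in> M" using hV(2) M_facts(5) by metis
    have gV: "s ^ q - s \<in> V" using V_ring(6)[OF M_facts(1)[OF gM] V_facts(3)[of \<gamma>]] by simp
    have "s \<in> V"
    proof (rule ccontr)
      assume n: "s \<notin> V"
      then have "s \<noteq> 0" using V_ring(2) by auto
      have iM: "inverse s \<in> M" using inverse_M L_facts(4) n by blast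
      \<comment> \<open>If \<open>s\<close> had a pole, dividing \<open>s^q - s\<close> by
        \<open>s^q\<close> would put 1 into \<open>M\<close>.\<close>
      have "inverse s ^ q * (s ^ q - s) + inverse s ^ (q - 1) \<in> M"
        using iM gV q2 by (intro M_facts(3) M_facts(5) power_M) auto
      moreover have "inverse s ^ q * (s ^ q - s) + inverse s ^ (q - 1) = 1"
      proof -
        obtain k where k: "q = Suc k" using q2 by (cases q) auto
        show ?thesis unfolding k using \<open>s \<noteq> 0\<close> by (simp add: field_simps)
      qed
      ultimately show False using M_facts(8) by simp
    qed
    then show ?thesis using gM by simp
  qed
  have uniq: "c ^ q - c = \<gamma> \<and> V = local_ring \<tau> (s - \<iota> c) \<and> V \<in> rational_rings L"
    if hV: "valuation_ring \<iota> L V" "\<tau> \<in> nonunits V" and c: "s - \<iota> c \<in> nonunits V" for V c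
  proof -
    interpret valued_field \<iota> L V by unfold_locales (fact L_facts hV)+
    define \<omega> where "\<omega> = s - \<iota> c"
    note gM = conjunct2[OF base[OF hV]]
    have \<omega>M: "\<omega> \<in> M" using c by (simp add: \<omega>_def)
    have \<omega>q: "\<omega> ^ q - \<omega> = s ^ q - s - \<iota> (c ^ q - c)"
      unfolding \<omega>_def by (simp add: frob_diff)
    have "\<omega> ^ q - \<omega> \<in> M" using \<omega>M q2 by (intro M_facts(7) power_M) auto
    then have "(\<omega> ^ q - \<omega>) - (s ^ q - s - \<iota> \<gamma>) \<in> M" using gM by (rule M_facts(7))
    also have "(\<omega> ^ q - \<omega>) - (s ^ q - s - \<iota> \<gamma>) = \<iota> (\<gamma> - (c ^ q - c))" unfolding \<omega>q by simp
    finally have "\<iota> (\<gamma> - (c ^ q - c)) \<in> M" .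
    then have "\<gamma> - (c ^ q - c) = 0" by (simp only: const_M)
    then have c\<gamma>: "c ^ q - c = \<gamma>" by simp
    \<comment> \<open>The factor \<open>\<omega>^(q-1) - 1\<close>, taken from
      \<open>\<omega>^q - \<omega>\<close>, has residue -1, so \<open>a\<close> is a unit.\<close>
    define a where "a = (\<omega> ^ (q - 1) - 1) * ev \<iota> H \<tau>"
    have "\<omega> * a = \<tau> * ev \<iota> G \<tau>"
    proof -
      obtain k where k: "q = Suc k" using q2 by (cases q) auto
      have "\<omega> * a = (\<omega> ^ q - \<omega>) * ev \<iota> H \<tau>" by (simp add: a_def k algebra_simps)
      then show ?thesis unfolding \<omega>q c\<gamma> using g(1) by simp
    qed
    moreover have "a \<in> U"
    proof -
      have "res (ev \<iota> H \<tau>) (poly H 0)" using hV(2) by (auto intro!: res_ev simp: res_0)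
      moreover have "res (\<omega> ^ (q - 1)) 0" using \<omega>M q2 by (auto simp: res_0 intro!: power_M)
      ultimately have "res a ((0 - 1) * poly H 0)" unfolding a_def by (intro res_arith res_1)
      then show ?thesis using res_U g(2) by simp
    qed
    moreover have evR: "ev \<iota> f \<tau> \<in> gen_ring {\<tau>, \<omega>}" for f
      using gen_ring by (intro pols_subset) auto
    moreover have "a \<in> gen_ring {\<tau>, \<omega>}"
      unfolding a_def using evR gen_ring[where S = "{\<tau>, \<omega>}"] is_subringD[OF gen_ring(1)[of "{\<tau>, \<omega>}"]]
      by auto
    moreover have "L \<subseteq> gen_field {\<tau>, \<omega>}"
      unfolding Lts
    proof (rule gen_field_least)
      note r = is_subringD[OF is_subfieldD(1)[OF gen_field(1)[of "{\<tau>, \<omega>}"]]]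
      have "s = \<omega> + \<iota> c" by (simp add: \<omega>_def)
      then have "s \<in> gen_field {\<tau>, \<omega>}" using r(6) gen_field(2,3) by auto
      moreover have "rats \<tau> \<subseteq> gen_field {\<tau>, \<omega>}" using gen_field by (intro rats_subset) auto
      ultimately show "{t, s} \<subseteq> gen_field {\<tau>, \<omega>}" using \<tau>(1) rats_basic(2)[of t] by auto
    qed (use gen_field in auto)
    moreover have "\<tau> = \<tau> ^ 1 * 1" by simp
    ultimately have "V = local_ring \<tau> \<omega>" "rational"
      using chart[of \<tau> \<omega> a "ev \<iota> G \<tau>" \<tau> 1 1] hV(2) \<tau>0 \<omega>M algebraic[OF \<tau>(1)] U_facts(3) zero_less_one by blast+
    then show ?thesis using c\<gamma> hV by (auto simp: rational_rings_def \<omega>_def)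
  qed
  have ex: "\<exists>V. valuation_ring \<iota> L V \<and> \<tau> \<in> nonunits V \<and> s - \<iota> c \<in> nonunits V" if c: "c ^ q - c = \<gamma>" for c
  proof -
    obtain V0 where V0: "valuation_ring \<iota> L V0" "\<tau> \<in> nonunits V0"
      using ex_valuation_ring[OF L_facts(1,2) \<tau>(2,3)] by blast
    interpret v0: valued_field \<iota> L V0 by unfold_locales (fact L_facts V0)+
    have sV: "s - \<iota> c \<in> V0" using base[OF V0] v0.V_ring(3) v0.V_facts(3) by blast
    \<comment> \<open>The product equals \<open>(s - \<iota> c)^q - (s - \<iota> c)\<close>. One
      factor lies in the maximal ideal of \<open>V0\<close>, so there \<open>s\<close> has the
      residue \<open>c + d\<close> for some \<open>d\<close> in \<open>F_q\<close>.\<close>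
    have "(\<Prod>d\<in>Fq q. (s - \<iota> c) - \<iota> d) = s ^ q - s - \<iota> \<gamma>"
      unfolding factor_AS using c by (simp add: frob_diff flip: c)
    also have "\<dots> \<in> v0.M" using base[OF V0] by blast
    finally have p: "(\<Prod>d\<in>Fq q. (s - \<iota> c) - \<iota> d) \<in> v0.M" .
    have prod: "\<exists>d\<in>S. (s - \<iota> c) - \<iota> d \<in> v0.M" if "finite S" "(\<Prod>d\<in>S. (s - \<iota> c) - \<iota> d) \<in> v0.M" for S
      using that
    proof (induction S rule: finite_induct)
      case empty
      then show ?case using v0.M_facts(8) by simp
    next
      case (insert d S)
      have V: "(s - \<iota> c) - \<iota> d \<in> V0" for d using sV v0.V_ring(3) v0.V_facts(3) by blast
      have "(\<Prod>d\<in>S. (s - \<iota> c) - \<iota> d) \<in> V0"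
        using insert.hyps(1) by (induction S rule: finite_induct) (auto intro!: v0.V_ring V)
      then have "(s - \<iota> c) - \<iota> d \<in> v0.M \<or> (\<Prod>d\<in>S. (s - \<iota> c) - \<iota> d) \<in> v0.M"
        using insert.prems insert.hyps by (intro v0.M_prime[OF V]) simp_all
      then show ?case using insert.IH by blast
    qed
    from prod[OF finite p] obtain d where d: "d \<in> Fq q" "(s - \<iota> c) - \<iota> d \<in> v0.M" by blast
    have s': "s - \<iota> d \<in> L" using L_facts is_subringD(3)[OF is_subfieldD(1)] by blast
    have "\<tau> \<in> rats t" using \<tau>(1) rats_basic(2) by blast
    have KF: "range \<iota> \<subseteq> rats t" using rats_basic by auto
    \<comment> \<open>Pulling \<open>V0\<close> back along \<open>s \<mapsto> s - \<iota> d\<close>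
      changes the residue of \<open>s\<close> from \<open>c + d\<close> to \<open>c\<close>.\<close>
    obtain V where V: "valuation_ring \<iota> L V"
      "\<And>f. coeffs_in (rats t) f \<Longrightarrow> poly f s \<in> nonunits V \<longleftrightarrow> poly f (s - \<iota> d) \<in> nonunits V0"
      using twist_valuation_ring[OF is_subfield_rats KF L_facts(1,6) s' conjugate_root[OF d(1)] V0(1) \<open>\<tau> \<in> rats t\<close> V0(2) \<tau>0]
      by blast
    note Fr = is_subfieldD(1)[OF is_subfield_rats[of t]]
    have "coeffs_in (rats t) [:\<tau>:]" using \<open>\<tau> \<in> rats t\<close> coeffs_in_basic(3)[OF Fr] by blast
    then have "\<tau> \<in> nonunits V" using V(2)[of "[:\<tau>:]"] V0(2) by simp
    moreover have "coeffs_in (rats t) [:- \<iota> c, 1:]"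
      using KF is_subringD(1,5)[OF Fr] by (intro coeffs_in_basic[OF Fr]) auto
    then have "s - \<iota> c \<in> nonunits V" using V(2)[of "[:- \<iota> c, 1:]"] d(2) by (simp add: algebra_simps)
    ultimately show ?thesis using V(1) by blast
  qed
  have "bij_betw (\<lambda>c. local_ring \<tau> (s - \<iota> c)) {c. c ^ q - c = \<gamma>} {V \<in> rational_rings L. \<tau> \<in> nonunits V}"
  proof (rule bij_betw_imageI)
    have loc: "local_ring \<tau> (s - \<iota> c) \<in> rational_rings L \<and> \<tau> \<in> nonunits (local_ring \<tau> (s - \<iota> c))
      \<and> s - \<iota> c \<in> nonunits (local_ring \<tau> (s - \<iota> c))" if "c ^ q - c = \<gamma>" for c
      using ex[OF that] uniq by metis
    show "inj_on (\<lambda>c. local_ring \<tau> (s - \<iota> c)) {c. c ^ q - c = \<gamma>}"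
    proof (rule inj_onI)
      fix c d assume h: "c \<in> {c. c ^ q - c = \<gamma>}" "d \<in> {c. c ^ q - c = \<gamma>}"
        "local_ring \<tau> (s - \<iota> c) = local_ring \<tau> (s - \<iota> d)"
      define V where "V = local_ring \<tau> (s - \<iota> c)"
      have hV: "valuation_ring \<iota> L V" "s - \<iota> c \<in> nonunits V" "s - \<iota> d \<in> nonunits V"
        using loc[of c] loc[of d] h by (auto simp: V_def rational_rings_def)
      interpret valued_field \<iota> L V by unfold_locales (fact L_facts hV)+
      have "(s - \<iota> d) - (s - \<iota> c) \<in> M" using hV M_facts(7) by blast
      then show "c = d" using const_M[of "c - d"] by simp
    qed
    show "(\<lambda>c. local_ring \<tau> (s - \<iota> c)) ` {c. c ^ q - c = \<gamma>} = {V \<in> rational_rings L. \<tau> \<in> nonunits V}"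
    proof (rule subset_antisym)
      show "(\<lambda>c. local_ring \<tau> (s - \<iota> c)) ` {c. c ^ q - c = \<gamma>} \<subseteq> {V \<in> rational_rings L. \<tau> \<in> nonunits V}"
        using loc by blast
      show "{V \<in> rational_rings L. \<tau> \<in> nonunits V} \<subseteq> (\<lambda>c. local_ring \<tau> (s - \<iota> c)) ` {c. c ^ q - c = \<gamma>}"
      proof
        fix V assume "V \<in> {V \<in> rational_rings L. \<tau> \<in> nonunits V}"
        then have hV: "valuation_ring \<iota> L V" "\<tau> \<in> nonunits V" "valued_field.rational \<iota> V"
          by (auto simp: rational_rings_def)
        interpret valued_field \<iota> L V by unfold_locales (fact L_facts hV)+
        obtain c where "s - \<iota> c \<in> M" using hV(3) base[OF hV(1,2)] by (auto simp: rational_def res_def)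
        then show "V \<in> (\<lambda>c. local_ring \<tau> (s - \<iota> c)) ` {c. c ^ q - c = \<gamma>}" using uniq[OF hV(1,2)] by blast
      qed
    qed
  qed
  note bij = this
  show "finite {V \<in> rational_rings L. \<tau> \<in> nonunits V}"
    using bij_betw_finite[OF bij] by simp
  show "card {V \<in> rational_rings L. \<tau> \<in> nonunits V} = card {c. c ^ q - c = \<gamma>}"
    using bij_betw_same_card[OF bij] by simp
qed

end

context AS_ext
begin

text \<open>At a rational place \<open>t\<close> either has a pole or has a residue in
  \<open>K\<close>, and never two of these at once.\<close>

lemma card_rational_rings:
  assumes "\<And>c. finite {V \<in> rational_rings L. t - \<iota> c \<in> nonunits V}"
    "finite {V \<in> rational_rings L. inverse t \<in> nonunits V}"
  shows "finite (rational_rings L)"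
    "card (rational_rings L) = (\<Sum>c\<in>UNIV. card {V \<in> rational_rings L. t - \<iota> c \<in> nonunits V})
      + card {V \<in> rational_rings L. inverse t \<in> nonunits V}"
proof -
  define A where "A c = {V \<in> rational_rings L. t - \<iota> c \<in> nonunits V}" for c
  define B where "B = {V \<in> rational_rings L. inverse t \<in> nonunits V}"
  have t0: "t \<noteq> 0" using tr[of "[:0, 1:]"] by auto
  have vf: "valued_field \<iota> L V" if "V \<in> rational_rings L" for V
  proof -
    have "valuation_ring \<iota> L V" using that by (simp add: rational_rings_def)
    then show ?thesis by unfold_locales (rule L_facts(1))
  qed
  have un: "rational_rings L = (\<Union>c\<in>UNIV. A c) \<union> B"
  proof -
    have "V \<in> (\<Union>c\<in>UNIV. A c) \<union> B" if hV: "V \<in> rational_rings L" for V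
    proof -
      interpret valued_field \<iota> L V by (rule vf[OF hV])
      show ?thesis
      proof (cases "t \<in> V")
        case True
        then show ?thesis using hV unfolding rational_rings_def A_def by (auto simp: rational_def res_def)
      next
        case False
        then show ?thesis using hV inverse_M L_facts(5) by (auto simp: B_def)
      qed
    qed
    then show ?thesis by (auto simp: A_def B_def)
  qed
  have disj: "A c \<inter> A d = {}" if "c \<noteq> d" for c d
  proof -
    have False if hV: "V \<in> A c" "V \<in> A d" for V
    proof -
      interpret valued_field \<iota> L V by (rule vf) (use hV in \<open>auto simp: A_def\<close>)
      have "t - \<iota> d \<in> M" "t - \<iota> c \<in> M" using hV by (auto simp: A_def)
      then have "(t - \<iota> d) - (t - \<iota> c) \<in> M" by (rule M_facts(7))
      then show False using const_M[of "c - d"] \<open>c \<noteq> d\<close> by simp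
    qed
    then show ?thesis by blast
  qed
  have disjB: "A c \<inter> B = {}" for c
  proof -
    have False if hV: "V \<in> A c" "V \<in> B" for V
    proof -
      interpret valued_field \<iota> L V by (rule vf) (use hV in \<open>auto simp: A_def\<close>)
      have "t \<in> V" using hV V_ring(6)[OF M_facts(1) V_facts(3)[of c], of "t - \<iota> c"] by (auto simp: A_def)
      then show False using hV not_in_V[of "inverse t"] t0 by (auto simp: B_def)
    qed
    then show ?thesis by blast
  qed
  have fin: "finite (A c)" "finite B" for c using assms by (auto simp: A_def B_def)
  then show "finite (rational_rings L)" unfolding un by simp
  have "card (rational_rings L) = card (\<Union>c\<in>UNIV. A c) + card B"
    unfolding un using fin disjB by (intro card_Un_disjoint) auto
  also have "card (\<Union>c\<in>UNIV. A c) = (\<Sum>c\<in>UNIV. card (A c))"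
    using fin disj by (intro card_UN_disjoint) auto
  finally show "card (rational_rings L) = (\<Sum>c\<in>UNIV. card {V \<in> rational_rings L. t - \<iota> c \<in> nonunits V})
      + card {V \<in> rational_rings L. inverse t \<in> nonunits V}" by (simp add: A_def B_def)
qed

end

section \<open>Character sums\<close>

text \<open>Translation by 1 permutes the field and so preserves the sum of all elements.\<close>

lemma of_nat_card_UNIV: "of_nat (card (UNIV :: 'k::{finite,field} set)) = (0::'k)"
proof -
  have "(\<Sum>x\<in>UNIV. x + 1) = (\<Sum>x\<in>(UNIV :: 'k set). x)"
    by (rule sum.reindex_bij_witness[of _ "\<lambda>x. x - 1" "\<lambda>x. x + 1"]) auto
  then show ?thesis by (simp add: sum.distrib)
qed

lemma power_card_UNIV: "(x :: 'k::{finite,field}) ^ card (UNIV :: 'k set) = x"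
proof (cases "x = 0")
  case False
  have "(\<Prod>y\<in>UNIV - {0}. x * y) = (\<Prod>y\<in>UNIV - {0}. y)"
    by (rule prod.reindex_bij_witness[of _ "\<lambda>y. y / x" "\<lambda>y. x * y"]) (use False in auto)
  then have "x ^ (card (UNIV :: 'k set) - 1) = 1" by (simp add: prod.distrib)
  moreover obtain k where "card (UNIV :: 'k set) = Suc k" using finite_UNIV_card_ge_0[where ?'a = 'k] by (cases "card (UNIV :: 'k set)") auto
  ultimately show ?thesis by simp
qed (use finite_UNIV_card_ge_0[where ?'a = 'k] in auto)

lemma CHAR_eq_prime:
  assumes "prime p" "of_nat p = (0::'a::field)"
  shows "CHAR('a) = p"
proof -
  have "CHAR('a) dvd p" using assms(2) of_nat_eq_0_iff_char_dvd by blast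
  then show ?thesis using assms(1) CHAR_not_1'[where ?'a = 'a] by (auto simp: prime_nat_iff)
qed

section \<open>The canonical additive character\<close>

locale finite_field_pn =
  fixes p n :: nat and T :: "'k::{finite,field} itself"
  assumes p: "prime p" and n: "n \<ge> 1" and card_K: "card (UNIV :: 'k set) = p ^ n"
begin

lemma of_nat_p: "of_nat p = (0 :: 'k)"
  using of_nat_card_UNIV[where ?'k = 'k] unfolding card_K by simp

lemma CHAR_K: "CHAR('k) = p" by (rule CHAR_eq_prime[OF p of_nat_p])

lemma frobenius: "(x + y :: 'k) ^ (p ^ i) = x ^ (p ^ i) + y ^ (p ^ i)"
  by (rule freshmans_dream') (use p CHAR_K in auto)

lemma frobenius_diff: "(x - y :: 'k) ^ (p ^ i) = x ^ (p ^ i) - y ^ (p ^ i)"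
  using frobenius[of "x - y" y i] by (simp add: algebra_simps)

lemma p_gt_1: "p > 1" using p prime_gt_1_nat by blast

abbreviation Tr :: "'k \<Rightarrow> 'k" where "Tr \<equiv> abs_trace p n"

lemma Tr_add: "Tr (x + y) = Tr x + Tr y"
  by (simp add: abs_trace_def frobenius sum.distrib)

lemma Tr_p: "Tr (x ^ p) = Tr x"
proof -
  obtain k where k: "n = Suc k" using n by (cases n) auto
  have "Tr (x ^ p) = (\<Sum>i<n. x ^ (p ^ Suc i))" by (simp add: abs_trace_def power_mult)
  also have "\<dots> = (\<Sum>i<k. x ^ (p ^ Suc i)) + x ^ (p ^ n)" unfolding k by simp
  also have "x ^ (p ^ n) = x" using power_card_UNIV[of x] unfolding card_K .
  also have "(\<Sum>i<k. x ^ (p ^ Suc i)) + x = Tr x"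
    unfolding abs_trace_def k sum.lessThan_Suc_shift by simp
  finally show ?thesis .
qed

lemma Tr_power_p: "Tr x ^ p = Tr x"
proof -
  have "(\<Sum>i\<in>S. f i) ^ p = (\<Sum>i\<in>S. (f i :: 'k) ^ p)" for S :: "nat set" and f
    using frobenius[of _ _ 1] p_gt_1 by (induction S rule: infinite_finite_induct) auto
  then have "Tr x ^ p = Tr (x ^ p)" by (simp add: abs_trace_def flip: power_mult) (simp add: mult.commute)
  then show ?thesis by (simp add: Tr_p)
qed

lemma of_nat_eq_iff_mod: "of_nat a = (of_nat b :: 'k) \<longleftrightarrow> a mod p = b mod p"
proof -
  have *: "of_nat a = (of_nat b :: 'k) \<longleftrightarrow> a mod p = b mod p" if "b \<le> a" for a b
  proof -
    have "of_nat a = (of_nat b :: 'k) \<longleftrightarrow> of_nat (a - b) = (0 :: 'k)" using that by (simp add: of_nat_diff)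
    also have "\<dots> \<longleftrightarrow> p dvd a - b" using of_nat_eq_0_iff_char_dvd[where ?'a = 'k] CHAR_K by simp
    also have "\<dots> \<longleftrightarrow> a mod p = b mod p" using that by (metis mod_eq_dvd_iff_nat)
    finally show ?thesis .
  qed
  show ?thesis using *[of a b] *[of b a] by (cases "b \<le> a") auto
qed

text \<open>The \<open>p\<close> distinct multiples of 1 are already as many roots as
  \<open>X^p - X\<close> can have.\<close>

lemma prime_field:
  assumes "(y :: 'k) ^ p = y"
  shows "\<exists>j<p. of_nat j = y"
proof -
  define f :: "'k poly" where "f = monom 1 p - monom 1 1"
  have "coeff f p = 1" using p_gt_1 by (simp add: f_def coeff_monom)
  then have f0: "f \<noteq> 0" by auto
  have df: "degree f \<le> p" unfolding f_def using p_gt_1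
    by (intro degree_diff_le order_trans[OF degree_monom_le]) auto
  define S where "S = (of_nat :: nat \<Rightarrow> 'k) ` {..<p}"
  have "inj_on (of_nat :: nat \<Rightarrow> 'k) {..<p}" by (rule inj_onI) (simp add: of_nat_eq_iff_mod)
  then have cS: "card S = p" by (simp add: S_def card_image)
  have nat_p: "(of_nat j :: 'k) ^ p = of_nat j" for j
    using frobenius[of _ _ 1] p_gt_1 by (induction j) auto
  have sub: "S \<subseteq> {x. poly f x = 0}" by (auto simp: S_def f_def poly_monom nat_p)
  have "S = {x. poly f x = 0}"
  proof (rule card_seteq[OF poly_roots_finite[OF f0] sub])
    show "card {x. poly f x = 0} \<le> card S" using card_poly_roots_bound[OF f0] df cS by linarith
  qed
  moreover have "y \<in> {x. poly f x = 0}" using assms by (simp add: f_def poly_monom)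
  ultimately have "y \<in> S" by (simp only:)
  then show ?thesis by (auto simp: S_def)
qed

abbreviation e :: "'k \<Rightarrow> complex" where "e \<equiv> add_char p n"

definition zeta :: complex where "zeta = cis (2 * pi / real p)"

lemma zeta_power: "zeta ^ j = cis (2 * pi * real j / real p)" "zeta ^ p = 1"
proof -
  show *: "zeta ^ j = cis (2 * pi * real j / real p)" for j by (simp add: zeta_def DeMoivre mult.commute)
  show "zeta ^ p = 1" unfolding * using p_gt_1 by simp
qed

lemma zeta_mod: "zeta ^ (a mod p) = zeta ^ a"
proof -
  have "zeta ^ a = zeta ^ (p * (a div p) + a mod p)" by simp
  also have "\<dots> = zeta ^ (a mod p)" by (simp only: power_add power_mult zeta_power(2)) simp
  finally show ?thesis by simp
qed

text \<open>Any natural number representing the trace may serve as exponent, so representatives can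
  be added without reduction modulo \<open>p\<close>.\<close>

lemma e_eq:
  assumes "of_nat a = Tr z"
  shows "e z = zeta ^ a"
proof -
  have "(THE j. j < p \<and> of_nat j = Tr z) = a mod p"
  proof (rule the_equality)
    have "of_nat (a mod p) = (of_nat a :: 'k)" by (simp add: of_nat_eq_iff_mod)
    then show "a mod p < p \<and> of_nat (a mod p) = Tr z" using assms p_gt_1 by simp
    fix j assume "j < p \<and> of_nat j = Tr z"
    then show "j = a mod p" using assms of_nat_eq_iff_mod[of j a] by simp
  qed
  then have "e z = exp (\<i> * of_real (2 * pi * real (a mod p) / real p))"
    by (simp add: add_char_def field_simps)
  also have "\<dots> = zeta ^ (a mod p)" by (simp only: zeta_power(1) cis_conv_exp)
  finally show ?thesis by (simp add: zeta_mod)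
qed

lemma Tr_nat: obtains j where "j < p" "of_nat j = Tr z" "e z = zeta ^ j"
  using prime_field[OF Tr_power_p[of z]] e_eq by blast

lemma e_add: "e (z + w) = e z * e w"
proof -
  obtain a b where ab: "of_nat a = Tr z" "e z = zeta ^ a" "of_nat b = Tr w" "e w = zeta ^ b"
    using Tr_nat by metis
  then have "of_nat (a + b) = Tr (z + w)" by (simp add: Tr_add)
  then show ?thesis using e_eq[of "a + b"] ab by (simp add: power_add)
qed

lemma e_0: "e 0 = 1"
  using e_eq[of 0 0] p_gt_1 by (simp add: abs_trace_def power_0_left)

lemma e_q: "e (z ^ (p ^ i)) = e z"
proof -
  have "Tr (z ^ (p ^ i)) = Tr z"
    by (induction i) (auto simp: power_mult mult.commute[of p] Tr_p)
  then show ?thesis by (simp add: add_char_def)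
qed

text \<open>The trace is a nonzero polynomial of degree at most \<open>p^(n-1)\<close>, too small to
  vanish on all \<open>p^n\<close> elements, and \<open>zeta\<close> is a primitive root of unity of
  order \<open>p\<close>.\<close>

lemma e_nontrivial: "\<exists>z. e z \<noteq> 1"
proof -
  define f :: "'k poly" where "f = (\<Sum>i<n. monom 1 (p ^ i))"
  have pf: "poly f z = Tr z" for z by (simp add: f_def poly_sum poly_monom abs_trace_def)
  have inj: "p ^ i = p ^ j \<longleftrightarrow> i = j" for i j using p_gt_1 by simp
  have "coeff f (p ^ (n - 1)) = 1"
    using n by (simp add: f_def coeff_sum coeff_monom inj)
  then have f0: "f \<noteq> 0" by auto
  have df: "degree f \<le> p ^ (n - 1)" unfolding f_def
    using p_gt_1 by (intro degree_sum_le order_trans[OF degree_monom_le]) (auto intro: power_increasing)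
  have "\<exists>z. Tr z \<noteq> 0"
  proof (rule ccontr)
    assume "\<nexists>z. Tr z \<noteq> 0"
    then have "{z. poly f z = 0} = UNIV" using pf by auto
    then have "p ^ n \<le> p ^ (n - 1)" using card_poly_roots_bound[OF f0] df card_K by simp
    moreover have "p ^ (n - 1) < p ^ n" using p_gt_1 n by (intro power_strict_increasing) auto
    ultimately show False by simp
  qed
  then obtain z where z: "Tr z \<noteq> 0" by blast
  obtain j where j: "j < p" "of_nat j = Tr z" "e z = zeta ^ j" using Tr_nat by blast
  have "j \<noteq> 0" using j z by (auto intro: gr0I)
  have "zeta ^ j \<noteq> zeta ^ 0"
  proof
    assume h: "zeta ^ j = zeta ^ 0"
    have "inj_on (\<lambda>k. cis (2 * pi * real k / real p)) {..<p}"
      using bij_betw_roots_unity[of p] p_gt_1 by (auto simp: bij_betw_def)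
    then have "j = 0" using h j(1) unfolding zeta_power(1) inj_on_def by auto
    then show False using \<open>j \<noteq> 0\<close> by simp
  qed
  then show ?thesis using j(3) by (metis power_0)
qed

text \<open>Translation by an \<open>a\<close> with \<open>\<chi> a \<noteq> 1\<close> permutes
  \<open>A\<close>, yet multiplies the sum by \<open>\<chi> a\<close>. Needed both for the whole
  field and for \<open>F_q\<close>.\<close>

lemma character_sum_subgroup:
  assumes A: "finite A" "\<And>x y. x \<in> A \<Longrightarrow> y \<in> A \<Longrightarrow> x + y \<in> A" "\<And>x y. x \<in> A \<Longrightarrow> y \<in> A \<Longrightarrow> x - y \<in> A"
    and \<chi>: "\<And>x y. \<chi> (x + y) = \<chi> x * (\<chi> y :: complex)"
  shows "(\<Sum>x\<in>A. \<chi> (x :: 'k)) = 0 \<or> (\<forall>x\<in>A. \<chi> x = 1)"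
proof (rule disjCI)
  assume "\<not> (\<forall>x\<in>A. \<chi> x = 1)"
  then obtain a where a: "a \<in> A" "\<chi> a \<noteq> 1" by blast
  have "(\<Sum>x\<in>A. \<chi> x) = (\<Sum>x\<in>A. \<chi> (a + x))"
    by (rule sum.reindex_bij_witness[of _ "\<lambda>x. a + x" "\<lambda>x. x - a"]) (use A a in auto)
  also have "\<dots> = \<chi> a * (\<Sum>x\<in>A. \<chi> x)" by (simp add: \<chi> sum_distrib_left)
  finally show "(\<Sum>x\<in>A. \<chi> x) = 0" using a(2) by simp
qed

lemma e_sum: "(\<Sum>z\<in>UNIV. e (u * z)) = (if u = 0 then of_nat (p ^ n) else 0)"
proof (cases "u = 0")
  case True
  then show ?thesis by (simp add: e_0 card_K)
next
  case False
  obtain z where z: "e z \<noteq> 1" using e_nontrivial by blast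
  then have nt: "e (u * (z / u)) \<noteq> 1" using False by simp
  have "(\<Sum>z\<in>UNIV. e (u * z)) = 0 \<or> (\<forall>z\<in>UNIV. e (u * z) = 1)"
    by (rule character_sum_subgroup) (auto simp: e_add distrib_left)
  then show ?thesis using nt False by (metis UNIV_I)
qed

end

section \<open>Solutions of t^q - t = z and character sums\<close>

locale finite_field_qm = finite_field_pn p "r * m" T for p r m and T :: "'k::{finite,field} itself" +
  fixes q :: nat
  assumes r: "r \<ge> 1" and m: "m \<ge> 1" and q: "q = p ^ r"
begin

lemma q_ge_2: "q \<ge> 2" using p_gt_1 r self_le_power[of p r] by (simp add: q)

lemma card_qm: "card (UNIV :: 'k set) = q ^ m" using card_K by (simp add: q power_mult)

lemma frob_q: "(x + y :: 'k) ^ q = x ^ q + y ^ q" "(x - y :: 'k) ^ q = x ^ q - y ^ q"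
  by (simp_all add: q frobenius frobenius_diff)

text \<open>\<open>X^q - X\<close> divides \<open>X^(q^m) - X\<close>, which has \<open>q^m\<close>
  distinct roots. The cofactor has at most \<open>q^m - q\<close> of them, so at least
  \<open>q\<close> remain. Divisibility follows by induction from
  \<open>X (Suc i) = X i ^ q + X 1\<close>.\<close>

lemma card_Fq: "card (Fq q :: 'k set) = q"
proof -
  define X where "X i = monom 1 (q ^ i) - monom (1::'k) 1" for i
  have "CHAR('k poly) = p" using CHAR_K by simp
  then have fr: "(f + g) ^ q = f ^ q + g ^ q" for f g :: "'k poly"
    unfolding q by (intro freshmans_dream') (use p in auto)
  have fr': "(f - g) ^ q = f ^ q - g ^ q" for f g :: "'k poly"
    using fr[of "f - g" g] by (simp add: algebra_simps)
  have dvd: "X 1 dvd X i" for i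
  proof (induction i)
    case 0
    then show ?case by (simp add: X_def)
  next
    case (Suc i)
    have "X (Suc i) = X i ^ q + X 1" by (simp add: X_def fr' monom_power mult.commute)
    moreover have "X i dvd X i ^ q" using q_ge_2 by (simp add: dvd_power)
    ultimately show ?case using Suc by (metis dvd_add dvd_refl dvd_trans)
  qed
  have deg: "degree (X i) = q ^ i" "X i \<noteq> 0" if "i \<ge> 1" for i
  proof -
    have "q ^ i > 1" using q_ge_2 that by (intro one_less_power) auto
    then have "coeff (X i) (q ^ i) = 1" by (auto simp: X_def coeff_monom)
    moreover have "degree (X i) \<le> q ^ i" unfolding X_def using \<open>q ^ i > 1\<close>
      by (intro degree_diff_le order_trans[OF degree_monom_le]) auto
    ultimately show "degree (X i) = q ^ i" "X i \<noteq> 0" using le_degree[of "X i" "q ^ i"] by auto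
  qed
  obtain h where h: "X m = X 1 * h" using dvd by blast
  then have h0: "h \<noteq> 0" "degree h = q ^ m - q"
    using deg(2)[OF m] deg(1)[OF m] deg[of 1] degree_mult_eq[of "X 1" h] by auto
  have "UNIV = {x. poly (X m) x = 0}"
    using power_card_UNIV[where ?'k = 'k] unfolding card_qm by (auto simp: X_def poly_monom)
  also have "\<dots> = {x. poly (X 1) x = 0} \<union> {x. poly h x = 0}" by (auto simp: h)
  finally have "q ^ m \<le> card {x. poly (X 1) x = 0} + card {x. poly h x = 0}"
    using card_Un_le[of "{x. poly (X 1) x = 0}" "{x. poly h x = 0}"] card_qm by metis
  moreover have "card {x. poly h x = 0} \<le> q ^ m - q" using card_poly_roots_bound[OF h0(1)] h0 by simp
  moreover have "q \<le> q ^ m" using m q_ge_2 by (intro self_le_power) auto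
  ultimately have "q \<le> card {x. poly (X 1) x = 0}" by simp
  moreover have "card {x. poly (X 1) x = 0} \<le> q" using card_poly_roots_bound[OF deg(2)[of 1]] deg[of 1] by simp
  moreover have "{x. poly (X 1) x = 0} = Fq q" by (auto simp: X_def poly_monom Fq_def)
  ultimately show ?thesis by simp
qed

definition AS_count :: "'k \<Rightarrow> nat" where "AS_count z = card {t. t ^ q - t = z}"

lemma Fq_0: "0 \<in> (Fq q :: 'k set)" using q_ge_2 by (simp add: Fq_def)

lemma AS_count_image: "AS_count (t ^ q - t) = q"
proof -
  have "bij_betw (\<lambda>c. t + c) (Fq q) {u. u ^ q - u = t ^ q - t}"
    by (rule bij_betw_byWitness[where f' = "\<lambda>u. u - t"]) (auto simp: Fq_def frob_q algebra_simps)
  from bij_betw_same_card[OF this] show ?thesis by (simp add: AS_count_def card_Fq)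
qed

lemma AS_count_shift: "AS_count (z + (w ^ q - w)) = AS_count z"
proof -
  have 1: "(t + w) ^ q - (t + w) = (t ^ q - t) + (w ^ q - w)" for t by (simp add: frob_q)
  have 2: "(u - w) ^ q - (u - w) = (u ^ q - u) - (w ^ q - w)" for u by (simp add: frob_q)
  have "bij_betw (\<lambda>t. t + w) {t. t ^ q - t = z} {t. t ^ q - t = z + (w ^ q - w)}"
  proof (rule bij_betw_byWitness[where f' = "\<lambda>u. u - w"])
    show "(\<lambda>t. t + w) ` {t. t ^ q - t = z} \<subseteq> {t. t ^ q - t = z + (w ^ q - w)}"
      by (auto simp only: 1 image_subset_iff mem_Collect_eq)
    show "(\<lambda>u. u - w) ` {t. t ^ q - t = z + (w ^ q - w)} \<subseteq> {t. t ^ q - t = z}"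
      by (auto simp only: 2 image_subset_iff mem_Collect_eq add_diff_cancel_right')
  qed auto
  from bij_betw_same_card[OF this] show ?thesis by (simp add: AS_count_def)
qed

lemma sum_over_AS_map: "(\<Sum>t\<in>UNIV. g (t ^ q - t)) = (\<Sum>z\<in>UNIV. of_nat (AS_count z) * (g (z :: 'k) :: complex))"
proof -
  have "(\<Sum>t\<in>UNIV. g (t ^ q - t)) = (\<Sum>z\<in>UNIV. \<Sum>t\<in>{t \<in> UNIV. t ^ q - t = z}. g (t ^ q - t))"
    by (rule sum.group[symmetric]) auto
  also have "\<dots> = (\<Sum>z\<in>UNIV. of_nat (AS_count z) * g z)"
    by (intro sum.cong refl) (simp add: AS_count_def)
  finally show ?thesis .
qed

lemma sum_AS_count: "(\<Sum>z\<in>UNIV. of_nat (AS_count z) :: complex) = of_nat (q ^ m)"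
  using sum_over_AS_map[of "\<lambda>_. 1"] by (simp add: card_qm)

text \<open>Both sides equal \<open>q\<close> when \<open>z\<close> has the form
  \<open>t^q - t\<close>. For other \<open>z\<close> the left-hand side is 0, and since both sides
  have the same sum \<open>q^m\<close> over all \<open>z\<close>, the right-hand side is 0 there
  too.\<close>

lemma AS_count_character: "of_nat (AS_count z) = (\<Sum>u\<in>Fq q. e (u * z))"
proof -
  define F where "F z = (\<Sum>u\<in>Fq q. e (u * z))" for z
  have img: "F (t ^ q - t) = of_nat q" for t
  proof -
    have "e (u * (t ^ q - t)) = 1" if "u \<in> Fq q" for u
    proof -
      \<comment> \<open>Here \<open>u^q = u\<close>, and \<open>e\<close> is invariant under
        \<open>q\<close>-th powers.\<close>
      have "u * (t ^ q - t) + u * t = (u * t) ^ q" using that by (simp add: Fq_def algebra_simps power_mult_distrib)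
      then have "e (u * (t ^ q - t)) * e (u * t) = e (u * t)" using e_q[of "u * t" r] by (metis e_add q)
      moreover have "e (u * t) * e (- (u * t)) = 1" by (simp add: e_0 flip: e_add)
      ultimately show ?thesis by (metis mult.assoc mult_cancel_right2 mult_zero_left zero_neq_one)
    qed
    then show ?thesis by (simp add: F_def card_Fq)
  qed
  have val: "F z = 0 \<or> F z = of_nat q" for z
  proof -
    have "(\<Sum>u\<in>Fq q. e (u * z)) = 0 \<or> (\<forall>u\<in>Fq q. e (u * z) = 1)"
      by (rule character_sum_subgroup) (auto simp: Fq_def frob_q e_add ring_distribs)
    then show ?thesis by (auto simp: F_def card_Fq)
  qed
  have cnt: "AS_count z = 0 \<or> of_nat (AS_count z) = F z" for z
  proof (cases "{t. t ^ q - t = z} = {}")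
    case True
    then show ?thesis by (simp add: AS_count_def)
  next
    case False
    then obtain t where "z = t ^ q - t" by blast
    then show ?thesis using AS_count_image img by simp
  qed
  have F_sum: "(\<Sum>z\<in>UNIV. F z) = of_nat (q ^ m)"
  proof -
    have "(\<Sum>z\<in>UNIV. F z) = (\<Sum>u\<in>Fq q. \<Sum>z\<in>UNIV. e (u * z))" unfolding F_def by (rule sum.swap)
    also have "\<dots> = (\<Sum>u\<in>(Fq q :: 'k set). if u = 0 then of_nat (p ^ (r * m)) else 0)" by (simp only: e_sum)
    also have "\<dots> = of_nat (q ^ m)" using Fq_0 by (simp add: q power_mult)
    finally show ?thesis .
  qed
  have "(\<Sum>z\<in>UNIV. Re (F z) - real (AS_count z)) = 0"
  proof -
    have "(\<Sum>z\<in>UNIV. F z - of_nat (AS_count z)) = 0" using F_sum sum_AS_count by (simp add: sum_subtractf)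
    then have "Re (\<Sum>z\<in>UNIV. F z - of_nat (AS_count z)) = 0" by simp
    then show ?thesis by simp
  qed
  \<comment> \<open>\<open>F z\<close> is 0 or \<open>q\<close> and equals the count wherever the
    count is nonzero, so no difference is negative; being of sum 0, they all vanish.\<close>
  moreover have nn: "Re (F z) - real (AS_count z) \<ge> 0" for z
    using cnt[of z] val[of z] by (metis Re_complex_of_real complex_Re_of_nat diff_ge_0_iff_ge diff_self of_nat_0 of_nat_0_le_iff order_refl zero_complex.simps(1))
  ultimately have "Re (F z) - real (AS_count z) = 0" using sum_nonneg_eq_0_iff[of UNIV "\<lambda>z. Re (F z) - real (AS_count z)"] by simp
  moreover have "Im (F z) = 0" using val[of z] by auto
  ultimately show ?thesis unfolding F_def[symmetric] by (simp add: complex_eq_iff)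
qed

lemma AS_count_product_sum:
  "(\<Sum>z\<in>Z. of_nat (AS_count z) * of_nat (AS_count (\<beta> + h z)) :: complex) =
    (\<Sum>v\<in>Fq q. e (\<beta> * v) * (\<Sum>u\<in>Fq q. \<Sum>z\<in>Z. e (u * z + v * h z)))"
proof -
  have "(\<Sum>z\<in>Z. of_nat (AS_count z) * of_nat (AS_count (\<beta> + h z)) :: complex) =
    (\<Sum>z\<in>Z. \<Sum>v\<in>Fq q. \<Sum>u\<in>Fq q. e (\<beta> * v) * e (u * z + v * h z))"
    unfolding AS_count_character sum_product
  proof (subst sum.swap, intro sum.cong refl)
    fix z u v :: 'k
    have "u * z + v * (\<beta> + h z) = \<beta> * v + (u * z + v * h z)" by (simp add: algebra_simps)
    then show "e (u * z) * e (v * (\<beta> + h z)) = e (\<beta> * v) * e (u * z + v * h z)" by (simp only: e_add[symmetric])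
  qed
  also have "\<dots> = (\<Sum>v\<in>Fq q. \<Sum>z\<in>Z. \<Sum>u\<in>Fq q. e (\<beta> * v) * e (u * z + v * h z))" by (rule sum.swap)
  also have "\<dots> = (\<Sum>v\<in>Fq q. e (\<beta> * v) * (\<Sum>u\<in>Fq q. \<Sum>z\<in>Z. e (u * z + v * h z)))"
    by (simp add: sum_distrib_left, subst sum.swap, rule refl)
  finally show ?thesis .
qed


text \<open>The summand \<open>v = 0\<close> contributes \<open>q^m\<close> by
  orthogonality.\<close>

lemma count_cubic:
  "(\<Sum>z\<in>UNIV. of_nat (AS_count z) * of_nat (AS_count (\<beta> + z powi 3)) :: complex) =
    of_nat (q ^ m) + (\<Sum>v\<in>Fq q - {0}. e (\<beta> * v) * (\<Sum>u\<in>Fq q. S_sum p (r * m) 3 u v))"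
proof -
  have v0: "(\<Sum>u\<in>Fq q. \<Sum>z\<in>UNIV. e (u * z)) = of_nat (q ^ m)"
    unfolding e_sum using Fq_0 by (simp add: q power_mult)
  show ?thesis
    unfolding AS_count_product_sum[where Z = UNIV and \<beta> = \<beta> and h = "\<lambda>z. z powi 3"] S_sum_def
    by (subst sum.remove[OF _ Fq_0]) (simp_all add: e_0 v0)
qed

text \<open>The added terms \<open>q\<close> and \<open>AS_count \<beta>\<close> count the places
  over \<open>F_q\<close> and over infinity. They cancel: \<open>v = 0\<close> contributes
  \<open>q^m - q\<close>, while \<open>u = 0\<close> contributes \<open>- e (\<beta> v)\<close> for
  each \<open>v \<noteq> 0\<close>, in total \<open>1 - AS_count \<beta>\<close>.\<close>

lemma count_inverse:
  "(\<Sum>z\<in>UNIV - {0}. of_nat (AS_count z) * of_nat (AS_count (\<beta> + z powi (-1))) :: complex) + of_nat q + of_nat (AS_count \<beta>) =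
    of_nat (q ^ m) + 1 + (\<Sum>v\<in>Fq q - {0}. e (\<beta> * v) * (\<Sum>u\<in>Fq q - {0}. S_sum p (r * m) (-1) u v))"
proof -
  let ?Z = "UNIV - {0 :: 'k}"
  have minus0: "(\<Sum>z\<in>?Z. f z) = (\<Sum>z\<in>UNIV. f z) - f 0" for f :: "'k \<Rightarrow> complex"
    by (subst (2) sum.remove[of _ 0]) auto
  have inv: "(\<Sum>z\<in>?Z. f (z powi (-1))) = (\<Sum>z\<in>?Z. f z)" for f :: "'k \<Rightarrow> complex"
    by (rule sum.reindex_bij_witness[of _ inverse inverse]) (auto simp: power_int_minus)
  have v0: "(\<Sum>u\<in>Fq q. \<Sum>z\<in>?Z. e (u * z)) = of_nat (q ^ m) - of_nat q"
    unfolding minus0 sum_subtractf e_sum using Fq_0 by (simp add: q power_mult e_0 card_Fq[unfolded q])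
  have u0: "(\<Sum>z\<in>?Z. e (v * z powi (-1))) = -1" if "v \<noteq> 0" for v
    unfolding inv[of "\<lambda>z. e (v * z)"] minus0 e_sum using that by (simp add: e_0)
  have c: "(\<Sum>v\<in>Fq q - {0}. e (\<beta> * v)) = of_nat (AS_count \<beta>) - 1"
  proof -
    have "of_nat (AS_count \<beta>) = (\<Sum>v\<in>Fq q. e (\<beta> * v))" by (simp add: AS_count_character mult.commute)
    also have "\<dots> = e 0 + (\<Sum>v\<in>Fq q - {0}. e (\<beta> * v))" by (subst sum.remove[OF _ Fq_0]) simp_all
    finally show ?thesis by (simp add: e_0)
  qed
  have "(\<Sum>z\<in>?Z. of_nat (AS_count z) * of_nat (AS_count (\<beta> + z powi (-1))) :: complex)
    = of_nat (q ^ m) - of_nat q + (\<Sum>v\<in>Fq q - {0}. e (\<beta> * v) * (\<Sum>u\<in>Fq q. \<Sum>z\<in>?Z. e (u * z + v * z powi (-1))))"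
    unfolding AS_count_product_sum[where Z = ?Z and \<beta> = \<beta> and h = "\<lambda>z. z powi (-1)"]
    by (subst sum.remove[OF _ Fq_0]) (simp_all add: e_0 v0)
  also have "(\<Sum>v\<in>Fq q - {0}. e (\<beta> * v) * (\<Sum>u\<in>Fq q. \<Sum>z\<in>?Z. e (u * z + v * z powi (-1)))) =
    (\<Sum>v\<in>Fq q - {0}. e (\<beta> * v) * (- 1 + (\<Sum>u\<in>Fq q - {0}. S_sum p (r * m) (-1) u v)))"
  proof (intro sum.cong refl arg_cong2[where f = "(*)"])
    fix v :: 'k assume v: "v \<in> Fq q - {0}"
    show "(\<Sum>u\<in>Fq q. \<Sum>z\<in>?Z. e (u * z + v * z powi (-1))) = - 1 + (\<Sum>u\<in>Fq q - {0}. S_sum p (r * m) (-1) u v)"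
      using u0[of v] v by (subst sum.remove[OF _ Fq_0]) (simp_all add: S_sum_def)
  qed
  also have "\<dots> = (\<Sum>v\<in>Fq q - {0}. e (\<beta> * v) * (\<Sum>u\<in>Fq q - {0}. S_sum p (r * m) (-1) u v)) - (\<Sum>v\<in>Fq q - {0}. e (\<beta> * v))"
    by (simp add: right_diff_distrib sum_subtractf)
  finally show ?thesis unfolding c by simp
qed

end

section \<open>Places of the two families\<close>

context field_emb
begin

lemma rats_eqI: "z \<in> rats w \<Longrightarrow> w \<in> rats z \<Longrightarrow> rats z = rats w"
  using rats_basic(1) by (intro subset_antisym rats_subset is_subfield_rats) auto

lemma ev_pcompose: "ev \<iota> (pcompose f g) z = ev \<iota> f (ev \<iota> g z)"
  by (induction f) (auto simp: pcompose_pCons)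

lemma transcendental_shift:
  assumes "\<And>f. f \<noteq> 0 \<Longrightarrow> ev \<iota> f t \<noteq> 0" "f \<noteq> 0"
  shows "ev \<iota> f (t - \<iota> c) \<noteq> 0"
proof -
  have "pcompose f [:- c, 1:] \<noteq> 0" using assms(2) by (simp add: pcompose_eq_0_iff)
  from assms(1)[OF this] show ?thesis by (simp add: ev_pcompose)
qed

text \<open>The reversed polynomial turns an equation of \<open>1 / t\<close> into one of
  \<open>t\<close>.\<close>

lemma transcendental_inverse:
  assumes "\<And>f. f \<noteq> 0 \<Longrightarrow> ev \<iota> f t \<noteq> 0" "f \<noteq> 0"
  shows "ev \<iota> f (inverse t) \<noteq> 0"
proof -
  have t0: "t \<noteq> 0" using assms(1)[of "[:0, 1:]"] by auto
  have "map_poly \<iota> (reflect_poly f) = reflect_poly (map_poly \<iota> f)"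
    by (rule poly_eqI) (auto simp: coeff_map_poly coeff_reflect_poly degree_map_poly)
  then have "ev \<iota> (reflect_poly f) t = t ^ degree f * ev \<iota> f (inverse t)"
    using t0 by (simp add: ev_def poly_reflect_poly_nz degree_map_poly)
  moreover have "reflect_poly f \<noteq> 0" using assms(2) by simp
  ultimately show ?thesis using assms(1) by (metis mult_zero_right)
qed

lemma rats_shift: "rats (t - \<iota> c) = rats t"
proof (rule rats_eqI)
  have "t - \<iota> c = ev \<iota> [:- c, 1:] t" "t = ev \<iota> [:c, 1:] (t - \<iota> c)" by simp_all
  then show "t - \<iota> c \<in> rats t" "t \<in> rats (t - \<iota> c)" using rats_basic(3) by metis+
qed

lemma rats_inverse: "rats (inverse t) = rats t"
  using is_subfieldD(2)[OF is_subfield_rats] rats_basic(2) by (intro rats_eqI) (auto, metis inverse_inverse_eq)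

end

section \<open>Totally ramified places\<close>

context AS_ext
begin

lemma t_simps: "t \<noteq> 0" "t ^ q - t \<noteq> 0"
proof -
  show "t \<noteq> 0" using tr[of "[:0, 1:]"] by auto
  have "coeff (monom 1 q - monom 1 1 :: 'k poly) q = 1" using q2 by (simp add: coeff_monom)
  then have "monom 1 q - monom 1 1 \<noteq> (0 :: 'k poly)" by (metis coeff_0 zero_neq_one)
  from tr[OF this] show "t ^ q - t \<noteq> 0" by simp
qed

lemma shift_facts:
  "rats (t - \<iota> c) = rats t" "t - \<iota> c \<in> L" "f \<noteq> 0 \<Longrightarrow> ev \<iota> f (t - \<iota> c) \<noteq> 0"
proof -
  have "\<iota> c \<in> L" using L_facts(2) by blast
  then show "t - \<iota> c \<in> L" using L_facts(5) is_subringD(3)[OF is_subfieldD(1)[OF L_facts(1)]] by blast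
qed (use rats_shift transcendental_shift[OF tr] in auto)

lemma inverse_facts:
  "rats (inverse t) = rats t" "inverse t \<in> L" "f \<noteq> 0 \<Longrightarrow> ev \<iota> f (inverse t) \<noteq> 0"
  using rats_inverse L_facts(5) is_subfieldD(2)[OF L_facts(1)] transcendental_inverse[OF tr] by auto

text \<open>The relation in \<open>ab\<close> gives \<open>\<tau>\<close> order \<open>q\<close>,
  and the last condition gives \<open>s\<close> a pole of order \<open>n q + 1\<close>. The first
  yields the single place, both together the independence of the powers of \<open>s\<close>.\<close>

lemma ramified_place:
  assumes \<tau>: "rats \<tau> = rats t" "\<tau> \<in> L" "\<And>f. f \<noteq> 0 \<Longrightarrow> ev \<iota> f \<tau> \<noteq> 0"
    and s: "s \<in> gen_field {\<pi>, \<tau>}"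
    and ab: "a \<in> gen_ring {\<pi>, \<tau>}" "b \<in> gen_ring {\<pi>, \<tau>}" "\<tau> * a = \<pi> ^ q * b"
    and dom: "\<And>V. valuation_ring \<iota> L V \<Longrightarrow> \<tau> \<in> nonunits V \<Longrightarrow>
      \<pi> \<in> nonunits V \<and> \<pi> \<noteq> 0 \<and> a \<in> valued_field.U V \<and> b \<in> valued_field.U V
      \<and> s * \<pi> ^ (n * q + 1) \<in> valued_field.U V"
  shows "card {V \<in> rational_rings L. \<tau> \<in> nonunits V} = 1" "AS_ext_irred \<iota> q t s L"
proof -
  have "L \<subseteq> gen_field {\<pi>, \<tau>}" unfolding Lts
  proof (rule gen_field_least)
    have "rats \<tau> \<subseteq> gen_field {\<pi>, \<tau>}" using gen_field by (intro rats_subset) auto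
    then show "{t, s} \<subseteq> gen_field {\<pi>, \<tau>}" using s \<tau>(1) rats_basic(2)[of t] by auto
  qed (use gen_field in auto)
  then show "card {V \<in> rational_rings L. \<tau> \<in> nonunits V} = 1"
    using q2 dom by (intro card_ramified[OF L_facts(1,2) \<tau>(2,3) algebraic[OF \<tau>(1)] _ _ ab]) auto
  obtain V where V: "valuation_ring \<iota> L V" "\<tau> \<in> nonunits V"
    using ex_valuation_ring[OF L_facts(1,2) \<tau>(2,3)] by blast
  interpret v: valued_field \<iota> L V by unfold_locales (fact L_facts V)+
  note d = dom[OF V]
  have "a \<noteq> 0" using d v.U_facts(2)[of a] by blast
  then have eq: "\<tau> = \<pi> ^ q * (b / a)" using ab(3) by (simp add: field_simps)
  have u: "b / a \<in> v.U" using d v.U_facts(6) by blast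
  show "AS_ext_irred \<iota> q t s L"
  proof unfold_locales
    fix f assume f: "coeffs_in (rats t) f" "degree f < q" "f \<noteq> 0"
    show "poly f s \<noteq> 0"
      by (rule v.ramified_independent[of q \<pi> \<tau> "b / a" s n "s * \<pi> ^ (n * q + 1)" f])
        (use d q2 eq u f \<tau>(1) in auto)
  qed
qed

text \<open>Multiplied by \<open>\<tau>^(2q+1)\<close>, the equation has the right-hand side
  \<open>b\<close> with residue \<open>- \<kappa>\<close>, a unit. Written in \<open>\<pi>\<close>
  and \<open>\<tau>\<close> it becomes \<open>\<tau> a = \<pi>^q b\<close>.\<close>

lemma cubic_at_infinity:
  assumes "\<kappa> \<noteq> 0" and g: "s ^ q - s = \<iota> \<beta> - \<iota> \<kappa> * t ^ (2 * q + 1) + \<iota> \<kappa> * t ^ (q + 2)"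
  shows "card {V \<in> rational_rings L. inverse t \<in> nonunits V} = 1" "AS_ext_irred \<iota> q t s L"
proof -
  define \<tau> where "\<tau> = inverse t"
  \<comment> \<open>Expected orders are \<open>q\<close> for \<open>\<tau>\<close> and
    \<open>-(2q + 1)\<close> for \<open>s\<close>, so \<open>s \<tau>^2\<close> should have a simple
    pole.\<close>
  define \<pi> where "\<pi> = inverse (s * \<tau> ^ 2)"
  define b where "b = \<iota> \<beta> * \<tau> ^ (2 * q + 1) - \<iota> \<kappa> + \<iota> \<kappa> * \<tau> ^ (q - 1)"
  define a where "a = 1 - \<tau> ^ (2 * q - 2) * \<pi> ^ (q - 1)"
  obtain k where k: "q = Suc (Suc k)" using q2 by (metis Suc_le_D add_2_eq_Suc le_add_diff_inverse)
  have \<tau>0: "\<tau> \<noteq> 0" "t = inverse \<tau>" using t_simps by (auto simp: \<tau>_def)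
  have gb: "\<tau> ^ (2 * q + 1) * (s ^ q - s) = b"
  proof -
    have t\<tau>: "t ^ i * \<tau> ^ i = 1" for i using t_simps(1) by (simp add: \<tau>_def flip: power_mult_distrib)
    have "2 * q + 1 = (q + 2) + (q - 1)" using q2 by simp
    then have "t ^ (q + 2) * \<tau> ^ (2 * q + 1) = \<tau> ^ (q - 1)"
      using t\<tau>[of "q + 2"] by (metis mult.assoc mult_1 power_add)
    moreover have "\<tau> ^ (2 * q + 1) * (s ^ q - s) = \<iota> \<beta> * \<tau> ^ (2 * q + 1)
      - \<iota> \<kappa> * (t ^ (2 * q + 1) * \<tau> ^ (2 * q + 1)) + \<iota> \<kappa> * (t ^ (q + 2) * \<tau> ^ (2 * q + 1))"
      unfolding g by (simp only: ring_distribs mult_ac)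
    ultimately show ?thesis unfolding t\<tau> b_def by simp
  qed
  note rg = is_subringD[OF gen_ring(1)[of "{\<pi>, \<tau>}"]]
  have res_b: "b \<in> valued_field.U V" if hV: "valuation_ring \<iota> L V" "\<tau> \<in> nonunits V" for V
  proof -
    interpret valued_field \<iota> L V by unfold_locales (fact L_facts hV)+
    have r\<tau>: "res (\<tau> ^ i) 0" if "i > 0" for i using hV(2) that by (auto simp: res_0 intro: power_M)
    have "res b (\<beta> * 0 - \<kappa> + \<kappa> * 0)"
      unfolding b_def using q2 by (intro res_arith res_const r\<tau>) auto
    then show ?thesis using res_U assms(1) by simp
  qed
  obtain V where "valuation_ring \<iota> L V" "\<tau> \<in> nonunits V"
    using ex_valuation_ring[OF L_facts(1,2) inverse_facts(2,3)] unfolding \<tau>_def by blast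
  then interpret v: valued_field \<iota> L V by unfold_locales (rule L_facts(1))
  have "b \<noteq> 0" using res_b v.V \<open>\<tau> \<in> nonunits V\<close> v.U_facts(2) by blast
  have "s \<noteq> 0"
  proof
    assume "s = 0"
    then show False using gb \<open>b \<noteq> 0\<close> q2 by (simp add: power_0_left)
  qed
  have \<pi>0: "\<pi> \<noteq> 0" "s = inverse (\<pi> * \<tau> ^ 2)" using \<open>s \<noteq> 0\<close> \<tau>0 by (auto simp: \<pi>_def)
  have rel: "\<tau> * a = \<pi> ^ q * b"
    unfolding gb[symmetric] a_def \<pi>0(2) k using \<tau>0(1) \<pi>0(1) by (simp add: field_simps power_add power_mult_distrib power2_eq_square mult_2_right)
  have dom: "\<pi> \<in> nonunits V \<and> \<pi> \<noteq> 0 \<and> a \<in> valued_field.U V \<and> b \<in> valued_field.U V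
      \<and> s * \<pi> ^ (2 * q + 1) \<in> valued_field.U V" if hV: "valuation_ring \<iota> L V" "\<tau> \<in> nonunits V" for V
  proof -
    interpret valued_field \<iota> L V by unfold_locales (fact L_facts hV)+
    have bU: "b \<in> U" using res_b[OF hV] .
    have \<pi>M: "\<pi> \<in> M"
    proof (rule ccontr)
      assume n: "\<pi> \<notin> M"
      \<comment> \<open>If \<open>\<pi>\<close> were not in \<open>M\<close>, then
        \<open>\<rho>\<close> would be in \<open>V\<close> and the equation would make the unit
        \<open>b\<close> a multiple of \<open>\<tau>\<close>.\<close>
      define \<rho> where "\<rho> = s * \<tau> ^ 2"
      have \<rho>: "\<rho> = inverse \<pi>" by (simp add: \<rho>_def \<pi>_def)
      have "\<pi> \<in> L" unfolding \<pi>_def \<tau>_def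
        using L_facts is_subfieldD[OF L_facts(1)] is_subringD[OF is_subfieldD(1)[OF L_facts(1)]] by simp
      then have "\<rho> \<in> V" unfolding \<rho> using n unitD(2)[of \<pi>] inverse_M[of \<pi>] M_facts(1) by blast
      then have "\<tau> * (\<rho> ^ q - \<tau> ^ (2 * q - 2) * \<rho>) \<in> M"
        using hV(2) M_facts(1)[OF hV(2)] by (intro M_facts(5)) (auto intro!: V_ring)
      moreover have "\<tau> * (\<rho> ^ q - \<tau> ^ (2 * q - 2) * \<rho>) = b"
        unfolding gb[symmetric] \<rho>_def k using \<tau>0(1) by (simp add: field_simps power_add power_mult_distrib power2_eq_square mult_2_right)
      ultimately show False using bU U_facts(10) by simp
    qed
    have aU: "a \<in> U"
    proof -
      have "\<tau> ^ (2 * q - 2) * \<pi> ^ (q - 1) \<in> M"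
        using hV(2) \<pi>M q2 by (intro M_facts(5) V_ring power_M M_facts(1)) auto
      then have "1 + - (\<tau> ^ (2 * q - 2) * \<pi> ^ (q - 1)) \<in> U" by (intro U_facts(9) U_facts(3) M_facts(6))
      then show ?thesis by (simp add: a_def)
    qed
    have "a / b \<in> U" using aU bU U_facts(6) by blast
    then have "(a / b) ^ 2 \<in> U" by (rule U_facts(7))
    \<comment> \<open>By \<open>s = 1 / (\<pi> \<tau>^2)\<close> the product is
      \<open>(\<pi>^q / \<tau>)^2\<close>, so the pole order of \<open>s\<close> is
      \<open>n q + 1\<close> with \<open>n = 2\<close>.\<close>
    moreover have "s * \<pi> ^ (2 * q + 1) = (a / b) ^ 2"
    proof -
      have "a / b = \<pi> ^ q / \<tau>" using rel \<tau>0(1) \<open>b \<noteq> 0\<close> by (simp add: field_simps)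
      then have "(a / b) ^ 2 = \<pi> ^ (2 * q) / \<tau> ^ 2"
        by (simp add: power_divide mult.commute flip: power_mult)
      moreover have "s * \<pi> ^ (2 * q + 1) = \<pi> ^ (2 * q) / \<tau> ^ 2"
        unfolding \<pi>0(2) using \<tau>0(1) \<pi>0(1) by (simp add: field_simps)
      ultimately show ?thesis by simp
    qed
    ultimately show ?thesis using \<pi>M \<pi>0 aU bU by simp
  qed
  have R: "\<tau> \<in> gen_ring {\<pi>, \<tau>}" "\<pi> \<in> gen_ring {\<pi>, \<tau>}" "\<iota> c \<in> gen_ring {\<pi>, \<tau>}" for c
    using gen_ring by auto
  have aR: "a \<in> gen_ring {\<pi>, \<tau>}" "b \<in> gen_ring {\<pi>, \<tau>}"
    unfolding a_def b_def using R by (auto intro!: rg)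
  have sF: "s \<in> gen_field {\<pi>, \<tau>}"
    unfolding \<pi>0(2) using gen_field(3)[of _ "{\<pi>, \<tau>}"]
    by (intro is_subfieldD(2)[OF gen_field(1)] is_subringD(4,7)[OF is_subfieldD(1)[OF gen_field(1)]]) auto
  show "card {V \<in> rational_rings L. inverse t \<in> nonunits V} = 1" "AS_ext_irred \<iota> q t s L"
    using ramified_place[OF inverse_facts(1-3)[folded \<tau>_def] sF aR rel dom] by (auto simp: \<tau>_def)
qed

text \<open>As \<open>c^q = c\<close>, the equation reads
  \<open>(\<tau>^q - \<tau>) (s^q - s - \<beta>) = 1\<close>. So \<open>s\<close> has a pole, and
  multiplying by \<open>\<pi>^q\<close> with \<open>\<pi> = 1 / s\<close> gives
  \<open>\<tau> a = \<pi>^q\<close> where \<open>a\<close> has residue -1. The pole of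
  \<open>s\<close> is simple, which is the case \<open>n = 0\<close>.\<close>

lemma inverse_at_Fq:
  assumes g: "s ^ q - s = \<iota> \<beta> + inverse (t ^ q - t)" and c: "c \<in> Fq q"
  shows "card {V \<in> rational_rings L. t - \<iota> c \<in> nonunits V} = 1" "AS_ext_irred \<iota> q t s L"
proof -
  define \<tau> where "\<tau> = t - \<iota> c"
  define \<pi> where "\<pi> = inverse s"
  define a where "a = (\<tau> ^ (q - 1) - 1) * (1 - \<pi> ^ (q - 1) - \<iota> \<beta> * \<pi> ^ q)"
  obtain k where k: "q = Suc (Suc k)" using q2 by (metis Suc_le_D add_2_eq_Suc le_add_diff_inverse)
  have "\<iota> c ^ q = \<iota> c" using c by (simp add: Fq_def flip: emb_simps(7))
  then have \<tau>q: "\<tau> ^ q - \<tau> = t ^ q - t" by (simp add: \<tau>_def frob_diff)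
  have rel0: "(\<tau> ^ q - \<tau>) * (s ^ q - s - \<iota> \<beta>) = 1" unfolding \<tau>q g using t_simps by simp
  have dom0: "s \<notin> V" if hV: "valuation_ring \<iota> L V" "\<tau> \<in> nonunits V" for V
  proof
    interpret valued_field \<iota> L V by unfold_locales (fact L_facts hV)+
    assume "s \<in> V"
    then have "(\<tau> ^ q - \<tau>) * (s ^ q - s - \<iota> \<beta>) \<in> M"
      using hV(2) q2 by (intro M_facts(5,7) power_M) (auto intro!: V_ring V_facts)
    then show False using rel0 M_facts(8) by simp
  qed
  obtain V where V: "valuation_ring \<iota> L V" "\<tau> \<in> nonunits V"
    using ex_valuation_ring[OF L_facts(1,2) shift_facts(2,3)] unfolding \<tau>_def by blast
  then interpret v: valued_field \<iota> L V by unfold_locales (rule L_facts(1))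
  have s0: "s \<noteq> 0" using dom0[OF V] v.V_ring(2) by auto
  have rel: "\<tau> * a = \<pi> ^ q * 1"
  proof -
    have "s ^ q * (\<tau> * a) = (\<tau> ^ q - \<tau>) * (s ^ q - s - \<iota> \<beta>)"
      unfolding a_def \<pi>_def k using s0 by (simp add: field_simps)
    then have "s ^ q * (\<tau> * a) = 1" using rel0 by simp
    then show ?thesis unfolding \<pi>_def using s0 by (simp add: field_simps)
  qed
  have dom: "\<pi> \<in> nonunits V \<and> \<pi> \<noteq> 0 \<and> a \<in> valued_field.U V \<and> 1 \<in> valued_field.U V
      \<and> s * \<pi> ^ (0 * q + 1) \<in> valued_field.U V" if hV: "valuation_ring \<iota> L V" "\<tau> \<in> nonunits V" for V
  proof -
    interpret valued_field \<iota> L V by unfold_locales (fact L_facts hV)+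
    have \<pi>M: "\<pi> \<in> M" unfolding \<pi>_def using inverse_M[OF L_facts(4) dom0[OF hV]] .
    have r: "res (\<tau> ^ i) 0" "res (\<pi> ^ i) 0" if "i > 0" for i
      using hV(2) \<pi>M that by (auto simp: res_0 intro: power_M)
    have "res a ((0 - 1) * (1 - 0 - \<beta> * 0))"
      unfolding a_def using q2 by (intro res_arith res_const res_1 r) auto
    then have "a \<in> U" using res_U by simp
    then show ?thesis using \<pi>M s0 U_facts(3) by (simp add: \<pi>_def)
  qed
  have R: "\<tau> \<in> gen_ring {\<pi>, \<tau>}" "\<pi> \<in> gen_ring {\<pi>, \<tau>}" "\<iota> c \<in> gen_ring {\<pi>, \<tau>}" for c
    using gen_ring by auto
  note rg = is_subringD[OF gen_ring(1)[of "{\<pi>, \<tau>}"]]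
  have aR: "a \<in> gen_ring {\<pi>, \<tau>}" "1 \<in> gen_ring {\<pi>, \<tau>}"
    unfolding a_def using R by (auto intro!: rg)
  have "inverse \<pi> \<in> gen_field {\<pi>, \<tau>}" using gen_field(3)[of \<pi> "{\<pi>, \<tau>}"] is_subfieldD(2)[OF gen_field(1)] by blast
  then have sF: "s \<in> gen_field {\<pi>, \<tau>}" by (simp add: \<pi>_def)
  show "card {V \<in> rational_rings L. t - \<iota> c \<in> nonunits V} = 1" "AS_ext_irred \<iota> q t s L"
    using ramified_place[OF shift_facts(1-3)[where c = c, folded \<tau>_def] sF aR rel dom] by (auto simp: \<tau>_def)
qed

end

section \<open>Unramified places\<close>

context AS_ext_irred
begin

lemma polynomial_place:
  assumes "s ^ q - s = ev \<iota> P t"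
  shows "finite {V \<in> rational_rings L. t - \<iota> c \<in> nonunits V}"
    "card {V \<in> rational_rings L. t - \<iota> c \<in> nonunits V} = card {u. u ^ q - u = poly P c}"
proof -
  \<comment> \<open>The quotient of \<open>P - P(c)\<close> by \<open>X - c\<close>, rewritten as a
    polynomial in \<open>t - c\<close>.\<close>
  define G where "G = pcompose (synthetic_div P c) [:c, 1:]"
  have "(s ^ q - s - \<iota> (poly P c)) * ev \<iota> 1 (t - \<iota> c) = (t - \<iota> c) * ev \<iota> G (t - \<iota> c)"
  proof -
    have "ev \<iota> P t = (t - \<iota> c) * ev \<iota> (synthetic_div P c) t + \<iota> (poly P c)"
      using arg_cong[OF synthetic_div_correct'[of c P], of "\<lambda>f. ev \<iota> f t"] by (simp add: algebra_simps)
    then show ?thesis using assms by (simp add: G_def ev_pcompose)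
  qed
  then show "finite {V \<in> rational_rings L. t - \<iota> c \<in> nonunits V}"
    "card {V \<in> rational_rings L. t - \<iota> c \<in> nonunits V} = card {u. u ^ q - u = poly P c}"
    using unramified_places[OF shift_facts(1-3)[where c = c], where \<gamma> = "poly P c" and H = 1 and G = G] by simp_all
qed

text \<open>With \<open>x = c^q - c\<close> and \<open>\<tau> = t - c\<close> one has
  \<open>t^q - t = x + \<tau>^q - \<tau>\<close>, hence \<open>1 / (t^q - t) - 1 / x = (\<tau> -
  \<tau>^q) / (x (x + \<tau>^q - \<tau>))\<close>. This is the origin of \<open>G\<close> and
  \<open>H\<close>.\<close>

lemma inverse_place:
  assumes g: "s ^ q - s = \<iota> \<beta> + inverse (t ^ q - t)" and c: "c ^ q - c \<noteq> 0"
  shows "finite {V \<in> rational_rings L. t - \<iota> c \<in> nonunits V}"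
    "card {V \<in> rational_rings L. t - \<iota> c \<in> nonunits V} = card {u. u ^ q - u = \<beta> + inverse (c ^ q - c)}"
proof -
  define x where "x = c ^ q - c"
  define \<tau> where "\<tau> = t - \<iota> c"
  define H where "H = smult x ([:x:] + monom 1 q - monom 1 1)"
  define G :: "'k poly" where "G = 1 - monom 1 (q - 1)"
  obtain k where k: "q = Suc k" using q2 by (cases q) auto
  have \<tau>q: "\<tau> ^ q - \<tau> = (t ^ q - t) - \<iota> x" by (simp add: \<tau>_def x_def frob_diff)
  have \<tau>q': "\<iota> x + \<tau> ^ q - \<tau> = t ^ q - t" using \<tau>q by (simp add: algebra_simps)
  have "ev \<iota> H \<tau> = \<iota> x * (\<iota> x + \<tau> ^ q - \<tau>)" by (simp add: H_def)
  then have H: "ev \<iota> H \<tau> = \<iota> x * (t ^ q - t)" unfolding \<tau>q' .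
  have "x \<noteq> 0" using c by (simp add: x_def)
  then have x0: "\<iota> x \<noteq> 0" by simp
  have "(s ^ q - s - \<iota> (\<beta> + inverse x)) * ev \<iota> H \<tau> = \<tau> * ev \<iota> G \<tau>"
  proof -
    have "(s ^ q - s - \<iota> (\<beta> + inverse x)) * ev \<iota> H \<tau> = (inverse (t ^ q - t) - inverse (\<iota> x)) * (\<iota> x * (t ^ q - t))"
      unfolding g H by simp
    also have "\<dots> = \<iota> x - (t ^ q - t)"
    proof -
      have "(inverse y - inverse w) * (w * y) = w - y" if "y \<noteq> 0" "w \<noteq> 0" for y w :: 'l
        using that by (simp add: field_simps)
      then show ?thesis using x0 t_simps(2) by blast
    qed
    also have "\<dots> = \<tau> - \<tau> ^ q" using \<tau>q by (simp add: algebra_simps)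
    also have "\<dots> = \<tau> * ev \<iota> G \<tau>" by (simp add: G_def k algebra_simps)
    finally show ?thesis .
  qed
  moreover have "poly H 0 \<noteq> 0" using c q2 by (simp add: H_def poly_monom x_def power_0_left)
  ultimately show "finite {V \<in> rational_rings L. t - \<iota> c \<in> nonunits V}"
    "card {V \<in> rational_rings L. t - \<iota> c \<in> nonunits V} = card {u. u ^ q - u = \<beta> + inverse (c ^ q - c)}"
    using unramified_places[OF shift_facts(1-3)[where c = c], where \<gamma> = "\<beta> + inverse x" and H = H and G = G] by (simp_all add: \<tau>_def x_def)
qed

text \<open>In \<open>\<tau> = 1 / t\<close> one has
  \<open>1 / (t^q - t) = \<tau>^q / (1 - \<tau>^(q-1))\<close>, which vanishes at infinity and
  leaves the value \<open>\<beta>\<close>.\<close>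

lemma inverse_at_infinity:
  assumes g: "s ^ q - s = \<iota> \<beta> + inverse (t ^ q - t)"
  shows "finite {V \<in> rational_rings L. inverse t \<in> nonunits V}"
    "card {V \<in> rational_rings L. inverse t \<in> nonunits V} = card {u. u ^ q - u = \<beta>}"
proof -
  define \<tau> where "\<tau> = inverse t"
  define H :: "'k poly" where "H = 1 - monom 1 (q - 1)"
  define G :: "'k poly" where "G = monom 1 (q - 1)"
  obtain k where k: "q = Suc k" using q2 by (cases q) auto
  have "(s ^ q - s - \<iota> \<beta>) * ev \<iota> H \<tau> = \<tau> * ev \<iota> G \<tau>"
  proof -
    have "t ^ q * ev \<iota> H \<tau> = t ^ q - t"
      unfolding H_def \<tau>_def k using t_simps(1) by (simp add: field_simps)
    then have "ev \<iota> H \<tau> = \<tau> ^ q * (t ^ q - t)"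
      unfolding \<tau>_def using t_simps(1) by (simp add: field_simps)
    then have "(s ^ q - s - \<iota> \<beta>) * ev \<iota> H \<tau> = \<tau> ^ q" unfolding g using t_simps(2) by simp
    then show ?thesis by (simp add: G_def k)
  qed
  moreover have "poly H 0 \<noteq> 0" using q2 by (simp add: H_def poly_monom power_0_left)
  ultimately show "finite {V \<in> rational_rings L. inverse t \<in> nonunits V}"
    "card {V \<in> rational_rings L. inverse t \<in> nonunits V} = card {u. u ^ q - u = \<beta>}"
    using unramified_places[OF inverse_facts(1-3), where \<gamma> = \<beta> and H = H and G = G] by (simp_all add: \<tau>_def)
qed

end

section \<open>The number of rational places\<close>

text \<open>If \<open>t\<close> were algebraic over the finite field \<open>K\<close>, then
  \<open>K[t]\<close> would be finite, by reduction modulo an equation of \<open>t\<close>. Two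
  powers of \<open>x\<close> would then coincide, and \<open>x\<close> would be algebraic.\<close>

lemma (in field_emb) transcendental_if_mem_pols:
  fixes t x :: 'l
  assumes fin: "finite (UNIV :: 'k set)" and tr: "transcendental_over \<iota> x" and x: "x \<in> pols t" and "f \<noteq> 0"
  shows "ev \<iota> f t \<noteq> 0"
proof
  assume f: "ev \<iota> f t = 0"
  have "x ^ i \<in> pols t" for i using x is_subringD(7)[OF is_subring_pols] by blast
  moreover have "pols t \<subseteq> (\<lambda>g. ev \<iota> g t) ` {g. degree g \<le> degree f}"
  proof
    fix y assume "y \<in> pols t"
    then obtain g where g: "y = ev \<iota> g t" by (auto simp: pols_def)
    have "degree (g mod f) \<le> degree f" using degree_mod_less[OF assms(4), of g] by auto
    moreover have "ev \<iota> g t = ev \<iota> (g div f * f + g mod f) t" by simp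
    then have "y = ev \<iota> (g mod f) t" using g f by (simp only: ev_simps) simp
    ultimately show "y \<in> (\<lambda>g. ev \<iota> g t) ` {g. degree g \<le> degree f}" by blast
  qed
  moreover have "finite {g :: 'k poly. degree g \<le> degree f}"
  proof -
    have "{g :: 'k poly. degree g \<le> degree f} \<subseteq> Poly ` {xs. set xs \<subseteq> UNIV \<and> length xs \<le> Suc (degree f)}"
    proof
      fix g :: "'k poly" assume "g \<in> {g. degree g \<le> degree f}"
      then have "length (coeffs g) \<le> Suc (degree f)" by (cases "g = 0") (auto simp: length_coeffs_degree)
      then show "g \<in> Poly ` {xs. set xs \<subseteq> UNIV \<and> length xs \<le> Suc (degree f)}"
        by (intro image_eqI[of _ _ "coeffs g"]) auto
    qed
    then show ?thesis using finite_lists_length_le[OF fin] finite_subset by blast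
  qed
  ultimately have "finite (range (\<lambda>i. x ^ i))" by (meson finite_imageI finite_subset image_subsetI subset_trans)
  then obtain i j where "i \<noteq> j" "x ^ i = x ^ j"
    using finite_imageD[of "\<lambda>i. x ^ i" "UNIV :: nat set"] by (auto simp: inj_on_def)
  define h :: "'k poly" where "h = monom 1 i - monom 1 j"
  have "coeff h i = 1" using \<open>i \<noteq> j\<close> by (simp add: h_def coeff_monom)
  then have "h \<noteq> 0" by auto
  moreover have "ev \<iota> h x = 0" using \<open>x ^ i = x ^ j\<close> by (simp add: h_def)
  ultimately show False using tr by (auto simp: transcendental_over_def ev_def)
qed

theorem theorem2p2:
  fixes p q r m :: nat and d :: int
    and a b \<beta> :: "'k::{finite,field}"
    and \<iota> :: "'k \<Rightarrow> 'l::field"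
    and x ya yb :: 'l and L :: "'l set"
  assumes "prime p" and "r \<ge> 1" and "q = p ^ r" and "m \<ge> 1"
    and "card (UNIV :: 'k set) = q ^ m"
    and "a \<in> Fq q" and "b \<in> Fq q" and "a \<noteq> b"
    and "d \<in> {-1, 3}" and "d = 3 \<longrightarrow> p \<noteq> 3"
    and "field_embedding \<iota>"
    and "transcendental_over \<iota> x"
    and "ya ^ q - ya = x + \<iota> a * (\<iota> \<beta> + x powi d)"
    and "yb ^ q - yb = x + \<iota> b * (\<iota> \<beta> + x powi d)"
    and "L = is_subfield hull (range \<iota> \<union> {x, ya, yb})"
  shows "finite (rational_places \<iota> L) \<and>
    of_nat (card (rational_places \<iota> L)) =
      (of_nat (q ^ m) + 1 +
        (\<Sum>v\<in>Fq q - {0}. add_char p (r * m) (\<beta> * v) *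
          (\<Sum>u\<in>(if d = -1 then Fq q - {0} else Fq q). S_sum p (r * m) d u v)) :: complex)"
proof -
  interpret field_emb \<iota> by unfold_locales fact
  interpret finite_field_qm p r m "TYPE('k)" q
    using assms(1-5) by unfold_locales (auto simp: power_mult)
  have "of_nat p = (0 :: 'l)" using of_nat_p emb_simps(10)[of p] emb_simps(2) by simp
  then have CHAR_L: "CHAR('l) = p" by (rule CHAR_eq_prime[OF assms(1)])
  have frob_L: "(y + z :: 'l) ^ q = y ^ q + z ^ q" for y z
    unfolding assms(3) by (rule freshmans_dream') (use CHAR_L assms(1) in auto)
  have frob_L': "(y - z :: 'l) ^ q = y ^ q - z ^ q" for y z
    using frob_L[of "y - z" z] by (simp add: algebra_simps)
  have Fq_L: "\<iota> c ^ q = \<iota> c" if "c \<in> Fq q" for c using that by (simp add: Fq_def flip: emb_simps(7))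
  note Fab = Fq_L[OF assms(6)] Fq_L[OF assms(7)]
  define \<delta> where "\<delta> = \<iota> (a - b)"
  have \<delta>: "\<delta> \<noteq> 0" "\<delta> = \<iota> a - \<iota> b" "\<delta> ^ q = \<delta>" using assms(8) Fab by (auto simp: \<delta>_def frob_L')
  \<comment> \<open>\<open>t\<close> and \<open>s\<close> solve
    \<open>ya = t + \<iota> a * s\<close>, \<open>yb = t + \<iota> b * s\<close>. As
    \<open>a\<close> and \<open>b\<close> lie in \<open>F_q\<close>, the map
    \<open>y \<mapsto> y^q - y\<close> respects these coefficients, and the two defining equations
    separate.\<close>
  define t where "t = (\<iota> a * yb - \<iota> b * ya) / \<delta>"
  define s where "s = (ya - yb) / \<delta>"
  have t: "t ^ q - t = x"
  proof -
    have "t ^ q - t = (\<iota> a * (yb ^ q - yb) - \<iota> b * (ya ^ q - ya)) / \<delta>"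
      unfolding t_def power_divide frob_L' power_mult_distrib Fab \<delta>(3)
      by (simp add: diff_divide_distrib add_divide_distrib algebra_simps)
    also have "\<iota> a * (yb ^ q - yb) - \<iota> b * (ya ^ q - ya) = \<delta> * x"
      unfolding assms(13,14) \<delta>(2) by (simp add: algebra_simps)
    finally show ?thesis using \<delta>(1) by simp
  qed
  have s: "s ^ q - s = \<iota> \<beta> + x powi d"
  proof -
    have "s ^ q - s = ((ya ^ q - ya) - (yb ^ q - yb)) / \<delta>"
      unfolding s_def power_divide frob_L' \<delta>(3) by (simp add: diff_divide_distrib add_divide_distrib algebra_simps)
    also have "(ya ^ q - ya) - (yb ^ q - yb) = \<delta> * (\<iota> \<beta> + x powi d)"
      unfolding assms(13,14) \<delta>(2) by (simp add: algebra_simps)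
    finally show ?thesis using \<delta>(1) by simp
  qed
  have y: "ya = t + \<iota> a * s" "yb = t + \<iota> b * s"
    using \<delta>(1) by (simp_all add: t_def s_def field_simps) (simp_all add: \<delta>(2) algebra_simps)
  have L0: "L = gen_field {x, ya, yb}" using assms(15) by (simp add: gen_field_def)
  have Lts: "L = gen_field {t, s}"
    unfolding L0
  proof (rule gen_field_eqI)
    note f1 = is_subringD[OF is_subfieldD(1)[OF gen_field(1)[of "{t, s}"]]]
    note f2 = is_subringD[OF is_subfieldD(1)[OF gen_field(1)[of "{x, ya, yb}"]]]
    have "t \<in> gen_field {t, s}" "s \<in> gen_field {t, s}" by (auto intro: gen_field(3))
    then show "{x, ya, yb} \<subseteq> gen_field {t, s}" unfolding t[symmetric] y using gen_field(2) f1 by auto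
    have "ya \<in> gen_field {x, ya, yb}" "yb \<in> gen_field {x, ya, yb}" by (auto intro: gen_field(3))
    then show "{t, s} \<subseteq> gen_field {x, ya, yb}" unfolding t_def s_def \<delta>_def
      using gen_field(2) f2 is_subfieldD(3)[OF gen_field(1)] by simp
  qed
  have xt: "x \<in> pols t" using t pols_basic(2)[of t] is_subringD[OF is_subring_pols[of t]] by metis
  have tr: "ev \<iota> f t \<noteq> 0" if "f \<noteq> 0" for f
    using transcendental_if_mem_pols[OF finite assms(12) xt that] .
  have x_rat: "x \<in> rats t" using xt pols_subset_rats by blast
  have Lsub: "is_subfield L" unfolding Lts by (rule gen_field(1))
  have places: "finite (rational_places \<iota> L) \<and> card (rational_places \<iota> L) = card (rational_rings L)"
    if "finite (rational_rings L)"
    using rational_places_eq[OF Lsub] that by (simp add: card_image)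
  show ?thesis
  proof (cases "d = -1")
    case True
    have g: "s ^ q - s = \<iota> \<beta> + inverse (t ^ q - t)" using s True t by (simp add: power_int_minus)
    interpret AS_ext \<iota> q t s L
    proof unfold_locales
      have "x powi d \<in> rats t" using x_rat is_subfieldD(4)[OF is_subfield_rats] by blast
      then show "s ^ q - s \<in> rats t"
        unfolding s using rats_basic(1) is_subringD(6)[OF is_subfieldD(1)[OF is_subfield_rats]] by blast
    qed (fact q_ge_2 card_Fq frob_L Lts tr)+
    interpret AS_ext_irred \<iota> q t s L using inverse_at_Fq(2)[OF g Fq_0] .
    have cnt: "finite {V \<in> rational_rings L. t - \<iota> c \<in> nonunits V} \<and>
      card {V \<in> rational_rings L. t - \<iota> c \<in> nonunits V} =
        (if c ^ q - c = 0 then 1 else AS_count (\<beta> + (c ^ q - c) powi (-1)))" for c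
    proof (cases "c ^ q - c = 0")
      case True
      then have "card {V \<in> rational_rings L. t - \<iota> c \<in> nonunits V} = 1"
        by (intro inverse_at_Fq[OF g]) (simp add: Fq_def)
      \<comment> \<open>Cardinality 1 includes finiteness, because \<open>card\<close> is 0 on
        infinite sets.\<close>
      then show ?thesis using True by (simp add: card_eq_0_iff[symmetric] card_ge_0_finite)
    next
      case False
      then show ?thesis using inverse_place[OF g False] by (simp add: AS_count_def power_int_minus)
    qed
    note inf = inverse_at_infinity[OF g]
    have RR: "finite (rational_rings L)" "of_nat (card (rational_rings L)) =
      (\<Sum>c\<in>UNIV. if c ^ q - c = 0 then 1 else of_nat (AS_count (\<beta> + (c ^ q - c) powi (-1)))) + (of_nat (AS_count \<beta>) :: complex)"
    proof -
      show "finite (rational_rings L)" using card_rational_rings(1) cnt inf by blast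
      have "card (rational_rings L) = (\<Sum>c\<in>UNIV. if c ^ q - c = 0 then 1 else AS_count (\<beta> + (c ^ q - c) powi (-1))) + AS_count \<beta>"
        using card_rational_rings(2) cnt inf by (simp add: AS_count_def)
      then show "of_nat (card (rational_rings L)) =
        (\<Sum>c\<in>UNIV. if c ^ q - c = 0 then 1 else of_nat (AS_count (\<beta> + (c ^ q - c) powi (-1)))) + (of_nat (AS_count \<beta>) :: complex)"
        by (simp add: if_distrib[of of_nat] cong: if_cong)
    qed
    have "(\<Sum>c\<in>UNIV. if c ^ q - c = 0 then 1 else of_nat (AS_count (\<beta> + (c ^ q - c) powi (-1))) :: complex)
      = (\<Sum>z\<in>UNIV. of_nat (AS_count z) * (if z = 0 then 1 else of_nat (AS_count (\<beta> + z powi (-1)))))"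
      by (rule sum_over_AS_map[of "\<lambda>z. if z = 0 then 1 else of_nat (AS_count (\<beta> + z powi (-1)))"])
    also have "\<dots> = of_nat (AS_count 0) + (\<Sum>z\<in>UNIV - {0}. of_nat (AS_count z) * of_nat (AS_count (\<beta> + z powi (-1))))"
      by (subst sum.remove[of _ 0]) auto
    \<comment> \<open>The fibre over 0 is \<open>F_q\<close>, whose elements each carry one ramified
      place.\<close>
    also have "AS_count 0 = q" using AS_count_image[of 0] q_ge_2 by (simp add: power_0_left)
    finally show ?thesis
      using places[OF RR(1)] RR(2) count_inverse[of \<beta>] True by (simp add: algebra_simps)
  next
    case False
    then have d3: "d = 3" "p \<noteq> 3" using assms(9,10) by auto
    define \<kappa> :: 'k where "\<kappa> = of_nat 3"
    have \<kappa>0: "\<kappa> \<noteq> 0"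
    proof
      assume "\<kappa> = 0"
      then have "p dvd 3" using of_nat_eq_0_iff_char_dvd[where ?'a = 'k, of 3] CHAR_K by (simp add: \<kappa>_def)
      moreover have "prime (3::nat)" by simp
      ultimately show False using d3 assms(1) primes_dvd_imp_eq by blast
    qed
    define s' where "s' = s - t ^ 3"
    have cube: "(u - v) ^ 3 = u ^ 3 - 3 * u ^ 2 * v + 3 * u * v ^ 2 - v ^ 3" for u v :: "'c::comm_ring_1"
      by (simp add: power3_eq_cube power2_eq_square algebra_simps)
    have pw: "u ^ (2 * q + 1) = (u ^ q) ^ 2 * u" "u ^ (q + 2) = u ^ q * u ^ 2" "(u ^ 3) ^ q = (u ^ q) ^ 3"
      for u :: "'c::comm_ring_1"
      by (simp add: mult.commute flip: power_mult, simp only: power_add, simp add: mult.commute flip: power_mult)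
    have \<iota>\<kappa>: "\<iota> \<kappa> = 3" unfolding \<kappa>_def emb_simps(10) by simp
    have g: "s' ^ q - s' = \<iota> \<beta> - \<iota> \<kappa> * t ^ (2 * q + 1) + \<iota> \<kappa> * t ^ (q + 2)"
    proof -
      have "s' ^ q - s' = (s ^ q - s) - (t ^ q) ^ 3 + t ^ 3" by (simp add: s'_def frob_L' pw)
      also have "s ^ q - s = \<iota> \<beta> + (t ^ q - t) ^ 3" using s d3(1) t by simp
      finally show ?thesis unfolding cube pw \<iota>\<kappa> by (simp add: algebra_simps)
    qed
    define P where "P = [:\<beta>:] - monom \<kappa> (2 * q + 1) + monom \<kappa> (q + 2)"
    have gP: "s' ^ q - s' = ev \<iota> P t" unfolding g P_def by simp
    interpret AS_ext \<iota> q t s' L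
    proof unfold_locales
      show "L = gen_field {t, s'}" unfolding Lts
      proof (rule gen_field_eqI)
        note f1 = is_subringD[OF is_subfieldD(1)[OF gen_field(1)[of "{t, s}"]]]
        note f2 = is_subringD[OF is_subfieldD(1)[OF gen_field(1)[of "{t, s'}"]]]
        have "t \<in> gen_field {t, s}" "s \<in> gen_field {t, s}" by (auto intro: gen_field(3))
        then show "{t, s'} \<subseteq> gen_field {t, s}" unfolding s'_def using f1 by auto
        have t2: "t \<in> gen_field {t, s'}" "s' \<in> gen_field {t, s'}" by (auto intro: gen_field(3))
        then have "s' + t ^ 3 \<in> gen_field {t, s'}" by (intro f2(6,7))
        then show "{t, s} \<subseteq> gen_field {t, s'}" using t2 by (simp add: s'_def)
      qed
      show "s' ^ q - s' \<in> rats t" unfolding gP by (rule rats_basic(3))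
    qed (fact q_ge_2 card_Fq frob_L tr)+
    note inf = cubic_at_infinity[OF \<kappa>0 g]
    interpret AS_ext_irred \<iota> q t s' L by (rule inf(2))
    \<comment> \<open>The replacement of \<open>s\<close> by \<open>s - t^3\<close> shifts the value
      at \<open>c\<close> by \<open>(c^3)^q - c^3\<close>, which does not change the number of
      solutions; so the count can be stated with the original right-hand side.\<close>
    have P: "AS_count (poly P c) = AS_count (\<beta> + (c ^ q - c) powi 3)" for c
    proof -
      have "poly P c = \<beta> - \<kappa> * ((c ^ q) ^ 2 * c) + \<kappa> * (c ^ q * c ^ 2)"
        unfolding pw[symmetric] by (simp add: P_def poly_monom)
      then have "\<beta> + (c ^ q - c) powi 3 = poly P c + ((c ^ 3) ^ q - c ^ 3)"
        by (simp add: \<kappa>_def cube pw(3) algebra_simps)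
      then show ?thesis by (simp only: AS_count_shift)
    qed
    have fin_inf: "finite {V \<in> rational_rings L. inverse t \<in> nonunits V}"
      using inf(1) by (intro card_ge_0_finite) simp
    note pl = polynomial_place[OF gP]
    have fin: "finite (rational_rings L)" using card_rational_rings(1) pl(1) fin_inf by blast
    have "card (rational_rings L) = (\<Sum>c\<in>UNIV. AS_count (\<beta> + (c ^ q - c) powi 3)) + 1"
      using card_rational_rings(2)[OF pl(1) fin_inf] unfolding inf(1) pl(2) AS_count_def[symmetric] P .
    then have "of_nat (card (rational_rings L)) =
      (\<Sum>c\<in>UNIV. of_nat (AS_count (\<beta> + (c ^ q - c) powi 3))) + (1 :: complex)" by simp
    also have "(\<Sum>c\<in>UNIV. of_nat (AS_count (\<beta> + (c ^ q - c) powi 3)) :: complex) =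
      (\<Sum>z\<in>UNIV. of_nat (AS_count z) * of_nat (AS_count (\<beta> + z powi 3)))"
      by (rule sum_over_AS_map[of "\<lambda>z. of_nat (AS_count (\<beta> + z powi 3))"])
    finally show ?thesis
      using places[OF fin] count_cubic[of \<beta>] d3(1) by simp
  qed
qed

end
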